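(* Fix $0<k<n$. Let $\beta$ be a plane partition of size $k\times(n-k)$ having a plateau with corner at $(a,b)$, where $1\le a\le k$, $1\le b\le n-k$. Assume the plateau has positive fall, and let $\beta'$ be the plane partition obtained from $\beta$ by adding one box in position $(a,b)$ (that is, $\beta'_{a,b}=\beta_{a,b}+1$ and $\beta'_{i,j}=\beta_{i,j}$ otherwise). Then there is a strict containment $\overline{\mathcal C}_\beta\supsetneq\overline{\mathcal C}_{\beta'}$.
   Context: Work over $\mathbb C$. $G(k,n)$: Grassmannian of $k$-dimensional subspaces of $\mathbb C^n$. $F_i\subset\mathbb C^n$: span of the last $i$ standard basis vectors. For $1\le a\le k$, $1\le b\le n-k$, $\Omega_{(b^a)}=\{V\in G(k,n)\mid\dim V\cap F_{n-k+a-b}\ge a\}$ (reduced). $J_\infty G(k,n)$ is the arc space; points with residue field $K$ are arcs $\operatorname{Spec}K[[t]]\to G(k,n)$. $\operatorname{ord}_\Lambda(Y)=e$ means the ideal of $Y$ pulls back to $(t^e)$ ($t^\infty=0$). Put $\alpha_{i,j}=\operatorname{ord}_\Lambda(\Omega_{(j^i)})$ for $1\le i\le k,1\le j\le n-k$ and $\alpha_{i,j}=0$ if $i>k$ or $j>n-k$. The invariant factor profile of $\Lambda$ is $\beta_{i,j}=\alpha_{i,j}-\alpha_{i+1,j+1}$ ($1\le i\le k,1\le j\le n-k$), with $\infty-x=\infty$. A plane partition is a $k\times(n-k)$ matrix with entries in $\{0,1,\ldots,\infty\}$ non-increasing along rows and columns. $\mathcal C_\beta\subset J_\infty G(k,n)$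 is the set of arcs with invariant factor profile $\beta$; $\overline{\mathcal C}_\beta$ is its Zariski closure in $J_\infty G(k,n)$. A plane partition $\beta$ has a plateau up to position $(a,b)$ (called the corner of the plateau) if there is a number $h$ (the height) such that $\beta_{i,j}=h$ whenever $i\le a$, $j\le b$ and $(i,j)\ne(a,b)$; if $(a,b)=(1,1)$ one sets $h=\infty$. If $h$ is finite, the fall is $h-\beta_{a,b}$. If $h$ is infinite, the fall is $0$ if $\beta_{a,b}=\infty$ and $\infty$ if $\beta_{a,b}<\infty$. *)

theory Defs
  imports
    "HOL-Analysis.Sum_Topology"
    "HOL-Algebra.Ideal"
    "HOL-Library.Poly_Mapping"
    "HOL-Library.Extended_Nat"
    "HOL-Computational_Algebra.Formal_Power_Series"
    "HOL-Computational_Algebra.Fraction_Field"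
    "Jordan_Normal_Form.VS_Connect"
    "Jordan_Normal_Form.DL_Submatrix"
begin

section \<open>Grassmannian and Schubert varieties\<close>

abbreviation cspace :: "nat \<Rightarrow> (complex, complex vec) module" where
  "cspace n \<equiv> module_vec TYPE(complex) n"

definition subspace_dim :: "nat \<Rightarrow> complex vec set \<Rightarrow> nat" where
  "subspace_dim n W = vectorspace.dim class_ring ((cspace n)\<lparr>carrier := W\<rparr>)"

definition grassmannian :: "nat \<Rightarrow> nat \<Rightarrow> complex vec set set" where
  "grassmannian k n = {V. VectorSpace.subspace class_ring V (cspace n) \<and> subspace_dim n V = k}"

definition flag :: "nat \<Rightarrow> nat \<Rightarrow> complex vec set" where
  "flag n i = LinearCombinations.module.span class_ring (cspace n) (unit_vec n ` {n - i..<n})"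

text \<open>The Schubert variety of the rectangle with \<open>a\<close> rows and \<open>b\<close> columns, as a set of
  complex points. Its reduced structure enters through \<open>chart_ideal\<close> below.\<close>

definition schubert_rect :: "nat \<Rightarrow> nat \<Rightarrow> nat \<Rightarrow> nat \<Rightarrow> complex vec set set" where
  "schubert_rect k n a b = {V \<in> grassmannian k n. a \<le> subspace_dim n (V \<inter> flag n (n - k + a - b))}"

section \<open>Polynomials over the complex numbers in countably many variables\<close>

type_synonym cpoly = "(nat \<Rightarrow>\<^sub>0 nat) \<Rightarrow>\<^sub>0 complex"

definition var :: "nat \<Rightarrow> cpoly" where
  "var v = Poly_Mapping.single (Poly_Mapping.single v 1) 1"

definition const :: "complex \<Rightarrow> cpoly" where
  "const c = Poly_Mapping.single 0 c"

definition vars :: "cpoly \<Rightarrow> nat set" where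
  "vars f = (\<Union>m\<in>Poly_Mapping.keys f. Poly_Mapping.keys m)"

text \<open>Value of \<open>f\<close> at \<open>x\<close> in a ring made into a complex algebra by \<open>\<phi>\<close>.\<close>

definition eval_poly :: "(complex \<Rightarrow> 'r::comm_ring_1) \<Rightarrow> (nat \<Rightarrow> 'r) \<Rightarrow> cpoly \<Rightarrow> 'r" where
  "eval_poly \<phi> x f = (\<Sum>m\<in>Poly_Mapping.keys f.
     \<phi> (Poly_Mapping.lookup f m) * (\<Prod>v\<in>Poly_Mapping.keys m. x v ^ Poly_Mapping.lookup m v))"

section \<open>Standard charts\<close>

definition charts :: "nat \<Rightarrow> nat \<Rightarrow> nat set set" where
  "charts k n = {I. I \<subseteq> {..<n} \<and> card I = k}"

text \<open>The chart \<open>U\<^sub>I\<close> consists of the subspaces having a basis whose matrix has the identity in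
  the columns \<open>I\<close>. It is an affine space of dimension \<open>k * (n - k)\<close>; the coordinate with number
  \<open>i * (n - k) + j\<close> is the entry of that matrix in row \<open>i\<close> and in the \<open>j\<close>-th column not in \<open>I\<close>
  (counting from 0).\<close>

definition chart_mat :: "nat \<Rightarrow> nat \<Rightarrow> nat set \<Rightarrow> (nat \<Rightarrow> 'r::comm_ring_1) \<Rightarrow> 'r mat" where
  "chart_mat k n I x = mat k n (\<lambda>(i, c).
     if c \<in> I then (if card (I \<inter> {..<c}) = i then 1 else 0)
     else x (i * (n - k) + card ({..<c} - I)))"

text \<open>The ideal of \<open>Y \<inter> U\<^sub>I\<close> (with its reduced structure) in the coordinate ring of \<open>U\<^sub>I\<close>.\<close>

definition chart_ideal :: "nat \<Rightarrow> nat \<Rightarrow> nat set \<Rightarrow> complex vec set set \<Rightarrow> cpoly set" where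
  "chart_ideal k n I Y = {f. vars f \<subseteq> {..<k * (n - k)} \<and>
     (\<forall>x. vec_space.row_space n (chart_mat k n I x) \<in> Y \<longrightarrow> eval_poly id x f = 0)}"

section \<open>The arc space\<close>

text \<open>The arc space of \<open>U\<^sub>I\<close> is the spectrum of the ring \<^typ>\<open>cpoly\<close>, where the variable with
  number \<open>m * (k * (n - k)) + v\<close> is the coefficient of \<open>t\<^sup>m\<close> of the coordinate number \<open>v\<close>
  of the arc, for \<open>v < k * (n - k)\<close>. If \<open>0 < k < n\<close>, every natural number is the number of exactly
  one such coefficient. A prime ideal \<open>P\<close> is the arc over the residue field of \<open>P\<close> that is
  obtained from the universal arc by reducing coefficients modulo \<open>P\<close>.\<close>

definition prime_spec :: "cpoly set set" where
  "prime_spec = {P. primeideal P class_ring}"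

definition zariski :: "cpoly set topology" where
  "zariski = topology_generated_by (range (\<lambda>f. {P \<in> prime_spec. f \<notin> P}))"

definition universal_coord :: "nat \<Rightarrow> nat \<Rightarrow> nat \<Rightarrow> cpoly fps" where
  "universal_coord k n v = Abs_fps (\<lambda>m. var (m * (k * (n - k)) + v))"

definition universal_arc :: "nat \<Rightarrow> nat \<Rightarrow> nat set \<Rightarrow> cpoly fps mat" where
  "universal_arc k n I = chart_mat k n I (universal_coord k n)"

text \<open>The transition from the chart \<open>I\<close> to the chart \<open>J\<close>. On the open set where the constant
  coefficient of the minor of \<^const>\<open>universal_arc\<close> in the columns \<open>J\<close> does not vanish,
  the submatrix in these columns can be made the identity by left multiplication with its inverse
  (the adjugate divided by the minor). This takes place in power series over the field of
  fractions of \<^typ>\<open>cpoly\<close>; the coefficients of the result lie in the localization at that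
  constant coefficient.\<close>

definition transition_minor :: "nat \<Rightarrow> nat \<Rightarrow> nat set \<Rightarrow> nat set \<Rightarrow> cpoly" where
  "transition_minor k n I J = fps_nth (det (submatrix (universal_arc k n I) UNIV J)) 0"

definition transition_mat :: "nat \<Rightarrow> nat \<Rightarrow> nat set \<Rightarrow> nat set \<Rightarrow> cpoly fract fps mat" where
  "transition_mat k n I J =
     (let M = map_mat (\<lambda>g. Abs_fps (\<lambda>m. Fract (fps_nth g m) 1)) (universal_arc k n I);
          S = submatrix M UNIV J
      in inverse (det S) \<cdot>\<^sub>m (adj_mat S * M))"

definition transition_hom :: "nat \<Rightarrow> nat \<Rightarrow> nat set \<Rightarrow> nat set \<Rightarrow> cpoly \<Rightarrow> cpoly fract" where
  "transition_hom k n I J = eval_poly (\<lambda>c. Fract (const c) 1)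
     (\<lambda>w. let m = w div (k * (n - k)); v = w mod (k * (n - k)) in
        fps_nth (transition_mat k n I J $$ (v div (n - k), pick ({..<n} - J) (v mod (n - k)))) m)"

definition local_max_ideal :: "cpoly set \<Rightarrow> cpoly fract set" where
  "local_max_ideal P = {Fract p q |p q. p \<in> P \<and> q \<notin> P}"

definition chart_points :: "nat \<Rightarrow> nat \<Rightarrow> (nat set \<times> cpoly set) topology" where
  "chart_points k n = sum_topology (\<lambda>_. zariski) (charts k n)"

text \<open>\<open>(I, P)\<close> and \<open>(J, Q)\<close> are the same point of the arc space: \<open>P\<close> lies in the arc space
  of \<open>U\<^sub>I \<inter> U\<^sub>J\<close>, and the transition map sends it to \<open>Q\<close>.\<close>

definition glue :: "nat \<Rightarrow> nat \<Rightarrow> ((nat set \<times> cpoly set) \<times> (nat set \<times> cpoly set)) set" where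
  "glue k n = {((I, P), (J, Q)). I \<in> charts k n \<and> J \<in> charts k n \<and> P \<in> prime_spec \<and>
     transition_minor k n I J \<notin> P \<and> Q = transition_hom k n I J -` local_max_ideal P}"

definition arc_point :: "nat \<Rightarrow> nat \<Rightarrow> nat set \<times> cpoly set \<Rightarrow> (nat set \<times> cpoly set) set" where
  "arc_point k n z = glue k n `` {z}"

definition quotient_topology :: "'a topology \<Rightarrow> ('a \<Rightarrow> 'b) \<Rightarrow> 'b topology" where
  "quotient_topology X f =
     topology (\<lambda>U. U \<subseteq> f ` topspace X \<and> openin X {x \<in> topspace X. f x \<in> U})"

lemma openin_quotient_topology:
  "openin (quotient_topology X f) U \<longleftrightarrow>
     U \<subseteq> f ` topspace X \<and> openin X {x \<in> topspace X. f x \<in> U}"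
proof -
  have "istopology (\<lambda>U. U \<subseteq> f ` topspace X \<and> openin X {x \<in> topspace X. f x \<in> U})"
    unfolding istopology_def
  proof (intro conjI allI impI)
    fix S T
    assume S: "S \<subseteq> f ` topspace X \<and> openin X {x \<in> topspace X. f x \<in> S}"
      and T: "T \<subseteq> f ` topspace X \<and> openin X {x \<in> topspace X. f x \<in> T}"
    show "S \<inter> T \<subseteq> f ` topspace X" using S by blast
    have "{x \<in> topspace X. f x \<in> S \<inter> T}
        = {x \<in> topspace X. f x \<in> S} \<inter> {x \<in> topspace X. f x \<in> T}" by blast
    then show "openin X {x \<in> topspace X. f x \<in> S \<inter> T}" using S T by (simp only: openin_Int)
  next
    fix K
    assume K: "\<forall>S\<in>K. S \<subseteq> f ` topspace X \<and> openin X {x \<in> topspace X. f x \<in> S}"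
    show "\<Union>K \<subseteq> f ` topspace X" using K by blast
    have "{x \<in> topspace X. f x \<in> \<Union>K} = (\<Union>S\<in>K. {x \<in> topspace X. f x \<in> S})" by blast
    then show "openin X {x \<in> topspace X. f x \<in> \<Union>K}"
      using K by (simp only:) (blast intro: openin_Union)
  qed
  then show ?thesis unfolding quotient_topology_def by (subst topology_inverse') (assumption, rule refl)
qed

lemma topspace_quotient_topology: "topspace (quotient_topology X f) = f ` topspace X"
proof
  show "topspace (quotient_topology X f) \<subseteq> f ` topspace X"
    using openin_topspace[of "quotient_topology X f"] unfolding openin_quotient_topology by blast
  have "{x \<in> topspace X. f x \<in> f ` topspace X} = topspace X" by blast
  then have "openin (quotient_topology X f) (f ` topspace X)"
    by (simp add: openin_quotient_topology)
  then show "f ` topspace X \<subseteq> topspace (quotient_topology X f)" by (rule openin_subset)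
qed

lemma quotient_map_quotient_topology: "quotient_map X (quotient_topology X f) f"
  by (simp add: quotient_map_def topspace_quotient_topology openin_quotient_topology)

definition arc_space :: "nat \<Rightarrow> nat \<Rightarrow> (nat set \<times> cpoly set) set topology" where
  "arc_space k n = quotient_topology (chart_points k n) (arc_point k n)"

section \<open>Contact orders and invariant factor profiles\<close>

text \<open>Order of the reduction modulo \<open>P\<close> of a power series; the zero series has order infinity.\<close>

definition ord_mod :: "cpoly set \<Rightarrow> cpoly fps \<Rightarrow> enat" where
  "ord_mod P g = Inf (enat ` {m. fps_nth g m \<notin> P})"

text \<open>Over a field, a set of power series generates the ideal \<open>(t\<^sup>e)\<close>, where \<open>e\<close> is the
  infimum of the orders of its elements.\<close>

definition arc_ord :: "nat \<Rightarrow> nat \<Rightarrow> complex vec set set \<Rightarrow> nat set \<times> cpoly set \<Rightarrow> enat" where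
  "arc_ord k n Y = (\<lambda>(I, P). INF f\<in>chart_ideal k n I Y.
     ord_mod P (eval_poly (\<lambda>c. fps_const (const c)) (universal_coord k n) f))"

definition schubert_ord :: "nat \<Rightarrow> nat \<Rightarrow> nat set \<times> cpoly set \<Rightarrow> nat \<Rightarrow> nat \<Rightarrow> enat" where
  "schubert_ord k n z i j =
     (if i \<in> {1..k} \<and> j \<in> {1..n - k} then arc_ord k n (schubert_rect k n i j) z else 0)"

text \<open>Subtraction on \<^typ>\<open>enat\<close> satisfies \<open>\<infinity> - x = \<infinity>\<close> for all \<open>x\<close>, including \<open>x = \<infinity>\<close>.\<close>

definition profile :: "nat \<Rightarrow> nat \<Rightarrow> nat set \<times> cpoly set \<Rightarrow> nat \<Rightarrow> nat \<Rightarrow> enat" where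
  "profile k n z i j = schubert_ord k n z i j - schubert_ord k n z (i + 1) (j + 1)"

text \<open>Only the entries of \<open>\<beta>\<close> in rows \<open>1..k\<close> and columns \<open>1..n - k\<close> matter, here and below.\<close>

definition contact_stratum ::
    "nat \<Rightarrow> nat \<Rightarrow> (nat \<Rightarrow> nat \<Rightarrow> enat) \<Rightarrow> (nat set \<times> cpoly set) set set" where
  "contact_stratum k n \<beta> = arc_point k n `
     {z \<in> topspace (chart_points k n). \<forall>i\<in>{1..k}. \<forall>j\<in>{1..n - k}. profile k n z i j = \<beta> i j}"

section \<open>Plane partitions and plateaus\<close>

definition plane_partition :: "nat \<Rightarrow> nat \<Rightarrow> (nat \<Rightarrow> nat \<Rightarrow> enat) \<Rightarrow> bool" where
  "plane_partition r c \<beta> \<longleftrightarrow>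
     (\<forall>i\<in>{1..r}. \<forall>j\<in>{1..c}. \<forall>j'\<in>{1..c}. j \<le> j' \<longrightarrow> \<beta> i j' \<le> \<beta> i j) \<and>
     (\<forall>j\<in>{1..c}. \<forall>i\<in>{1..r}. \<forall>i'\<in>{1..r}. i \<le> i' \<longrightarrow> \<beta> i' j \<le> \<beta> i j)"

definition has_plateau :: "(nat \<Rightarrow> nat \<Rightarrow> enat) \<Rightarrow> nat \<Rightarrow> nat \<Rightarrow> enat \<Rightarrow> bool" where
  "has_plateau \<beta> a b h \<longleftrightarrow>
     (\<forall>i\<in>{1..a}. \<forall>j\<in>{1..b}. (i, j) \<noteq> (a, b) \<longrightarrow> \<beta> i j = h) \<and>
     ((a, b) = (1, 1) \<longrightarrow> h = \<infinity>)"

definition plateau_fall :: "(nat \<Rightarrow> nat \<Rightarrow> enat) \<Rightarrow> nat \<Rightarrow> nat \<Rightarrow> enat \<Rightarrow> enat" where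
  "plateau_fall \<beta> a b h =
     (if h = \<infinity> then (if \<beta> a b = \<infinity> then 0 else \<infinity>) else h - \<beta> a b)"

definition add_box :: "(nat \<Rightarrow> nat \<Rightarrow> enat) \<Rightarrow> nat \<Rightarrow> nat \<Rightarrow> nat \<Rightarrow> nat \<Rightarrow> enat" where
  "add_box \<beta> a b = (\<lambda>i j. if (i, j) = (a, b) then \<beta> i j + 1 else \<beta> i j)"

end

(* By a Nullstellensatz for countably many variables over an uncountable field, it suffices to work
with closed points, that is, with matrices A over the complex power series that contain an identity
block. The contact order with the (i, j)-th Schubert variety is the least order of a minor of size
k - i + 1 of the first c = k - i + j columns of A, so the profile entry (i, j) is the invariant factor
number k - i (counting from 0) of these columns. With c = k - a + b and r = k - a, the plateau forces
estimates on the column c and on the linear form that cuts out the first c - 1 columns; these allow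
a rank-one perturbation of the first c columns, with a factor s, that for small s other than 0 lowers
their r-th invariant factor by one and preserves the invariant factors of the first c' columns for
all other c'. As s tends to 0 this arc of profile beta tends coefficientwise to the given one. The
containment is strict because the contact order at (a, b) is finite and constant on each stratum,
larger by one on the smaller stratum, and upper semicontinuous. *)

theory Submission
  imports Defs "HOL-Computational_Algebra.Fundamental_Theorem_Algebra"
    "HOL-Analysis.Continuum_Not_Denumerable" "HOL-Computational_Algebra.Polynomial_FPS"
begin

section \<open>Polynomial evaluation and closed points\<close>

text \<open>The obstacle is rigidity: one invariant factor of one initial block of columns must drop
  by one while those of all shorter and longer blocks stay. Semicontinuity gives one inequality for
  free, so it is enough that the other blocks arise from the old ones by multiplication with some
  matrix of power series, invertible or not. This dictates the rank-one term: t^(g-1), where g is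
  the exponent to be lowered, times a column vector and a row vector. After multiplication by
  t^(g-1) the column vector has to be a combination of the first c + 1 columns, and the row vector,
  restricted to the first c - 1 columns, a combination of rows. The four neighbours of the corner
  supply such vectors. The other delicate point is the contact order. The ideal of the reduced
  variety consists of all functions vanishing on it, so a lower bound must hold for every such
  function. It comes from replacing some diagonal entries of a Smith form by 0: with few entries
  left the arc lies in the Schubert variety, and a function vanishing on all these arcs has on the
  full arc at least the order of the smallest product of enough diagonal entries.\<close>

lemma cpoly_induct [case_names single add]:
  fixes p :: cpoly
  assumes s: "\<And>m c. Q (Poly_Mapping.single m c)" and a: "\<And>p q. Q p \<Longrightarrow> Q q \<Longrightarrow> Q (p + q)"
  shows "Q p"
proof -
  have "Q (\<Sum>m\<in>S. Poly_Mapping.single m (Poly_Mapping.lookup p m))" if "finite S" for S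
    using that
  proof (induction S rule: finite_induct)
    case empty
    then show ?case using s[of 0 0] by simp
  next
    case (insert m S)
    then show ?case using s a by simp
  qed
  moreover have "p = (\<Sum>m\<in>Poly_Mapping.keys p. Poly_Mapping.single m (Poly_Mapping.lookup p m))"
    by (rule poly_mapping_eqI) (simp add: lookup_sum lookup_single when_def in_keys_iff)
  ultimately show ?thesis by (metis finite_keys)
qed

definition monom_eval :: "(nat \<Rightarrow> 'r::comm_ring_1) \<Rightarrow> (nat \<Rightarrow>\<^sub>0 nat) \<Rightarrow> 'r" where
  "monom_eval x m = (\<Prod>v\<in>Poly_Mapping.keys m. x v ^ Poly_Mapping.lookup m v)"

lemma monom_eval_superset:
  assumes "finite S" "Poly_Mapping.keys m \<subseteq> S"
  shows "monom_eval x m = (\<Prod>v\<in>S. x v ^ Poly_Mapping.lookup m v)"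
  unfolding monom_eval_def
  by (rule prod.mono_neutral_left[OF assms]) (simp add: in_keys_iff)

lemma monom_eval_0 [simp]: "monom_eval x 0 = 1"
  by (simp add: monom_eval_def)

lemma monom_eval_add: "monom_eval x (m + m') = monom_eval x m * monom_eval x m'"
proof -
  let ?S = "Poly_Mapping.keys m \<union> Poly_Mapping.keys m'"
  have "Poly_Mapping.keys (m + m') \<subseteq> ?S" by (rule keys_add)
  then show ?thesis
    by (simp add: monom_eval_superset[of ?S] lookup_add power_add prod.distrib)
qed

lemma eval_poly_alt:
  "eval_poly \<phi> x f = (\<Sum>m\<in>Poly_Mapping.keys f. \<phi> (Poly_Mapping.lookup f m) * monom_eval x m)"
  by (simp add: eval_poly_def monom_eval_def)

lemma eval_poly_single:
  assumes "\<phi> 0 = 0"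
  shows "eval_poly \<phi> x (Poly_Mapping.single m c) = \<phi> c * monom_eval x m"
  using assms by (cases "c = 0") (simp_all add: eval_poly_alt)

context
  fixes \<phi> :: "complex \<Rightarrow> 'r::comm_ring_1"
  assumes hom: "comm_ring_hom \<phi>"
begin

interpretation \<phi>: comm_ring_hom \<phi> by (fact hom)

lemma eval_poly_add: "eval_poly \<phi> x (f + g) = eval_poly \<phi> x f + eval_poly \<phi> x g"
  unfolding eval_poly_alt
  by (rule setsum_keys_plus_distrib) (simp_all add: \<phi>.hom_add distrib_right)

lemma eval_poly_0: "eval_poly \<phi> x 0 = 0"
  by (simp add: eval_poly_alt)

lemma eval_poly_mult: "eval_poly \<phi> x (f * g) = eval_poly \<phi> x f * eval_poly \<phi> x g"
proof (induction f rule: cpoly_induct)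
  case (single m c)
  show ?case
  proof (induction g rule: cpoly_induct)
    case (single m' c')
    then show ?case
      by (simp add: mult_single eval_poly_single monom_eval_add \<phi>.hom_mult mult_ac)
  next
    case (add p q)
    then show ?case by (simp add: distrib_left eval_poly_add)
  qed
next
  case (add p q)
  then show ?case by (simp add: distrib_right eval_poly_add)
qed

lemma comm_ring_hom_eval_poly: "comm_ring_hom (eval_poly \<phi> x)"
proof
  show "eval_poly \<phi> x 1 = 1"
    using eval_poly_single[of \<phi> x 0 1] by simp
qed (simp_all add: eval_poly_0 eval_poly_add eval_poly_mult)

lemma eval_poly_const: "eval_poly \<phi> x (const c) = \<phi> c"
  by (simp add: const_def eval_poly_single)

lemma eval_poly_var: "eval_poly \<phi> x (var v) = x v"
  by (simp add: var_def eval_poly_single monom_eval_def)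

end

lemma hom_eval_poly:
  assumes "comm_ring_hom \<psi>"
  shows "\<psi> (eval_poly \<phi> x f) = eval_poly (\<lambda>c. \<psi> (\<phi> c)) (\<lambda>v. \<psi> (x v)) f"
proof -
  interpret \<psi>: comm_ring_hom \<psi> by fact
  show ?thesis
    by (simp add: eval_poly_def \<psi>.hom_sum \<psi>.hom_mult \<psi>.hom_prod \<psi>.hom_power)
qed

lemma eval_poly_cong:
  assumes "\<And>v. v \<in> vars f \<Longrightarrow> x v = y v"
  shows "eval_poly \<phi> x f = eval_poly \<phi> y f"
proof -
  have "x v = y v" if "v \<in> Poly_Mapping.keys m" "m \<in> Poly_Mapping.keys f" for v m
    using that by (intro assms) (auto simp: vars_def)
  then show ?thesis
    unfolding eval_poly_def by (intro sum.cong prod.cong arg_cong2[of _ _ _ _ "(*)"]) auto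
qed

lemma const_hom: "comm_ring_hom const"
  by unfold_locales (simp_all add: const_def single_add mult_single)

lemma const_eq_0_iff [simp]: "const c = 0 \<longleftrightarrow> c = 0"
  unfolding const_def by (metis single_zero inj_single injD)

definition ev :: "(nat \<Rightarrow> complex) \<Rightarrow> cpoly \<Rightarrow> complex" where
  "ev x = eval_poly id x"

lemma id_hom: "comm_ring_hom (id :: complex \<Rightarrow> complex)"
  by unfold_locales simp_all

lemma ev_hom: "comm_ring_hom (ev x)"
  unfolding ev_def by (rule comm_ring_hom_eval_poly[OF id_hom])

lemmas ev_add [simp] = eval_poly_add[OF id_hom, folded ev_def]
lemmas ev_mult [simp] = eval_poly_mult[OF id_hom, folded ev_def]
lemmas ev_0 [simp] = eval_poly_0[OF id_hom, folded ev_def]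
lemmas ev_const [simp] = eval_poly_const[OF id_hom, folded ev_def, unfolded id_apply]
lemmas ev_var [simp] = eval_poly_var[OF id_hom, folded ev_def]

lemma ev_1 [simp]: "ev x 1 = 1"
proof -
  interpret comm_ring_hom "ev x" by (rule ev_hom)
  show ?thesis by simp
qed

section \<open>Ideals and primes of the polynomial ring\<close>

locale cpoly_ideal =
  fixes Q :: "cpoly set"
  assumes zero [simp]: "0 \<in> Q" and add: "p \<in> Q \<Longrightarrow> q \<in> Q \<Longrightarrow> p + q \<in> Q"
    and absorb: "p \<in> Q \<Longrightarrow> r * p \<in> Q"
begin

lemma absorb_right: "p \<in> Q \<Longrightarrow> p * r \<in> Q"
  using absorb[of p r] by (simp add: mult.commute)

lemma uminus: "p \<in> Q \<Longrightarrow> - p \<in> Q"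
  using absorb[of p "-1"] by simp

lemma diff: "p \<in> Q \<Longrightarrow> q \<in> Q \<Longrightarrow> p - q \<in> Q"
  using add[of p "- q"] uminus[of q] by simp

lemma sum: "(\<And>i. i \<in> S \<Longrightarrow> p i \<in> Q) \<Longrightarrow> (\<Sum>i\<in>S. p i) \<in> Q"
  by (induction S rule: infinite_finite_induct) (auto intro: add)

end

locale cpoly_prime = cpoly_ideal +
  assumes one: "1 \<notin> Q" and prime: "p * q \<in> Q \<Longrightarrow> p \<in> Q \<or> q \<in> Q"
begin

lemma const_notin: "c \<noteq> 0 \<Longrightarrow> const c \<notin> Q"
proof
  assume "c \<noteq> 0" "const c \<in> Q"
  then have "const (1 / c) * const c \<in> Q" by (intro absorb)
  moreover have "const (1 / c) * const c = 1"
    using \<open>c \<noteq> 0\<close> by (simp add: const_def mult_single)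
  ultimately show False using one by simp
qed

lemma prod: "finite S \<Longrightarrow> (\<Prod>i\<in>S. p i) \<in> Q \<Longrightarrow> \<exists>i\<in>S. p i \<in> Q"
  by (induction S rule: finite_induct) (use one prime in auto)

lemma power: "p ^ n \<in> Q \<Longrightarrow> p \<in> Q"
  by (induction n) (use one prime in auto)

end

text \<open>Replaces the record operations of \<open>class_ring\<close> by those of the type class,
  in which all later computations with ideals take place.\<close>

lemma prime_spec_iff: "P \<in> prime_spec \<longleftrightarrow> cpoly_prime P"
proof
  assume "P \<in> prime_spec"
  then interpret P: primeideal P "class_ring :: cpoly ring" by (simp add: prime_spec_def)
  show "cpoly_prime P"
  proof
    show "0 \<in> P" using P.zero_closed by (simp add: class_ring_simps)
    show "p + q \<in> P" if "p \<in> P" "q \<in> P" for p q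
      using P.a_closed[OF that] by (simp add: class_ring_simps)
    show "r * p \<in> P" if "p \<in> P" for r p
      using P.I_l_closed[OF that, of r] by (simp add: class_ring_simps)
    show "1 \<notin> P" using P.I_notcarr P.one_imp_carrier by (auto simp: class_ring_simps)
    show "p \<in> P \<or> q \<in> P" if "p * q \<in> P" for p q
      using P.I_prime[of p q] that by (simp add: class_ring_simps)
  qed
next
  assume "cpoly_prime P"
  then interpret P: cpoly_prime P .
  have r: "Ring.cring (class_ring :: cpoly ring)" by unfold_locales
  show "P \<in> prime_spec"
    unfolding prime_spec_def mem_Collect_eq
  proof (intro primeidealI idealI r Ring.cring.axioms(1)[OF r])
    show "subgroup P (add_monoid (class_ring :: cpoly ring))"
    proof
      show "inv\<^bsub>add_monoid (class_ring :: cpoly ring)\<^esub> x \<in> P" if "x \<in> P" for x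
      proof -
        have "inv\<^bsub>add_monoid (class_ring :: cpoly ring)\<^esub> x = \<ominus>\<^bsub>class_ring\<^esub> x" by (simp add: a_inv_def)
        then have "inv\<^bsub>add_monoid (class_ring :: cpoly ring)\<^esub> x = - x" by (simp add: class_ring_simps)
        then show ?thesis using P.uminus[OF that] by simp
      qed
    qed (auto simp: class_ring_simps intro: P.add)
    show "carrier class_ring \<noteq> P" using P.one by (auto simp: class_ring_simps)
  qed (use P.absorb P.absorb_right P.prime in \<open>auto simp: class_ring_simps\<close>)
qed

text \<open>The closed points: x lists all coefficients of the chart coordinates of a complex arc,
  in the numbering of \<open>universal_coord\<close>.\<close>

definition ev_ker :: "(nat \<Rightarrow> complex) \<Rightarrow> cpoly set" where
  "ev_ker x = {p. ev x p = 0}"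

lemma cpoly_prime_ev_ker: "cpoly_prime (ev_ker x)"
  by unfold_locales (auto simp: ev_ker_def)

text \<open>Induction on the coordinates: a vector d with nonzero coordinate m clears this
  coordinate in all other vectors, and its own coefficient is then determined by theirs.\<close>

lemma linear_dependence:
  fixes h :: "'a \<Rightarrow> 'b \<Rightarrow> complex"
  assumes "finite B" "finite S" "card B < card S"
  shows "\<exists>a. (\<exists>c\<in>S. a c \<noteq> 0) \<and> (\<forall>m\<in>B. (\<Sum>c\<in>S. a c * h c m) = 0)"
  using assms
proof (induction B arbitrary: S h rule: finite_induct)
  case empty
  then have "S \<noteq> {}" by auto
  then show ?case by (intro exI[of _ "\<lambda>_. 1"]) auto
next
  case (insert m B)
  show ?case
  proof (cases "\<forall>c\<in>S. h c m = 0")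
    case True
    obtain a where "\<exists>c\<in>S. a c \<noteq> 0" "\<forall>m\<in>B. (\<Sum>c\<in>S. a c * h c m) = 0"
      using insert.IH[of S h] insert.prems insert.hyps by auto
    then show ?thesis using True by (intro exI[of _ a]) auto
  next
    case False
    then obtain d where d: "d \<in> S" "h d m \<noteq> 0" by auto
    let ?h = "\<lambda>c b. h c b - h c m / h d m * h d b"
    have "card B < card (S - {d})" using insert d by simp
    then obtain a where a: "\<exists>c\<in>S - {d}. a c \<noteq> 0" "\<forall>b\<in>B. (\<Sum>c\<in>S - {d}. a c * ?h c b) = 0"
      using insert.IH[of "S - {d}" ?h] insert.prems by auto
    define A where "A = (\<Sum>c\<in>S - {d}. a c * h c m) / h d m"
    let ?a = "a(d := - A)"
    have sum: "(\<Sum>c\<in>S. ?a c * h c b) = (\<Sum>c\<in>S - {d}. a c * h c b) - A * h d b" for b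
      using d insert.prems by (subst sum.remove[of _ d]) auto
    have "(\<Sum>c\<in>S. ?a c * h c b) = (\<Sum>c\<in>S - {d}. a c * ?h c b)" for b
    proof -
      have "A * h d b = (\<Sum>c\<in>S - {d}. a c * (h c m / h d m * h d b))"
        unfolding A_def sum_divide_distrib sum_distrib_right by (rule sum.cong) auto
      then show ?thesis unfolding sum by (simp add: right_diff_distrib sum_subtractf)
    qed
    moreover have "(\<Sum>c\<in>S. ?a c * h c m) = 0" unfolding sum[of m] using d by (simp add: A_def)
    moreover have "\<exists>c\<in>S. ?a c \<noteq> 0" using a(1) by auto
    ultimately show ?thesis using a(2) by (intro exI[of _ ?a]) auto
  qed
qed

text \<open>An increasing exhaustion of the monomials by finite sets. Countable dimension is used in
  this form: the ring is a countable union of finite-dimensional spaces.\<close>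

definition bounded_monoms :: "nat \<Rightarrow> (nat \<Rightarrow>\<^sub>0 nat) set" where
  "bounded_monoms d = {m. Poly_Mapping.keys m \<subseteq> {..<d} \<and> (\<forall>v. Poly_Mapping.lookup m v < d + 1)}"

lemma finite_bounded_monoms: "finite (bounded_monoms d)"
proof -
  have "inj_on (\<lambda>m. restrict (Poly_Mapping.lookup m) {..<d}) (bounded_monoms d)"
  proof (rule inj_onI)
    fix m m' assume m: "m \<in> bounded_monoms d" "m' \<in> bounded_monoms d"
      and eq: "restrict (Poly_Mapping.lookup m) {..<d} = restrict (Poly_Mapping.lookup m') {..<d}"
    show "m = m'"
    proof (rule poly_mapping_eqI)
      fix v
      show "Poly_Mapping.lookup m v = Poly_Mapping.lookup m' v"
      proof (cases "v < d")
        case True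
        then show ?thesis using fun_cong[OF eq, of v] by simp
      next
        case False
        then have "v \<notin> Poly_Mapping.keys m" "v \<notin> Poly_Mapping.keys m'"
          using m by (auto simp: bounded_monoms_def)
        then show ?thesis by (simp add: in_keys_iff)
      qed
    qed
  qed
  moreover have "(\<lambda>m. restrict (Poly_Mapping.lookup m) {..<d}) ` bounded_monoms d \<subseteq> PiE {..<d} (\<lambda>_. {..<d + 1})"
    unfolding bounded_monoms_def by (intro subsetI, elim imageE) (simp add: PiE_def restrict_def extensional_def)
  moreover have "finite (PiE {..<d} (\<lambda>_. {..<d + 1}))" by (intro finite_PiE) auto
  ultimately show ?thesis by (metis finite_imageD finite_subset)
qed

lemma monom_bounded: "\<exists>d. \<forall>e\<ge>d. m \<in> bounded_monoms e"
proof -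
  let ?d = "\<Sum>v\<in>Poly_Mapping.keys m. Suc v + Poly_Mapping.lookup m v"
  have le: "Suc v + Poly_Mapping.lookup m v \<le> ?d" if "v \<in> Poly_Mapping.keys m" for v
    using member_le_sum[of v "Poly_Mapping.keys m" "\<lambda>v. Suc v + Poly_Mapping.lookup m v"] that by simp
  have "m \<in> bounded_monoms e" if "e \<ge> ?d" for e
  proof -
    have "Poly_Mapping.lookup m v < e + 1" for v
      using le[of v] that by (cases "v \<in> Poly_Mapping.keys m") (auto simp: in_keys_iff)
    moreover have "v < e" if "v \<in> Poly_Mapping.keys m" for v
      using le[OF that] \<open>e \<ge> ?d\<close> by linarith
    ultimately show ?thesis by (auto simp: bounded_monoms_def)
  qed
  then show ?thesis by blast
qed

lemma keys_bounded: "\<exists>d. Poly_Mapping.keys (p :: cpoly) \<subseteq> bounded_monoms d"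
proof -
  obtain D where D: "\<And>m e. e \<ge> D m \<Longrightarrow> m \<in> bounded_monoms e" using monom_bounded by metis
  have "D m \<le> (\<Sum>m\<in>Poly_Mapping.keys p. D m)" if "m \<in> Poly_Mapping.keys p" for m
    using member_le_sum[of m "Poly_Mapping.keys p" D] that by simp
  then show ?thesis using D by blast
qed

text \<open>Substitutes an element of \<open>cpoly\<close>, in practice \<open>var v\<close>, into a
  complex polynomial in one variable, which makes the fundamental theorem of algebra
  applicable.\<close>

definition poly_at :: "cpoly \<Rightarrow> complex poly \<Rightarrow> cpoly" where
  "poly_at z p = poly (map_poly const p) z"

lemma poly_at_pCons [simp]: "poly_at z (pCons a p) = const a + z * poly_at z p"
  by (simp add: poly_at_def map_poly_pCons)

lemma poly_at_0 [simp]: "poly_at z 0 = 0"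
  by (simp add: poly_at_def)

lemma poly_at_add: "poly_at z (p + q) = poly_at z p + poly_at z q"
  by (induction p q rule: poly_induct2) (simp_all add: const_def single_add algebra_simps)

lemma poly_at_smult: "poly_at z (Polynomial.smult a p) = const a * poly_at z p"
  by (induction p) (simp_all add: const_def mult_single algebra_simps)

lemma poly_at_mult: "poly_at z (p * q) = poly_at z p * poly_at z q"
  by (induction p) (simp_all add: poly_at_add poly_at_smult algebra_simps)

lemma poly_at_linear [simp]: "poly_at z [:- c, 1:] = z - const c"
  by (simp add: const_def single_uminus)

lemma poly_at_prod: "poly_at z (\<Prod>i\<in>S. p i) = (\<Prod>i\<in>S. poly_at z (p i))"
proof (induction S rule: infinite_finite_induct)
  case (insert i S)
  then show ?case by (simp add: poly_at_mult)
qed (simp_all add: const_def one_pCons)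

lemma poly_at_sum: "poly_at z (\<Sum>i\<in>S. p i) = (\<Sum>i\<in>S. poly_at z (p i))"
  by (induction S rule: infinite_finite_induct) (simp_all add: poly_at_add)

context cpoly_prime begin

text \<open>Over the complex numbers p splits into linear factors, and a prime ideal that contains
  their product contains one of them.\<close>

lemma linear_factor:
  fixes p :: "complex poly"
  assumes "p \<noteq> 0" "poly_at (var v) p \<in> Q"
  shows "\<exists>c. var v - const c \<in> Q"
  using assms
proof (induction "degree p" arbitrary: p)
  case 0
  then obtain c where "p = [:c:]" by (metis degree_eq_zeroE)
  have "poly_at (var v) p = const c" using \<open>p = [:c:]\<close> by simp
  moreover have "c \<noteq> 0" using 0 \<open>p = [:c:]\<close> by simp
  ultimately show ?case using 0 const_notin[of c] by simp
next
  case (Suc d)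
  have "\<nexists>a l. a \<noteq> 0 \<and> l = 0 \<and> p = pCons a l" using Suc.hyps(2) by auto
  from fundamental_theorem_of_algebra_alt[OF this] obtain z where "poly p z = 0" ..
  then obtain q where q: "p = [:- z, 1:] * q" by (auto simp: poly_eq_0_iff_dvd)
  have "poly_at (var v) p = (var v - const z) * poly_at (var v) q"
    unfolding q poly_at_mult poly_at_linear ..
  then consider "var v - const z \<in> Q" | "poly_at (var v) q \<in> Q"
    using Suc.prems prime by auto
  then show ?case
  proof cases
    case 2
    have "q \<noteq> 0" using Suc q by auto
    moreover have "degree q = d"
      using Suc.hyps(2) \<open>q \<noteq> 0\<close> unfolding q by (subst (asm) degree_mult_eq) auto
    ultimately show ?thesis using Suc.hyps(1)[of q] 2 by auto
  qed auto
qed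

end

text \<open>A maximal ideal among those avoiding the powers of \<open>f\<close> is the kernel of an evaluation,
  because there are uncountably many complex numbers but the polynomial ring has countable
  dimension: if no \<open>v - c\<close> lies in it, the quotients \<open>f\<^sup>N / (v - c)\<close> are linearly dependent.\<close>

theorem exists_point:
  assumes P: "P \<in> prime_spec" and f: "f \<notin> P"
  shows "\<exists>x. (\<forall>p\<in>P. ev x p = 0) \<and> ev x f \<noteq> 0"
proof -
  interpret P: cpoly_prime P using P by (simp add: prime_spec_iff)
  define F where "F = {Q. cpoly_ideal Q \<and> P \<subseteq> Q \<and> (\<forall>N. f ^ N \<notin> Q)}"
  have "\<exists>M\<in>F. \<forall>X\<in>F. M \<subseteq> X \<longrightarrow> X = M"
  proof (rule subset_Zorn_nonempty)
    show "F \<noteq> {}" using P.power f P.cpoly_ideal_axioms by (auto simp: F_def)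
    fix C assume C: "C \<noteq> {}" "subset.chain F C"
    have "cpoly_ideal (\<Union>C)"
    proof
      show "0 \<in> \<Union>C"
      proof -
        obtain A where "A \<in> C" using C by auto
        then have "cpoly_ideal A" using C(2) by (auto simp: F_def subset.chain_def)
        then show ?thesis using \<open>A \<in> C\<close> cpoly_ideal.zero by blast
      qed
      show "p + q \<in> \<Union>C" if pq: "p \<in> \<Union>C" "q \<in> \<Union>C" for p q
      proof -
        obtain A B where "p \<in> A" "A \<in> C" "q \<in> B" "B \<in> C" using pq by auto
        then obtain D where "p \<in> D" "q \<in> D" "D \<in> C" using C(2) unfolding subset.chain_def by blast
        moreover have "cpoly_ideal D" using C(2) \<open>D \<in> C\<close> by (auto simp: F_def subset.chain_def)
        ultimately show ?thesis using cpoly_ideal.add by blast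
      qed
      show "r * p \<in> \<Union>C" if "p \<in> \<Union>C" for r p
      proof -
        obtain A where "p \<in> A" "A \<in> C" using \<open>p \<in> \<Union>C\<close> by blast
        moreover from this have "cpoly_ideal A" using C(2) by (auto simp: F_def subset.chain_def)
        ultimately show ?thesis using cpoly_ideal.absorb by blast
      qed
    qed
    moreover have "P \<subseteq> \<Union>C"
    proof -
      obtain A where "A \<in> C" using C by auto
      then have "P \<subseteq> A" using C(2) by (auto simp: F_def subset.chain_def)
      then show ?thesis using \<open>A \<in> C\<close> by blast
    qed
    moreover have "f ^ N \<notin> \<Union>C" for N using C(2) by (auto simp: F_def subset.chain_def)
    ultimately show "\<Union>C \<in> F" by (simp add: F_def)
  qed
  then obtain Q where Q: "Q \<in> F" and max: "\<And>X. X \<in> F \<Longrightarrow> Q \<subseteq> X \<Longrightarrow> X = Q" by blast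
  interpret Q: cpoly_ideal Q using Q by (simp add: F_def)
  have PQ: "P \<subseteq> Q" and fQ: "\<And>N. f ^ N \<notin> Q" using Q by (auto simp: F_def)
  \<comment> \<open>By maximality Q + (g) contains a power of f; so every g outside Q divides a
    power of f modulo Q.\<close>
  have ext: "\<exists>N h. f ^ N - g * h \<in> Q" if "g \<notin> Q" for g
  proof -
    define X where "X = {q + g * h |q h. q \<in> Q}"
    have "cpoly_ideal X"
    proof
      show "0 \<in> X" unfolding X_def using Q.zero by (force intro: exI[of _ 0])
      show "p + q \<in> X" if pq: "p \<in> X" "q \<in> X" for p q
      proof -
        obtain a h b h' where "p = a + g * h" "a \<in> Q" "q = b + g * h'" "b \<in> Q"
          using pq by (auto simp: X_def)
        then have "p + q = (a + b) + g * (h + h')" "a + b \<in> Q"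
          by (auto simp: algebra_simps Q.add)
        then show ?thesis unfolding X_def by blast
      qed
      show "r * p \<in> X" if p: "p \<in> X" for r p
      proof -
        obtain a h where "p = a + g * h" "a \<in> Q" using p by (auto simp: X_def)
        then have "r * p = r * a + g * (r * h)" "r * a \<in> Q"
          using Q.absorb[of a r] by (auto simp: algebra_simps)
        then show ?thesis unfolding X_def by blast
      qed
    qed
    moreover have QX: "Q \<subseteq> X" unfolding X_def by (force intro: exI[of _ 0])
    moreover have "g \<in> X" unfolding X_def using Q.zero by (force intro: exI[of _ 1])
    ultimately have "X \<notin> F" using max[of X] that by auto
    then obtain N where "f ^ N \<in> X" using \<open>cpoly_ideal X\<close> QX PQ unfolding F_def by auto
    then obtain q h where "f ^ N = q + g * h" "q \<in> Q" by (auto simp: X_def)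
    then show ?thesis by (intro exI[of _ N] exI[of _ h]) simp
  qed
  interpret Q: cpoly_prime Q
  proof
    show "1 \<notin> Q" using fQ[of 0] by simp
    fix p q assume pq: "p * q \<in> Q"
    show "p \<in> Q \<or> q \<in> Q"
    proof (rule ccontr)
      assume "\<not> ?thesis"
      then obtain N h M h' where NM: "f ^ N - p * h \<in> Q" "f ^ M - q * h' \<in> Q" using ext by meson
      \<comment> \<open>Modulo Q, p * h is f^N and q * h' is f^M, so p * q in Q would put f^(N + M)
        into Q.\<close>
      have "f ^ M * (f ^ N - p * h) + (p * h) * (f ^ M - q * h') + (h * h') * (p * q) \<in> Q"
        by (rule Q.add[OF Q.add[OF Q.absorb[OF NM(1)] Q.absorb[OF NM(2)]] Q.absorb[OF pq]])
      moreover have "f ^ M * (f ^ N - p * h) + (p * h) * (f ^ M - q * h') + (h * h') * (p * q) = f ^ (N + M)"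
        by (simp add: algebra_simps power_add)
      ultimately show False using fQ by metis
    qed
  qed
  have "\<exists>c. var v - const c \<in> Q" for v
  proof (rule ccontr)
    assume none: "\<nexists>c. var v - const c \<in> Q"
    then have "\<forall>c. \<exists>N h. f ^ N - (var v - const c) * h \<in> Q" using ext by simp
    then obtain N h where Nh: "\<And>c. f ^ N c - (var v - const c) * h c \<in> Q"
      unfolding choice_iff by blast
    have "\<forall>c. \<exists>d. Poly_Mapping.keys (h c) \<subseteq> bounded_monoms d" using keys_bounded by blast
    then obtain d where d: "\<And>c. Poly_Mapping.keys (h c) \<subseteq> bounded_monoms (d c)"
      unfolding choice_iff by blast
    \<comment> \<open>The uncountably many c have only countably many pairs (N c, d c), so
      infinitely many c share one pair.\<close>
    have "\<exists>N0 d0. infinite {c. N c = N0 \<and> d c = d0}"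
    proof (rule ccontr)
      assume "\<not> ?thesis"
      then have "countable (\<Union>N0. \<Union>d0. {c. N c = N0 \<and> d c = d0})"
        by (intro countable_UN) (auto intro: countable_finite)
      moreover have "(\<Union>N0. \<Union>d0. {c. N c = N0 \<and> d c = d0}) = (UNIV :: complex set)" by auto
      ultimately have "countable (Re ` (UNIV :: complex set))" by (simp add: countable_image)
      moreover have "Re ` (UNIV :: complex set) = UNIV" by (metis Re_complex_of_real surjI)
      ultimately show False using uncountable_UNIV_real by simp
    qed
    then obtain N0 d0 where inf: "infinite {c. N c = N0 \<and> d c = d0}" by blast
    \<comment> \<open>One element more than the dimension of the space that contains all the
      \<open>h c\<close>, which forces a linear relation.\<close>
    obtain S where S: "S \<subseteq> {c. N c = N0 \<and> d c = d0}" "finite S" "card S = Suc (card (bounded_monoms d0))"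
      using infinite_arbitrarily_large[OF inf] by blast
    obtain a c0 where a: "c0 \<in> S" "a c0 \<noteq> 0"
      and dep: "\<forall>m\<in>bounded_monoms d0. (\<Sum>c\<in>S. a c * Poly_Mapping.lookup (h c) m) = 0"
      using linear_dependence[OF finite_bounded_monoms S(2), of d0 "\<lambda>c. Poly_Mapping.lookup (h c)"] S(3) by auto
    have zero: "(\<Sum>c\<in>S. const (a c) * h c) = 0"
    proof (rule poly_mapping_eqI)
      fix m
      have "Poly_Mapping.lookup (const b * g) m = b * Poly_Mapping.lookup g m" for b and g :: cpoly
        by (simp add: const_def mult_map_scale_conv_mult[symmetric] Poly_Mapping.map.rep_eq when_def)
      then have "Poly_Mapping.lookup (\<Sum>c\<in>S. const (a c) * h c) m = (\<Sum>c\<in>S. a c * Poly_Mapping.lookup (h c) m)"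
        by (simp add: lookup_sum)
      also have "\<dots> = 0"
      proof (cases "m \<in> bounded_monoms d0")
        case False
        then have "Poly_Mapping.lookup (h c) m = 0" if "c \<in> S" for c
          using d[of c] S(1) that by (auto simp: in_keys_iff)
        then show ?thesis by simp
      qed (use dep in auto)
      finally show "Poly_Mapping.lookup (\<Sum>c\<in>S. const (a c) * h c) m = Poly_Mapping.lookup 0 m" by simp
    qed
    \<comment> \<open>The numerator of the sum of all a c / (X - c). Clearing denominators in the
      relation puts f^N0 * p(var v) into Q. That p is not zero is seen at c0, where only the summand
      of c0 survives.\<close>
    define p :: "complex poly" where "p = (\<Sum>c\<in>S. Polynomial.smult (a c) (\<Prod>e\<in>S - {c}. [:- e, 1:]))"
    have "poly p c0 = (\<Sum>c\<in>S. a c * (\<Prod>e\<in>S - {c}. c0 - e))"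
      by (simp add: p_def poly_sum poly_prod)
    also have "\<dots> = (\<Sum>c\<in>{c0}. a c * (\<Prod>e\<in>S - {c}. c0 - e))"
      using a S(2) by (intro sum.mono_neutral_right) auto
    also have "\<dots> \<noteq> 0" using a S(2) by (auto simp: prod_zero_iff)
    finally have "p \<noteq> 0" by auto
    have pv: "poly_at (var v) p = (\<Sum>c\<in>S. const (a c) * (\<Prod>e\<in>S - {c}. var v - const e))"
      unfolding p_def poly_at_sum poly_at_smult poly_at_prod poly_at_linear ..
    have "f ^ N0 * poly_at (var v) p
      = (\<Sum>c\<in>S. const (a c) * (\<Prod>e\<in>S - {c}. var v - const e) * (f ^ N0 - (var v - const c) * h c))
        + (\<Sum>c\<in>S. const (a c) * h c * (\<Prod>e\<in>S. var v - const e))"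
      unfolding pv sum_distrib_left sum.distrib[symmetric]
    proof (rule sum.cong[OF refl])
      fix c assume "c \<in> S"
      then have e: "(\<Prod>e\<in>S. var v - const e) = (var v - const c) * (\<Prod>e\<in>S - {c}. var v - const e)"
        using S(2) by (simp add: prod.remove)
      show "f ^ N0 * (const (a c) * (\<Prod>e\<in>S - {c}. var v - const e))
        = const (a c) * (\<Prod>e\<in>S - {c}. var v - const e) * (f ^ N0 - (var v - const c) * h c)
          + const (a c) * h c * (\<Prod>e\<in>S. var v - const e)"
        unfolding e by (simp add: algebra_simps)
    qed
    also have "(\<Sum>c\<in>S. const (a c) * h c * (\<Prod>e\<in>S. var v - const e)) = 0"
      unfolding sum_distrib_right[symmetric] zero by simp
    also have "(\<Sum>c\<in>S. const (a c) * (\<Prod>e\<in>S - {c}. var v - const e) * (f ^ N0 - (var v - const c) * h c)) + 0 \<in> Q"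
    proof -
      have "f ^ N0 - (var v - const c) * h c \<in> Q" if "c \<in> S" for c using Nh[of c] S(1) that by auto
      then show ?thesis by (auto intro: Q.sum Q.absorb)
    qed
    finally have "poly_at (var v) p \<in> Q" using Q.prime fQ by blast
    then show False using Q.linear_factor[OF \<open>p \<noteq> 0\<close>] none by blast
  qed
  then obtain x where x: "\<And>v. var v - const (x v) \<in> Q" by metis
  \<comment> \<open>Each variable is now congruent to a constant modulo Q; hence every polynomial is
    congruent to its value at x, which vanishes if the polynomial lies in P and does not vanish for
    f.\<close>
  have cong_mult: "p * q - const (a * b) \<in> Q" if "p - const a \<in> Q" "q - const b \<in> Q" for p q a b
  proof -
    have "q * (p - const a) + const a * (q - const b) \<in> Q" using that by (intro Q.add Q.absorb)
    then show ?thesis by (simp add: algebra_simps const_def mult_single)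
  qed
  have cong_pow: "p ^ n - const (a ^ n) \<in> Q" if "p - const a \<in> Q" for p a n
  proof (induction n)
    case 0
    show ?case by (simp add: const_def)
  next
    case (Suc n)
    then show ?case using cong_mult[OF that] by simp
  qed
  have cong_prod: "(\<Prod>i\<in>S. p i) - const (\<Prod>i\<in>S. a i) \<in> Q" if "\<And>i. i \<in> S \<Longrightarrow> p i - const (a i) \<in> Q"
    for S :: "nat set" and p a
    using that
  proof (induction S rule: infinite_finite_induct)
    case (insert i S)
    then show ?case using cong_mult[of "p i" "a i"] by auto
  qed (simp_all add: const_def)
  have single_prod: "Poly_Mapping.single m c = const c * (\<Prod>v\<in>Poly_Mapping.keys m. var v ^ Poly_Mapping.lookup m v)" for m c
  proof -
    have vp: "var v ^ e = Poly_Mapping.single (Poly_Mapping.single v e) 1" for v e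
      by (induction e) (simp_all add: var_def mult_single single_add[symmetric])
    have "(\<Prod>v\<in>S. var v ^ g v) = Poly_Mapping.single (\<Sum>v\<in>S. Poly_Mapping.single v (g v)) 1"
      if "finite S" for S g
      using that by (induction S rule: finite_induct) (simp_all add: vp mult_single)
    moreover have "(\<Sum>v\<in>Poly_Mapping.keys m. Poly_Mapping.single v (Poly_Mapping.lookup m v)) = m"
      by (rule poly_mapping_eqI) (simp add: lookup_sum lookup_single when_def in_keys_iff)
    ultimately show ?thesis by (simp add: const_def mult_single)
  qed
  have cong: "p - const (ev x p) \<in> Q" for p
  proof (induction p rule: cpoly_induct)
    case (single m c)
    have e: "ev x (Poly_Mapping.single m c) = c * (\<Prod>v\<in>Poly_Mapping.keys m. x v ^ Poly_Mapping.lookup m v)"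
      by (simp add: ev_def eval_poly_single monom_eval_def)
    have "const c - const c \<in> Q" by simp
    then have "const c * (\<Prod>v\<in>Poly_Mapping.keys m. var v ^ Poly_Mapping.lookup m v)
      - const (c * (\<Prod>v\<in>Poly_Mapping.keys m. x v ^ Poly_Mapping.lookup m v)) \<in> Q"
      by (intro cong_mult cong_prod cong_pow x)
    moreover note single_prod[of m c]
    ultimately show ?case unfolding e by (simp only:)
  next
    case (add p q)
    then have "(p - const (ev x p)) + (q - const (ev x q)) \<in> Q" by (rule Q.add)
    then show ?case by (simp add: const_def single_add algebra_simps)
  qed
  have "ev x p = 0" if "p \<in> P" for p
  proof (rule ccontr)
    assume "ev x p \<noteq> 0"
    moreover have "p - (p - const (ev x p)) \<in> Q" using Q.diff[OF _ cong] that PQ by blast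
    ultimately show False using Q.const_notin by auto
  qed
  moreover have "ev x f \<noteq> 0"
  proof
    assume "ev x f = 0"
    then have "f \<in> Q" using cong[of f] by (simp add: const_def)
    then show False using fQ[of 1] by simp
  qed
  ultimately show ?thesis by blast
qed

section \<open>Orders of minors over complex power series\<close>

text \<open>Has the shape of \<open>ord_mod\<close>, so that the two agree at closed points by
  unfolding.\<close>

definition ford :: "complex fps \<Rightarrow> enat" where
  "ford f = Inf (enat ` {m. fps_nth f m \<noteq> 0})"

lemma le_ford_iff: "e \<le> ford f \<longleftrightarrow> (\<forall>m. enat m < e \<longrightarrow> fps_nth f m = 0)"
  unfolding ford_def le_Inf_iff by (auto simp: not_less[symmetric])

lemma ford_le: "fps_nth f m \<noteq> 0 \<Longrightarrow> ford f \<le> enat m"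
  unfolding ford_def by (intro Inf_lower) auto

lemma ford_eq: "ford f = (if f = 0 then \<infinity> else enat (subdegree f))"
proof (cases "f = 0")
  case True
  then show ?thesis by (simp add: ford_def top_enat_def)
next
  case False
  then have "ford f \<le> enat (subdegree f)" by (intro ford_le) simp
  moreover have "enat (subdegree f) \<le> ford f"
    unfolding le_ford_iff using nth_less_subdegree_zero by auto
  ultimately show ?thesis using False by simp
qed

lemma ford_0 [simp]: "ford 0 = \<infinity>" by (simp add: ford_eq)

lemma ford_1 [simp]: "ford 1 = 0" by (simp add: ford_eq zero_enat_def)

lemma ford_eq_infinity [simp]: "ford f = \<infinity> \<longleftrightarrow> f = 0" by (simp add: ford_eq)

lemma ford_mult: "ford (f * g) = ford f + ford g"
  by (cases "f = 0"; cases "g = 0") (simp_all add: ford_eq subdegree_mult)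

lemma ford_uminus [simp]: "ford (- f) = ford f" by (simp add: ford_eq)

lemma ford_add_ge: "e \<le> ford f \<Longrightarrow> e \<le> ford g \<Longrightarrow> e \<le> ford (f + g)"
  by (simp add: le_ford_iff)

lemma ford_sum_ge: "(\<And>i. i \<in> S \<Longrightarrow> e \<le> ford (f i)) \<Longrightarrow> e \<le> ford (\<Sum>i\<in>S. f i)"
  by (induction S rule: infinite_finite_induct) (auto intro: ford_add_ge)

lemma ford_prod: "finite S \<Longrightarrow> ford (\<Prod>i\<in>S. f i) = (\<Sum>i\<in>S. ford (f i))"
  by (induction S rule: finite_induct) (simp_all add: ford_mult)

lemma ford_eq_0_iff: "ford f = 0 \<longleftrightarrow> fps_nth f 0 \<noteq> 0"
  by (auto simp: ford_eq zero_enat_def subdegree_eq_0_iff)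

lemma le_ford_mult: "e \<le> ford f \<Longrightarrow> e \<le> ford (g * f)"
  by (simp add: ford_mult add_increasing)

text \<open>The convention t^\<infinity> = 0 turns an infinite invariant factor into an ordinary
  diagonal entry, so that matrices of smaller rank need no separate treatment.\<close>

definition tp :: "enat \<Rightarrow> complex fps" where
  "tp e = (case e of enat m \<Rightarrow> fps_X ^ m | \<infinity> \<Rightarrow> 0)"

lemma ford_tp [simp]: "ford (tp e) = e"
  by (cases e) (simp_all add: tp_def ford_eq)

lemma tp_0 [simp]: "tp 0 = 1" by (simp add: tp_def zero_enat_def)

lemma tp_add: "tp (a + b) = tp a * tp b"
  by (cases a; cases b) (simp_all add: tp_def power_add)

lemma tp_dvd:
  assumes "e \<le> ford f"
  obtains g where "f = tp e * g"
proof (cases e)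
  case (enat m)
  then have "f = fps_X ^ m * fps_shift m f"
    using assms by (intro fps_ext) (auto simp: le_ford_iff fps_X_power_mult_nth)
  then show ?thesis using that enat by (auto simp: tp_def)
next
  case infinity
  then have "f = 0" using assms by (simp add: enat_ord_simps)
  then show ?thesis using that[of 0] by simp
qed

section \<open>Minors and the least order of a minor of given size\<close>

lemma det_mat_Leibniz:
  "det (mat j j (\<lambda>(a, b). F a b)) =
     (\<Sum>p\<in>{p. p permutes {0..<j}}. signof p * (\<Prod>i = 0..<j. F i (p i)))"
proof -
  have "det (mat j j (\<lambda>(a, b). F a b)) =
     (\<Sum>p\<in>{p. p permutes {0..<j}}. signof p * (\<Prod>i = 0..<j. mat j j (\<lambda>(a, b). F a b) $$ (i, p i)))"
    by (rule det_def') simp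
  also have "\<dots> = (\<Sum>p\<in>{p. p permutes {0..<j}}. signof p * (\<Prod>i = 0..<j. F i (p i)))"
  proof (rule sum.cong[OF refl])
    fix p assume p: "p \<in> {p. p permutes {0..<j}}"
    have "(\<Prod>i = 0..<j. mat j j (\<lambda>(a, b). F a b) $$ (i, p i)) = (\<Prod>i = 0..<j. F i (p i))"
    proof (rule prod.cong[OF refl])
      fix i assume i: "i \<in> {0..<j}"
      have "p i \<in> {0..<j}" using permutes_in_image[of p "{0..<j}" i] p i by simp
      then show "mat j j (\<lambda>(a, b). F a b) $$ (i, p i) = F i (p i)" using i by simp
    qed
    then show "signof p * (\<Prod>i = 0..<j. mat j j (\<lambda>(a, b). F a b) $$ (i, p i)) = signof p * (\<Prod>i = 0..<j. F i (p i))"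
      by simp
  qed
  finally show ?thesis .
qed

lemma det_ge:
  assumes "\<And>p. p permutes {0..<j} \<Longrightarrow> e \<le> (\<Sum>i = 0..<j. ford (F i (p i)))"
  shows "e \<le> ford (det (mat j j (\<lambda>(a, b). F a b)))"
  unfolding det_mat_Leibniz
  by (intro ford_sum_ge le_ford_mult) (simp add: ford_prod assms)

definition minor :: "nat \<Rightarrow> (nat \<Rightarrow> nat) \<Rightarrow> (nat \<Rightarrow> nat) \<Rightarrow> (nat \<Rightarrow> nat \<Rightarrow> 'a::comm_ring_1) \<Rightarrow> 'a" where
  "minor j f g X = det (mat j j (\<lambda>(a, b). X (f a) (g b)))"

lemma minor_cong:
  assumes "\<And>a b. a < j \<Longrightarrow> b < j \<Longrightarrow> X (f a) (g b) = Y (f' a) (g' b)"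
  shows "minor j f g X = minor j f' g' Y"
  unfolding minor_def by (intro arg_cong[of _ _ det] eq_matI) (use assms in auto)

lemma minor_0 [simp]: "minor 0 f g X = 1"
  by (simp add: minor_def det_mat_Leibniz)

lemma minor_transpose: "minor j g f (\<lambda>x y. X y x) = minor j f g X"
proof -
  have "mat j j (\<lambda>(a, b). X (f b) (g a)) = (mat j j (\<lambda>(a, b). X (f a) (g b)))\<^sup>T" by (rule eq_matI) auto
  then show ?thesis unfolding minor_def by (simp add: det_transpose[of _ j])
qed

lemma minor_noninj_row:
  assumes "\<not> inj_on f {..<j}"
  shows "minor j f g X = 0"
proof -
  obtain a b where ab: "a < j" "b < j" "a \<noteq> b" "f a = f b" using assms by (auto simp: inj_on_def)
  show ?thesis unfolding minor_def
    by (rule det_identical_rows[of _ j a b]) (use ab in \<open>auto intro!: eq_vecI\<close>)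
qed

lemma minor_noninj_col:
  assumes "\<not> inj_on g {..<j}"
  shows "minor j f g X = 0"
  using minor_noninj_row[OF assms, of f "\<lambda>x y. X y x"] unfolding minor_transpose[of j g f X] .

lemma minor_laplace_row:
  assumes "a < Suc j"
  shows "minor (Suc j) f g X = (\<Sum>b<Suc j. X (f a) (g b) *
    ((- 1) ^ (a + b) * minor j (\<lambda>i. f (if i < a then i else Suc i)) (\<lambda>i. g (if i < b then i else Suc i)) X))"
proof -
  let ?A = "mat (Suc j) (Suc j) (\<lambda>(a, b). X (f a) (g b))"
  have "det ?A = (\<Sum>b<Suc j. ?A $$ (a, b) * cofactor ?A a b)"
    by (rule laplace_expansion_row) (use assms in auto)
  also have "\<dots> = (\<Sum>b<Suc j. X (f a) (g b) *
    ((- 1) ^ (a + b) * minor j (\<lambda>i. f (if i < a then i else Suc i)) (\<lambda>i. g (if i < b then i else Suc i)) X))"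
  proof (intro sum.cong refl arg_cong2[of _ _ _ _ "(*)"])
    fix b assume "b \<in> {..<Suc j}"
    then show "?A $$ (a, b) = X (f a) (g b)" using assms by simp
    have "mat_delete ?A a b = mat j j (\<lambda>(i', j'). X (f (if i' < a then i' else Suc i')) (g (if j' < b then j' else Suc j')))"
      by (rule eq_matI) (use assms \<open>b \<in> {..<Suc j}\<close> in \<open>auto simp: mat_delete_def\<close>)
    then show "cofactor ?A a b = (- 1) ^ (a + b) * minor j (\<lambda>i. f (if i < a then i else Suc i)) (\<lambda>i. g (if i < b then i else Suc i)) X"
      by (simp add: cofactor_def minor_def)
  qed
  finally show ?thesis unfolding minor_def .
qed

text \<open>Index functions are not required to be injective or monotone: this only adds vanishing
  minors and signs, and it makes the expansion of the minors of a product a multilinear one.\<close>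

lemma minor_mult_left:
  assumes "\<And>a y. a < j \<Longrightarrow> B (f a) (g y) = (\<Sum>l<k. L (f a) l * A l (g y))"
  shows "minor j f g B = (\<Sum>\<phi>\<in>PiE {0..<j} (\<lambda>_. {..<k}). (\<Prod>a = 0..<j. L (f a) (\<phi> a)) * minor j \<phi> g A)"
proof -
  have "minor j f g B = (\<Sum>p\<in>{p. p permutes {0..<j}}. signof p * (\<Prod>i = 0..<j. \<Sum>l<k. L (f i) l * A l (g (p i))))"
    unfolding minor_def det_mat_Leibniz by (rule sum.cong[OF refl]) (simp add: assms)
  also have "\<dots> = (\<Sum>p\<in>{p. p permutes {0..<j}}. \<Sum>\<phi>\<in>PiE {0..<j} (\<lambda>_. {..<k}).
      signof p * ((\<Prod>a = 0..<j. L (f a) (\<phi> a)) * (\<Prod>a = 0..<j. A (\<phi> a) (g (p a)))))"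
    by (simp add: prod_sum_PiE sum_distrib_left prod.distrib)
  also have "\<dots> = (\<Sum>\<phi>\<in>PiE {0..<j} (\<lambda>_. {..<k}). (\<Prod>a = 0..<j. L (f a) (\<phi> a)) * minor j \<phi> g A)"
    unfolding minor_def det_mat_Leibniz sum_distrib_left
    by (subst sum.swap) (intro sum.cong refl, simp add: mult_ac)
  finally show ?thesis .
qed

text \<open>Exponent of the j-th determinantal divisor of the upper left k by c block. Repeated
  indices give the minor 0, so the value is \<infinity> when j exceeds min k c.\<close>

definition dord :: "nat \<Rightarrow> nat \<Rightarrow> nat \<Rightarrow> (nat \<Rightarrow> nat \<Rightarrow> complex fps) \<Rightarrow> enat" where
  "dord k c j X = (INF (f, g)\<in>{(f, g). (\<forall>a<j. f a < k) \<and> (\<forall>b<j. g b < c)}. ford (minor j f g X))"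

lemma le_dord_iff:
  "e \<le> dord k c j X \<longleftrightarrow> (\<forall>f g. (\<forall>a<j. f a < k) \<longrightarrow> (\<forall>b<j. g b < c) \<longrightarrow> e \<le> ford (minor j f g X))"
  unfolding dord_def le_INF_iff by auto

lemma dord_geI:
  assumes "\<And>f g. (\<forall>a<j. f a < k) \<Longrightarrow> (\<forall>b<j. g b < c) \<Longrightarrow> inj_on f {..<j} \<Longrightarrow> inj_on g {..<j}
    \<Longrightarrow> e \<le> ford (minor j f g X)"
  shows "e \<le> dord k c j X"
  unfolding le_dord_iff
proof (intro allI impI)
  fix f g assume "\<forall>a<j. f a < k" "\<forall>b<j. g b < c"
  then show "e \<le> ford (minor j f g X)"
    using assms[of f g] minor_noninj_row[of f j g X] minor_noninj_col[of g j f X]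
    by (cases "inj_on f {..<j} \<and> inj_on g {..<j}") auto
qed

lemma dord_le: "(\<And>a. a < j \<Longrightarrow> f a < k) \<Longrightarrow> (\<And>b. b < j \<Longrightarrow> g b < c) \<Longrightarrow> dord k c j X \<le> ford (minor j f g X)"
  using le_dord_iff[of "dord k c j X" k c j X] by blast

lemma dord_attained:
  assumes "dord k c j X < \<infinity>"
  obtains f g where "\<forall>a<j. f a < k" "\<forall>b<j. g b < c" "ford (minor j f g X) = dord k c j X"
proof -
  define S where "S = (\<lambda>(f, g). ford (minor j f g X)) ` {(f, g). (\<forall>a<j. f a < k) \<and> (\<forall>b<j. g b < c)}"
  have d: "dord k c j X = Inf S" by (simp add: dord_def S_def)
  have "S \<noteq> {}" using assms unfolding d by (auto simp: top_enat_def[symmetric])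
  then obtain e where "e \<in> S" by blast
  then have "(LEAST x. x \<in> S) \<in> S" by (rule LeastI)
  then have "Inf S \<in> S" using \<open>S \<noteq> {}\<close> by (simp add: Inf_enat_def)
  then show ?thesis using that unfolding S_def d by auto
qed

lemma dord_cong:
  assumes "\<And>x y. x < k \<Longrightarrow> y < c \<Longrightarrow> X x y = Y x y"
  shows "dord k c j X = dord k c j Y"
proof -
  have "ford (minor j f g X) = ford (minor j f g Y)" if "\<forall>a<j. f a < k" "\<forall>b<j. g b < c" for f g
    using that by (intro arg_cong[of _ _ ford] minor_cong assms) auto
  then show ?thesis unfolding dord_def by (intro INF_cong) auto
qed

lemma dord_transpose: "dord c k j (\<lambda>x y. X y x) = dord k c j X"
proof (rule antisym)
  show "dord c k j (\<lambda>x y. X y x) \<le> dord k c j X"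
    unfolding le_dord_iff[of _ k c j X] minor_transpose[of j _ _ X, symmetric] by (auto intro: dord_le)
  show "dord k c j X \<le> dord c k j (\<lambda>x y. X y x)"
    unfolding le_dord_iff[of _ c k j] minor_transpose[of j _ _ X] by (auto intro: dord_le)
qed

lemma dord_0 [simp]: "dord k c 0 X = 0"
  using dord_le[of 0 id k id c X] by (simp add: zero_enat_def[symmetric])

text \<open>Cauchy-Binet: minors of a product are combinations of minors of a factor. The multiplier
  L is arbitrary; when it has an inverse, the lemma applies in both directions and gives
  invariance.\<close>

lemma dord_mult_left:
  assumes "\<And>x y. x < k' \<Longrightarrow> y < c \<Longrightarrow> B x y = (\<Sum>l<k. L x l * A l y)"
  shows "dord k c j A \<le> dord k' c j B"
  unfolding le_dord_iff[of _ k' c]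
proof (intro allI impI)
  fix f g assume f: "\<forall>a<j. f a < k'" and g: "\<forall>b<j. g b < c"
  \<comment> \<open>The expansion of the product is required at every column index, so g is made
    bounded also beyond j.\<close>
  define g' where "g' b = (if b < j then g b else g 0)" for b
  have "minor j f g B = minor j f g' B" by (intro minor_cong) (simp add: g'_def)
  show "dord k c j A \<le> ford (minor j f g B)"
  proof (cases "j = 0")
    case False
    then have g': "g' b < c" for b using g by (simp add: g'_def)
    have "minor j f g' B = (\<Sum>\<phi>\<in>PiE {0..<j} (\<lambda>_. {..<k}). (\<Prod>a = 0..<j. L (f a) (\<phi> a)) * minor j \<phi> g' A)"
      using f g' by (intro minor_mult_left assms) auto
    also have "dord k c j A \<le> ford \<dots>"
      using g' by (intro ford_sum_ge le_ford_mult dord_le) auto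
    finally show ?thesis using \<open>minor j f g B = minor j f g' B\<close> by simp
  qed simp
qed

lemma dord_mult_right:
  assumes "\<And>x y. x < k \<Longrightarrow> y < c' \<Longrightarrow> B x y = (\<Sum>l<c. A x l * R l y)"
  shows "dord k c j A \<le> dord k c' j B"
proof -
  have "dord c k j (\<lambda>x y. A y x) \<le> dord c' k j (\<lambda>x y. B y x)"
  proof (rule dord_mult_left[where L = "\<lambda>x y. R y x"])
    fix x y assume "x < c'" "y < k"
    then have "B y x = (\<Sum>l<c. A y l * R l x)" by (intro assms)
    then show "B y x = (\<Sum>l<c. R l x * A y l)" by (simp add: mult.commute[of "R _ x"])
  qed
  then show ?thesis by (simp only: dord_transpose[of c k j A] dord_transpose[of c' k j B])
qed

lemma dord_mono_col:
  assumes "c \<le> c'"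
  shows "dord k c' j X \<le> dord k c j X"
  unfolding le_dord_iff[of _ k c]
proof (intro allI impI)
  fix f g assume f: "\<forall>a<j. f a < k" and g: "\<forall>b<j. g b < c"
  show "dord k c' j X \<le> ford (minor j f g X)"
  proof (rule dord_le)
    show "f a < k" if "a < j" for a using f that by simp
    show "g b < c'" if "b < j" for b using g that assms by (meson order.strict_trans2)
  qed
qed

text \<open>Expansion along the only column that can have index c leaves j-minors of the first c
  columns.\<close>

lemma dord_Suc_ge: "dord k c j X \<le> dord k (Suc c) (Suc j) X"
proof (rule dord_geI)
  fix f g assume f: "\<forall>a<Suc j. f a < k" and g: "\<forall>b<Suc j. g b < Suc c" "inj_on g {..<Suc j}"
  obtain b0 where b0: "b0 < Suc j" "\<And>b. b < Suc j \<Longrightarrow> b \<noteq> b0 \<Longrightarrow> g b < c"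
  proof (cases "\<exists>b0<Suc j. g b0 = c")
    case True
    then obtain b0 where "b0 < Suc j" "g b0 = c" by blast
    moreover have "g b < c" if "b < Suc j" "b \<noteq> b0" for b
      using g that \<open>b0 < Suc j\<close> \<open>g b0 = c\<close> inj_onD[OF g(2), of b b0] by (force simp: less_Suc_eq)
    ultimately show ?thesis using that by blast
  next
    case False
    then show ?thesis using that[of j] g(1) less_antisym by blast
  qed
  have "minor (Suc j) f g X = minor (Suc j) g f (\<lambda>x y. X y x)" by (rule minor_transpose[symmetric])
  also have "dord k c j X \<le> ford \<dots>"
    unfolding minor_laplace_row[OF b0(1)] minor_transpose[of j _ _ X]
    by (intro ford_sum_ge le_ford_mult dord_le) (use f b0 in auto)
  finally show "dord k c j X \<le> ford (minor (Suc j) f g X)" .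
qed

text \<open>A minor through the unit row k reduces, up to sign, to one with this row and the column
  c deleted; a minor that avoids the row is bounded by \<open>dord_Suc_ge\<close>. This expresses
  the omission of the last column by an additional row.\<close>

lemma dord_stack:
  assumes S: "\<And>x y. x < k \<Longrightarrow> y < Suc c \<Longrightarrow> S x y = X x y"
    and Sk: "\<And>y. y < Suc c \<Longrightarrow> S k y = (if y = c then 1 else 0)"
  shows "dord (Suc k) (Suc c) (Suc j) S = dord k c j X"
proof (rule antisym)
  show "dord (Suc k) (Suc c) (Suc j) S \<le> dord k c j X"
    unfolding le_dord_iff[of _ k c]
  proof (intro allI impI)
    fix f g assume f: "\<forall>a<j. f a < k" and g: "\<forall>b<j. g b < c"
    let ?f = "f(j := k)" and ?g = "g(j := c)"
    have "minor (Suc j) ?f ?g S = minor j f g X"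
    proof -
      have "minor (Suc j) ?f ?g S = (\<Sum>b<Suc j. S k (?g b) * ((- 1) ^ (j + b) *
         minor j (\<lambda>i. ?f (if i < j then i else Suc i)) (\<lambda>i. ?g (if i < b then i else Suc i)) S))"
        by (subst minor_laplace_row[of j]) simp_all
      also have "\<dots> = (\<Sum>b\<in>{j}. S k (?g b) * ((- 1) ^ (j + b) *
         minor j (\<lambda>i. ?f (if i < j then i else Suc i)) (\<lambda>i. ?g (if i < b then i else Suc i)) S))"
        by (rule sum.mono_neutral_right) (use g in \<open>auto simp: Sk less_Suc_eq\<close>)
      also have "\<dots> = minor j (\<lambda>i. ?f (if i < j then i else Suc i)) (\<lambda>i. ?g (if i < j then i else Suc i)) S"
        by (simp add: Sk)
      also have "\<dots> = minor j f g X"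
        by (rule minor_cong) (use f g in \<open>auto simp: less_Suc_eq intro!: S\<close>)
      finally show ?thesis .
    qed
    moreover have "dord (Suc k) (Suc c) (Suc j) S \<le> ford (minor (Suc j) ?f ?g S)"
    proof (rule dord_le)
      show "?f a < Suc k" if "a < Suc j" for a using f that by (auto simp: less_Suc_eq)
      show "?g b < Suc c" if "b < Suc j" for b using g that by (auto simp: less_Suc_eq)
    qed
    ultimately show "dord (Suc k) (Suc c) (Suc j) S \<le> ford (minor j f g X)" by simp
  qed
  show "dord k c j X \<le> dord (Suc k) (Suc c) (Suc j) S"
  proof (rule dord_geI)
    fix f g assume f: "\<forall>a<Suc j. f a < Suc k" and g: "\<forall>b<Suc j. g b < Suc c"
      and inj: "inj_on f {..<Suc j}" "inj_on g {..<Suc j}"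
    show "dord k c j X \<le> ford (minor (Suc j) f g S)"
    proof (cases "\<exists>a<Suc j. f a = k")
      case False
      then have fk: "\<forall>a<Suc j. f a < k" using f by (auto simp: less_Suc_eq)
      have "minor (Suc j) f g S = minor (Suc j) f g X" by (rule minor_cong) (use fk g in \<open>auto intro!: S\<close>)
      moreover have "dord k (Suc c) (Suc j) X \<le> ford (minor (Suc j) f g X)" using fk g by (intro dord_le) auto
      ultimately show ?thesis using dord_Suc_ge[of k c j X] by simp
    next
      case True
      then obtain a where a: "a < Suc j" "f a = k" by blast
      have fk: "f i < k" if "i < Suc j" "i \<noteq> a" for i
        using f a that inj_onD[OF inj(1), of i a] by (force simp: less_Suc_eq)
      show ?thesis unfolding minor_laplace_row[OF a(1)] a(2)
      proof (rule ford_sum_ge)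
        fix b assume b: "b \<in> {..<Suc j}"
        show "dord k c j X \<le> ford (S k (g b) * ((- 1) ^ (a + b) *
          minor j (\<lambda>i. f (if i < a then i else Suc i)) (\<lambda>i. g (if i < b then i else Suc i)) S))"
        proof (cases "g b = c")
          case True
          have gc: "g i < c" if "i < Suc j" "i \<noteq> b" for i
            using g b True that inj_onD[OF inj(2), of i b] by (force simp: less_Suc_eq)
          have "minor j (\<lambda>i. f (if i < a then i else Suc i)) (\<lambda>i. g (if i < b then i else Suc i)) S
            = minor j (\<lambda>i. f (if i < a then i else Suc i)) (\<lambda>i. g (if i < b then i else Suc i)) X"
            by (rule minor_cong) (use fk g in \<open>auto intro!: S\<close>)
          then show ?thesis using fk gc by (simp only:) (intro le_ford_mult dord_le, auto)
        next
          case False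
          then show ?thesis using g b by (simp add: Sk)
        qed
      qed
    qed
  qed
qed

section \<open>Diagonal matrices, with one row replaced or a rank-one term added\<close>

definition diag :: "(nat \<Rightarrow> enat) \<Rightarrow> nat \<Rightarrow> nat \<Rightarrow> complex fps" where
  "diag \<kappa> x y = (if x = y then tp (\<kappa> x) else 0)"

text \<open>The largest element of a set of n + 1 natural numbers is at least n; removing it gives
  the induction.\<close>

lemma sum_ge_initial:
  fixes \<kappa> :: "nat \<Rightarrow> enat"
  assumes "mono \<kappa>" "finite S"
  shows "(\<Sum>i<card S. \<kappa> i) \<le> (\<Sum>i\<in>S. \<kappa> i)"
  using assms(2)
proof (induction "card S" arbitrary: S)
  case (Suc n)
  let ?m = "Max S"
  have S: "S \<noteq> {}" "finite S" using Suc by auto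
  then have m: "?m \<in> S" by simp
  have "S \<subseteq> {..?m}" using S by auto
  then have "card S \<le> Suc ?m" using card_mono[of "{..?m}" S] by simp
  then have "n \<le> ?m" using Suc(2) by simp
  then have "\<kappa> n \<le> \<kappa> ?m" by (rule monoD[OF assms(1)])
  moreover have "n = card (S - {?m})" using Suc(2) m S(2) by simp
  then have "(\<Sum>i<n. \<kappa> i) \<le> (\<Sum>i\<in>S - {?m}. \<kappa> i)" using Suc(1)[of "S - {?m}"] S(2) by simp
  moreover have "(\<Sum>i\<in>S. \<kappa> i) = \<kappa> ?m + (\<Sum>i\<in>S - {?m}. \<kappa> i)" by (rule sum.remove[OF S(2) m])
  ultimately show ?case by (simp add: Suc(2)[symmetric] add_mono add.commute)
qed simp

text \<open>Outside row l the matrix is diagonal, so a contributing permutation fixes every other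
  index and is the identity.\<close>

lemma det_diag_row:
  assumes "l < j"
  shows "det (mat j j (\<lambda>(a, b). if a = l then v b else if a = b then d a else 0)) =
    v l * (\<Prod>a\<in>{0..<j} - {l}. d a)"
proof -
  let ?F = "\<lambda>a b. if a = l then v b else if a = b then d a else 0"
  have "det (mat j j (\<lambda>(a, b). ?F a b)) = (\<Sum>p\<in>{id}. signof p * (\<Prod>i = 0..<j. ?F i (p i)))"
    unfolding det_mat_Leibniz
  proof (rule sum.mono_neutral_right)
    show "\<forall>p\<in>{p. p permutes {0..<j}} - {id}. signof p * (\<Prod>i = 0..<j. ?F i (p i)) = 0"
    proof
      fix p assume p: "p \<in> {p. p permutes {0..<j}} - {id}"
      have "\<exists>i\<in>{0..<j} - {l}. p i \<noteq> i"
      proof (rule ccontr)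
        assume "\<not> ?thesis"
        then have fix_p: "p i = i" if "i \<noteq> l" for i using p that by (cases "i < j") (auto simp: permutes_def)
        then have "p l = l" using p by (metis DiffD1 mem_Collect_eq permutes_inj injD)
        then have "p i = i" for i using fix_p by (cases "i = l") auto
        then have "p = id" by (auto simp: fun_eq_iff)
        then show False using p by simp
      qed
      then obtain i where "i \<in> {0..<j} - {l}" "p i \<noteq> i" by blast
      then have "i \<in> {0..<j}" "?F i (p i) = 0" by simp_all
      then have "(\<Prod>i = 0..<j. ?F i (p i)) = 0" by (intro prod_zero[OF finite_atLeastLessThan] bexI)
      then show "signof p * (\<Prod>i = 0..<j. ?F i (p i)) = 0" by simp
    qed
  qed (auto simp: finite_permutations permutes_id)
  also have "\<dots> = v l * (\<Prod>a\<in>{0..<j} - {l}. d a)"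
    using assms by (simp add: prod.remove[of _ l] sign_id)
  finally show ?thesis .
qed

text \<open>A permutation p contributes only if f a = g (p a) for all a other than l. Its term is
  then the entry of v at q = g (p l) times the diagonal entries with indices in S, the image under f
  of the other rows.\<close>

lemma det_diag_row_ge:
  fixes E :: "nat \<Rightarrow> nat \<Rightarrow> complex fps"
  assumes inj: "inj_on f {..<j}" "inj_on g {..<j}" and l: "l < j"
    and bound: "\<And>q S. q \<in> g ` {..<j} \<Longrightarrow> finite S \<Longrightarrow> card S = j - 1 \<Longrightarrow> q \<notin> S \<Longrightarrow> f l \<notin> S
      \<Longrightarrow> e \<le> ford (v q) + (\<Sum>i\<in>S. \<kappa> i)"
  shows "e \<le> ford (det (mat j j (\<lambda>(a, b). if a = l then v (g b) else diag \<kappa> (f a) (g b))))"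
proof (rule det_ge)
  fix p assume p: "p permutes {0..<j}"
  let ?F = "\<lambda>a b. if a = l then v (g b) else diag \<kappa> (f a) (g b)"
  have pl: "p i < j" if "i < j" for i using permutes_in_image[OF p, of i] that by simp
  show "e \<le> (\<Sum>i = 0..<j. ford (?F i (p i)))"
  proof (cases "\<exists>a\<in>{0..<j} - {l}. f a \<noteq> g (p a)")
    case True
    then obtain a where "a \<in> {0..<j} - {l}" "f a \<noteq> g (p a)" by blast
    then have a: "a \<in> {0..<j}" "a \<noteq> l" "f a \<noteq> g (p a)" by simp_all
    then have "ford (?F a (p a)) = \<infinity>" by (simp add: diag_def)
    then have "(\<Sum>i = 0..<j. ford (?F i (p i))) = \<infinity>"
      using a(1) by (subst sum.remove[of _ a]) auto
    then show ?thesis by simp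
  next
    case False
    then have fg: "f a = g (p a)" if "a < j" "a \<noteq> l" for a using that by auto
    let ?S = "f ` ({..<j} - {l})"
    have "e \<le> ford (v (g (p l))) + (\<Sum>i\<in>?S. \<kappa> i)"
    proof (rule bound)
      show "g (p l) \<in> g ` {..<j}" using pl l by simp
      show "card ?S = j - 1" using inj(1) l by (subst card_image) (auto intro: inj_on_subset)
      show "f l \<notin> ?S" using inj(1) l by (auto dest: inj_onD)
      show "g (p l) \<notin> ?S"
      proof
        assume "g (p l) \<in> ?S"
        then obtain a where a: "a < j" "a \<noteq> l" "g (p l) = g (p a)" using fg by auto
        then have "p l = p a" using inj(2) pl l by (auto dest: inj_onD)
        then show False using a permutes_inj[OF p] by (auto dest: injD)
      qed
    qed simp
    also have "(\<Sum>i\<in>?S. \<kappa> i) = (\<Sum>a\<in>{..<j} - {l}. \<kappa> (f a))"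
      using inj(1) by (subst sum.reindex) (auto intro: inj_on_subset)
    also have "\<dots> = (\<Sum>i\<in>{0..<j} - {l}. ford (?F i (p i)))"
      using fg by (intro sum.cong) (auto simp: diag_def)
    also have "ford (v (g (p l))) + \<dots> = (\<Sum>i = 0..<j. ford (?F i (p i)))"
      using l by (subst (2) sum.remove[of _ l]) auto
    finally show ?thesis .
  qed
qed

lemma minor_diag_ge:
  assumes "mono \<kappa>" "inj_on f {..<j}" "inj_on g {..<j}"
  shows "(\<Sum>i<j. \<kappa> i) \<le> ford (minor j f g (diag \<kappa>))"
  unfolding minor_def
proof (rule det_ge)
  fix p assume p: "p permutes {0..<j}"
  show "(\<Sum>i<j. \<kappa> i) \<le> (\<Sum>i = 0..<j. ford (diag \<kappa> (f i) (g (p i))))"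
  proof -
    have "(\<Sum>i<j. \<kappa> i) \<le> (\<Sum>i\<in>f ` {..<j}. \<kappa> i)"
      using sum_ge_initial[OF assms(1), of "f ` {..<j}"] by (simp add: card_image assms(2))
    also have "\<dots> = (\<Sum>i = 0..<j. \<kappa> (f i))" by (simp add: sum.reindex assms(2) atLeast0LessThan)
    also have "\<dots> \<le> (\<Sum>i = 0..<j. ford (diag \<kappa> (f i) (g (p i))))"
      by (intro sum_mono) (auto simp: diag_def)
    finally show ?thesis .
  qed
qed

lemma minor_diag: "minor j id id (diag \<kappa>) = (\<Prod>i<j. tp (\<kappa> i))"
proof (cases j)
  case (Suc n)
  have "minor j id id (diag \<kappa>) = det (mat j j (\<lambda>(a, b). if a = 0 then diag \<kappa> 0 b else if a = b then tp (\<kappa> a) else 0))"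
    unfolding minor_def by (intro arg_cong[of _ _ det] eq_matI) (auto simp: diag_def)
  also have "\<dots> = diag \<kappa> 0 0 * (\<Prod>a\<in>{0..<j} - {0}. tp (\<kappa> a))" using Suc by (intro det_diag_row) simp
  also have "\<dots> = (\<Prod>i\<in>{0..<j}. tp (\<kappa> i))"
    using Suc by (subst prod.remove[of "{0..<j}" 0]) (simp_all add: diag_def)
  also have "{0..<j} = {..<j}" by auto
  finally show ?thesis .
qed simp

lemma dord_diag:
  assumes "mono \<kappa>" "j \<le> min k c"
  shows "dord k c j (diag \<kappa>) = (\<Sum>i<j. \<kappa> i)"
proof (rule antisym)
  show "dord k c j (diag \<kappa>) \<le> (\<Sum>i<j. \<kappa> i)"
    using dord_le[of j id k id c "diag \<kappa>"] assms(2) by (simp add: minor_diag ford_prod)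
  show "(\<Sum>i<j. \<kappa> i) \<le> dord k c j (diag \<kappa>)"
    by (rule dord_geI) (rule minor_diag_ge[OF assms(1)])
qed

text \<open>F + u v is the product of the matrix (1 | u) with F stacked on the row v. In the product
  formula a nonzero term selects the row v at most once, because the row selection has to be
  injective.\<close>

lemma det_rank_one_update:
  fixes F :: "nat \<Rightarrow> nat \<Rightarrow> 'a::comm_ring_1"
  shows "det (mat j j (\<lambda>(a, b). F a b + u a * v b)) =
    det (mat j j (\<lambda>(a, b). F a b)) + (\<Sum>l<j. u l * det (mat j j (\<lambda>(a, b). if a = l then v b else F a b)))"
proof -
  define A where "A l y = (if l < j then F l y else v y)" for l y
  define L where "L a l = (if l < j then if l = a then 1 else 0 else u a)" for a l
  \<comment> \<open>The surviving selections: \<open>\<Phi> l\<close> takes the additional row,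
    which has number j, in position l, and \<open>\<Phi>0\<close> never takes it.\<close>
  define \<Phi> where "\<Phi> l = (\<lambda>i\<in>{0..<j}. if i = l then j else i)" for l :: nat
  define \<Phi>0 where "\<Phi>0 = (\<lambda>i\<in>{0..<j}. i)"
  let ?t = "\<lambda>\<phi>. (\<Prod>a = 0..<j. L a (\<phi> a)) * minor j \<phi> id A"
  have inj: "inj_on \<Phi> {..<j}"
  proof (rule inj_onI)
    fix a b assume ab: "a \<in> {..<j}" "b \<in> {..<j}" "\<Phi> a = \<Phi> b"
    have "\<Phi> b a = j" using ab(1) unfolding ab(3)[symmetric] by (simp add: \<Phi>_def)
    then show "a = b" using ab(1) by (auto simp: \<Phi>_def split: if_splits)
  qed
  have n0: "\<Phi>0 \<notin> \<Phi> ` {..<j}"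
  proof
    assume "\<Phi>0 \<in> \<Phi> ` {..<j}"
    then obtain l where l: "l < j" "\<Phi>0 = \<Phi> l" by auto
    have "\<Phi>0 l = j" using l(1) unfolding l(2) by (simp add: \<Phi>_def)
    then show False using l(1) by (simp add: \<Phi>0_def)
  qed
  have "det (mat j j (\<lambda>(a, b). F a b + u a * v b)) = minor j id id (\<lambda>a b. F a b + u a * v b)"
    by (simp add: minor_def)
  also have "\<dots> = (\<Sum>\<phi>\<in>PiE {0..<j} (\<lambda>_. {..<Suc j}). (\<Prod>a = 0..<j. L (id a) (\<phi> a)) * minor j \<phi> id A)"
  proof (rule minor_mult_left)
    fix a y :: nat assume "a < j"
    have "(\<Sum>l<j. L a l * A l y) = (\<Sum>l\<in>{a}. L a l * A l y)"
      using \<open>a < j\<close> by (intro sum.mono_neutral_right) (auto simp: L_def)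
    then show "F (id a) (id y) + u (id a) * v (id y) = (\<Sum>l<Suc j. L (id a) l * A l (id y))"
      using \<open>a < j\<close> by (simp add: L_def A_def)
  qed
  also have "\<dots> = (\<Sum>\<phi>\<in>insert \<Phi>0 (\<Phi> ` {..<j}). ?t \<phi>)"
  proof (rule sum.mono_neutral_cong_right)
    show "finite (PiE {0..<j} (\<lambda>_. {..<Suc j}))" by (intro finite_PiE) auto
    show "insert \<Phi>0 (\<Phi> ` {..<j}) \<subseteq> PiE {0..<j} (\<lambda>_. {..<Suc j})"
      by (auto simp: \<Phi>_def \<Phi>0_def PiE_def split: if_splits)
    show "\<forall>\<phi>\<in>PiE {0..<j} (\<lambda>_. {..<Suc j}) - insert \<Phi>0 (\<Phi> ` {..<j}).
       (\<Prod>a = 0..<j. L (id a) (\<phi> a)) * minor j \<phi> id A = 0"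
    proof (intro ballI, rule ccontr)
      fix \<phi> assume \<phi>: "\<phi> \<in> PiE {0..<j} (\<lambda>_. {..<Suc j}) - insert \<Phi>0 (\<Phi> ` {..<j})"
        and nz: "(\<Prod>a = 0..<j. L (id a) (\<phi> a)) * minor j \<phi> id A \<noteq> 0"
      have "L a (\<phi> a) \<noteq> 0" if "a < j" for a
      proof
        assume "L a (\<phi> a) = 0"
        then have "(\<Prod>a = 0..<j. L (id a) (\<phi> a)) = 0" using that by (intro prod_zero) auto
        then show False using nz by simp
      qed
      then have "\<phi> a < j \<Longrightarrow> \<phi> a = a" if "a < j" for a
        using that unfolding L_def by (metis (full_types))
      moreover have "\<phi> a < Suc j" if "a < j" for a using that \<phi> by (auto simp: PiE_def Pi_def)
      ultimately have alt: "\<phi> a = a \<or> \<phi> a = j" if "a < j" for a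
        using that by (metis less_Suc_eq)
      have inj: "inj_on \<phi> {..<j}"
      proof (rule ccontr)
        assume "\<not> inj_on \<phi> {..<j}"
        then have "minor j \<phi> id A = 0" by (rule minor_noninj_row)
        then show False using nz by simp
      qed
      have out: "\<phi> i = undefined" if "\<not> i < j" for i
        using that DiffD1[OF \<phi>] by (simp add: PiE_iff extensional_def)
      have "\<phi> \<notin> insert \<Phi>0 (\<Phi> ` {..<j})" using \<phi> unfolding Diff_iff ..
      then have ne: "\<phi> \<noteq> \<Phi>0" "\<And>l. l < j \<Longrightarrow> \<phi> \<noteq> \<Phi> l" by (simp_all add: image_iff)
      show False
      proof (cases "\<exists>l<j. \<phi> l = j")
        case True
        then obtain l where "l < j \<and> \<phi> l = j" ..
        then have l: "l < j" "\<phi> l = j" by simp_all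
        have "\<phi> i = \<Phi> l i" for i
        proof -
          consider "i = l" | "i < j" "i \<noteq> l" | "\<not> i < j" using l by blast
          then show ?thesis
          proof cases
            case 1
            then show ?thesis using l by (simp add: \<Phi>_def)
          next
            case 2
            then have "\<phi> i \<noteq> j" using inj_onD[OF inj, of i l] l by force
            then show ?thesis using alt[of i] 2 by (simp add: \<Phi>_def)
          next
            case 3
            then show ?thesis by (simp add: \<Phi>_def out)
          qed
        qed
        then have "\<phi> = \<Phi> l" by (simp add: fun_eq_iff)
        then show False using ne(2) l by simp
      next
        case False
        have "\<phi> i = \<Phi>0 i" for i
        proof (cases "i < j")
          case True
          then have "\<phi> i \<noteq> j" using False by simp
          then show ?thesis using alt[of i] True by (simp add: \<Phi>0_def)
        qed (simp add: \<Phi>0_def out)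
        then have "\<phi> = \<Phi>0" by (simp add: fun_eq_iff)
        then show False using ne(1) by simp
      qed
    qed
  qed auto
  also have "\<dots> = ?t \<Phi>0 + (\<Sum>l<j. ?t (\<Phi> l))"
    using n0 by (simp add: sum.reindex[OF inj])
  also have "?t \<Phi>0 = det (mat j j (\<lambda>(a, b). F a b))"
  proof -
    have "minor j \<Phi>0 id A = minor j id id F" by (rule minor_cong) (simp add: \<Phi>0_def A_def)
    moreover have "(\<Prod>a = 0..<j. L a (\<Phi>0 a)) = 1" by (intro prod.neutral) (simp add: L_def \<Phi>0_def)
    ultimately show ?thesis by (simp add: minor_def)
  qed
  also have "(\<Sum>l<j. ?t (\<Phi> l)) = (\<Sum>l<j. u l * det (mat j j (\<lambda>(a, b). if a = l then v b else F a b)))"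
  proof (rule sum.cong[OF refl])
    fix l assume l: "l \<in> {..<j}"
    have "minor j (\<Phi> l) id A = minor j id id (\<lambda>a b. if a = l then v b else F a b)"
      by (rule minor_cong) (simp add: \<Phi>_def A_def)
    then have "minor j (\<Phi> l) id A = det (mat j j (\<lambda>(a, b). if a = l then v b else F a b))"
      unfolding minor_def id_apply .
    moreover have "(\<Prod>a = 0..<j. L a (\<Phi> l a)) = L l (\<Phi> l l) * (\<Prod>a\<in>{0..<j} - {l}. L a (\<Phi> l a))"
      using l by (intro prod.remove) auto
    moreover have "(\<Prod>a\<in>{0..<j} - {l}. L a (\<Phi> l a)) = 1" by (intro prod.neutral) (simp add: L_def \<Phi>_def)
    moreover have "L l (\<Phi> l l) = u l" using l by (simp add: L_def \<Phi>_def)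
    ultimately show "?t (\<Phi> l) = u l * det (mat j j (\<lambda>(a, b). if a = l then v b else F a b))"
      by (simp only: mult_1_right)
  qed
  finally show ?thesis .
qed

section \<open>Smith normal form over complex power series\<close>

lemma unit_det_inverse:
  fixes A :: "complex fps mat"
  assumes A: "A \<in> carrier_mat n n" and d: "ford (det A) = 0"
  obtains B where "B \<in> carrier_mat n n" "A * B = 1\<^sub>m n" "B * A = 1\<^sub>m n"
proof
  let ?B = "inverse (det A) \<cdot>\<^sub>m adj_mat A"
  note adj = adj_mat[OF A]
  have inv: "inverse (det A) * det A = 1"
    using d by (intro inverse_mult_eq_1) (simp add: ford_eq_0_iff)
  have one: "1 \<cdot>\<^sub>m 1\<^sub>m n = (1\<^sub>m n :: complex fps mat)" by (rule eq_matI) auto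
  show "?B \<in> carrier_mat n n" using adj(1) by simp
  have "A * ?B = inverse (det A) \<cdot>\<^sub>m (A * adj_mat A)" using mult_smult_distrib[OF A adj(1)] by simp
  also have "\<dots> = (inverse (det A) * det A) \<cdot>\<^sub>m 1\<^sub>m n" unfolding adj(2) by (rule eq_matI) auto
  finally show "A * ?B = 1\<^sub>m n" unfolding inv one .
  have "?B * A = inverse (det A) \<cdot>\<^sub>m (adj_mat A * A)" using mult_smult_assoc_mat[OF adj(1) A] by simp
  also have "\<dots> = (inverse (det A) * det A) \<cdot>\<^sub>m 1\<^sub>m n" unfolding adj(3) by (rule eq_matI) auto
  finally show "?B * A = 1\<^sub>m n" unfolding inv one .
qed

definition diag_mat' :: "nat \<Rightarrow> nat \<Rightarrow> (nat \<Rightarrow> enat) \<Rightarrow> complex fps mat" where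
  "diag_mat' k c \<kappa> = mat k c (\<lambda>(i, j). diag \<kappa> i j)"

text \<open>An entry of least order e divides all others. It is moved to the corner and t^e is taken
  out of the whole matrix; the corner becomes a unit and clears its row and column. Since t^e
  multiplies the rest as well, the exponents come out increasing.\<close>

lemma smith_mat:
  assumes "X \<in> carrier_mat k c"
  shows "\<exists>U V \<kappa>. U \<in> carrier_mat k k \<and> V \<in> carrier_mat c c \<and> ford (det U) = 0 \<and> ford (det V) = 0
    \<and> mono \<kappa> \<and> X = U * (diag_mat' k c \<kappa> * V)"
  using assms
proof (induction k arbitrary: c X)
  case 0
  show ?case
    by (rule exI[of _ "1\<^sub>m 0"], rule exI[of _ "1\<^sub>m c"], rule exI[of _ "\<lambda>_. \<infinity>"])
      (use 0 in \<open>auto simp: mono_def diag_mat'_def intro!: eq_matI\<close>)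
next
  case (Suc k)
  show ?case
  proof (cases "X = 0\<^sub>m (Suc k) c")
    case True
    have "diag_mat' (Suc k) c (\<lambda>_. \<infinity>) = 0\<^sub>m (Suc k) c"
      by (rule eq_matI) (auto simp: diag_mat'_def diag_def tp_def)
    then have "X = 1\<^sub>m (Suc k) * (diag_mat' (Suc k) c (\<lambda>_. \<infinity>) * 1\<^sub>m c)"
      unfolding True by simp
    then show ?thesis
      by (intro exI[of _ "1\<^sub>m (Suc k)"] exI[of _ "1\<^sub>m c"] exI[of _ "\<lambda>_. \<infinity>"]) (auto simp: mono_def)
  next
    case False
    then obtain c' where c: "c = Suc c'" using Suc.prems by (cases c) (auto intro!: eq_matI)
    define S where "S = {(p, q). p < Suc k \<and> q < c}"
    have "finite S" "S \<noteq> {}" unfolding S_def c by auto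
    then obtain pq where "is_arg_min (\<lambda>(p, q). ford (X $$ (p, q))) (\<lambda>x. x \<in> S) pq"
      using ex_is_arg_min_if_finite by blast
    then obtain p q where p: "p < Suc k" and q: "q < c"
      and min: "\<And>i j. i < Suc k \<Longrightarrow> j < c \<Longrightarrow> ford (X $$ (p, q)) \<le> ford (X $$ (i, j))"
      unfolding is_arg_min_linorder S_def by (cases pq) auto
    define e where "e = ford (X $$ (p, q))"
    obtain i j where "i < Suc k" "j < c" "X $$ (i, j) \<noteq> 0"
      using False Suc.prems by (auto simp: mat_eq_iff)
    then have e: "e < \<infinity>" using min[of i j] unfolding e_def by (auto simp: less_le ford_eq split: if_splits)
    define P where "P = (swaprows_mat (Suc k) 0 p :: complex fps mat)"
    define Q where "Q = (swaprows_mat c 0 q :: complex fps mat)"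
    have PQ: "P \<in> carrier_mat (Suc k) (Suc k)" "Q \<in> carrier_mat c c" "P * P = 1\<^sub>m (Suc k)" "Q * Q = 1\<^sub>m c"
      unfolding P_def Q_def using p q c by (auto intro!: swaprows_mat_inv)
    have dP: "ford (det P) = 0" and dQ: "ford (det Q) = 0"
    proof -
      have "det P * det P = 1" using det_mult[OF PQ(1) PQ(1)] PQ(3) by simp
      then have "ford (det P) + ford (det P) = 0" unfolding ford_mult[symmetric] by simp
      then show "ford (det P) = 0" by simp
      have "det Q * det Q = 1" using det_mult[OF PQ(2) PQ(2)] PQ(4) by simp
      then have "ford (det Q) + ford (det Q) = 0" unfolding ford_mult[symmetric] by simp
      then show "ford (det Q) = 0" by simp
    qed
    define X1 where "X1 = swapcols 0 q (swaprows 0 p X)"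
    have X1: "X1 \<in> carrier_mat (Suc k) c" using Suc.prems by (simp add: X1_def)
    have X1_eq: "X1 = P * X * Q"
      unfolding X1_def P_def Q_def using Suc.prems p q c
      by (subst swapcols_mat[of _ "Suc k"]) (auto simp: swaprows_mat[of X "Suc k" c])
    have X_eq: "X = P * (X1 * Q)"
    proof -
      have "X1 * Q = P * X * (Q * Q)"
        unfolding X1_eq using PQ Suc.prems by (intro assoc_mult_mat[of _ "Suc k" c _ c _ c]) auto
      then have "X1 * Q = P * X" using PQ Suc.prems by simp
      moreover have "P * (P * X) = (P * P) * X"
        using PQ Suc.prems by (intro assoc_mult_mat[symmetric, of _ "Suc k" "Suc k" _ "Suc k" _ c]) auto
      ultimately show ?thesis using PQ Suc.prems by simp
    qed
    have X1_ij: "X1 $$ (i, j) = X $$ (if i = 0 then p else if i = p then 0 else i, if j = 0 then q else if j = q then 0 else j)"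
      if "i < Suc k" "j < c" for i j
      unfolding X1_def using that p q Suc.prems c by auto
    have X1_ge: "e \<le> ford (X1 $$ (i, j))" if "i < Suc k" "j < c" for i j
      unfolding X1_ij[OF that] e_def using p q that c by (intro min) auto
    define Y where "Y i j = (SOME g. X1 $$ (i, j) = tp e * g)" for i j
    have Y: "X1 $$ (i, j) = tp e * Y i j" if "i < Suc k" "j < c" for i j
    proof -
      have "e \<le> ford (X1 $$ (i, j))" using that by (rule X1_ge)
      then obtain g where "X1 $$ (i, j) = tp e * g" by (rule tp_dvd)
      then show ?thesis unfolding Y_def by (rule someI)
    qed
    have "ford (X1 $$ (0, 0)) = e" using X1_ij[of 0 0] c by (simp add: e_def)
    then have "e + ford (Y 0 0) = e" using Y[of 0 0] c by (simp add: ford_mult)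
    then have Y00: "ford (Y 0 0) = 0" using e by (cases e; cases "ford (Y 0 0)") (auto simp: zero_enat_def)
    define u where "u = inverse (Y 0 0)"
    have u: "u * Y 0 0 = 1" unfolding u_def using Y00 by (intro inverse_mult_eq_1) (simp add: ford_eq_0_iff)
    \<comment> \<open>The Schur complement of the unit \<open>Y 0 0\<close>.\<close>
    define D where "D = mat k c' (\<lambda>(i, j). Y (Suc i) (Suc j) - Y (Suc i) 0 * u * Y 0 (Suc j))"
    obtain U0 V0 \<kappa>0 where IH: "U0 \<in> carrier_mat k k" "V0 \<in> carrier_mat c' c'" "ford (det U0) = 0" "ford (det V0) = 0"
      "mono \<kappa>0" "D = U0 * (diag_mat' k c' \<kappa>0 * V0)"
      using Suc.IH[of D c'] by (auto simp: D_def)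
    define L where "L = four_block_mat (1\<^sub>m 1) (0\<^sub>m 1 k) (mat k 1 (\<lambda>(i, _). Y (Suc i) 0 * u)) U0"
    define N where "N = four_block_mat (mat 1 1 (\<lambda>_. Y 0 0)) (mat 1 c' (\<lambda>(_, j). Y 0 (Suc j))) (0\<^sub>m c' 1) V0"
    define \<kappa> where "\<kappa> i = (case i of 0 \<Rightarrow> e | Suc i \<Rightarrow> e + \<kappa>0 i)" for i
    have L: "L \<in> carrier_mat (Suc k) (Suc k)" unfolding L_def using four_block_carrier_mat[of "1\<^sub>m 1" 1 1 U0 k k] IH by simp
    have N: "N \<in> carrier_mat c c" unfolding N_def c
      using four_block_carrier_mat[of "mat 1 1 (\<lambda>_. Y 0 0)" 1 1 V0 c' c'] IH by simp
    have dL: "ford (det L) = 0"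
      unfolding L_def using IH by (subst det_four_block_mat_upper_right_zero) (auto simp: ford_mult)
    have dN: "ford (det N) = 0"
      unfolding N_def using IH Y00
      by (subst det_four_block_mat_lower_left_zero) (auto simp: ford_mult det_single)
    have mono: "mono \<kappa>"
    proof (rule monoI)
      fix i j :: nat assume "i \<le> j"
      then show "\<kappa> i \<le> \<kappa> j" using monoD[OF IH(5)] by (auto simp: \<kappa>_def add_left_mono split: nat.splits)
    qed
    have dm: "diag_mat' (Suc k) c \<kappa> = tp e \<cdot>\<^sub>m four_block_mat (1\<^sub>m 1) (0\<^sub>m 1 c') (0\<^sub>m k 1) (diag_mat' k c' \<kappa>0)"
      by (rule eq_matI) (auto simp: diag_mat'_def diag_def \<kappa>_def tp_add c split: nat.splits)
    have dmc: "diag_mat' k c' \<kappa>0 \<in> carrier_mat k c'" by (simp add: diag_mat'_def)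
    have "L * (four_block_mat (1\<^sub>m 1) (0\<^sub>m 1 c') (0\<^sub>m k 1) (diag_mat' k c' \<kappa>0) * N)
      = mat (Suc k) c (\<lambda>(i, j). Y i j)"
    proof -
      have 1: "four_block_mat (1\<^sub>m 1) (0\<^sub>m 1 c') (0\<^sub>m k 1) (diag_mat' k c' \<kappa>0) * N
        = four_block_mat (mat 1 1 (\<lambda>_. Y 0 0)) (mat 1 c' (\<lambda>(_, j). Y 0 (Suc j))) (0\<^sub>m k 1) (diag_mat' k c' \<kappa>0 * V0)"
        unfolding N_def using IH dmc by (subst mult_four_block_mat[of _ 1 1 _ c' _ k _ _ 1 _ c']) auto
      have 2: "L * \<dots> = four_block_mat (mat 1 1 (\<lambda>_. Y 0 0)) (mat 1 c' (\<lambda>(_, j). Y 0 (Suc j)))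
          (mat k 1 (\<lambda>(i, _). Y (Suc i) 0 * u) * mat 1 1 (\<lambda>_. Y 0 0))
          (mat k 1 (\<lambda>(i, _). Y (Suc i) 0 * u) * mat 1 c' (\<lambda>(_, j). Y 0 (Suc j)) + D)"
        unfolding L_def using IH dmc by (subst mult_four_block_mat[of _ 1 1 _ k _ k _ _ 1 _ c']) auto
      have 3: "mat k 1 (\<lambda>(i, _). Y (Suc i) 0 * u) * mat 1 1 (\<lambda>_. Y 0 0) = mat k 1 (\<lambda>(i, _). Y (Suc i) 0)"
        by (rule eq_matI) (auto simp: scalar_prod_def mult.assoc u)
      have 4: "mat k 1 (\<lambda>(i, _). Y (Suc i) 0 * u) * mat 1 c' (\<lambda>(_, j). Y 0 (Suc j)) + D = mat k c' (\<lambda>(i, j). Y (Suc i) (Suc j))"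
        by (rule eq_matI) (auto simp: scalar_prod_def D_def)
      show ?thesis unfolding 1 2 3 4
        by (rule eq_matI) (auto simp: c less_Suc_eq_0_disj Suc_diff_1)
    qed
    moreover have "X1 = tp e \<cdot>\<^sub>m mat (Suc k) c (\<lambda>(i, j). Y i j)"
      by (rule eq_matI) (use X1 Y in auto)
    moreover have "four_block_mat (1\<^sub>m 1) (0\<^sub>m 1 c') (0\<^sub>m k 1) (diag_mat' k c' \<kappa>0) \<in> carrier_mat (Suc k) c"
      using four_block_carrier_mat[of "1\<^sub>m 1" 1 1 "diag_mat' k c' \<kappa>0" k c'] dmc c by simp
    ultimately have X1_LN: "X1 = L * (diag_mat' (Suc k) c \<kappa> * N)"
      unfolding dm using L N
      by (simp add: mult_smult_assoc_mat[of _ "Suc k" c] mult_smult_distrib[of _ "Suc k" "Suc k" _ c])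
    have dmk: "diag_mat' (Suc k) c \<kappa> \<in> carrier_mat (Suc k) c" by (simp add: diag_mat'_def)
    have "X = (P * L) * (diag_mat' (Suc k) c \<kappa> * (N * Q))"
    proof -
      let ?M = "diag_mat' (Suc k) c \<kappa>"
      have "L * (?M * N) * Q = L * (?M * N * Q)"
        using PQ L N dmk by (intro assoc_mult_mat[of _ "Suc k" "Suc k" _ c _ c]) auto
      also have "?M * N * Q = ?M * (N * Q)" using PQ N dmk by (intro assoc_mult_mat[of _ "Suc k" c _ c _ c]) auto
      finally have "X = P * (L * (?M * (N * Q)))" unfolding X_eq X1_LN by simp
      also have "\<dots> = (P * L) * (?M * (N * Q))"
        using PQ L N dmk by (intro assoc_mult_mat[symmetric, of _ "Suc k" "Suc k" _ "Suc k" _ c]) auto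
      finally show ?thesis .
    qed
    moreover have "ford (det (P * L)) = 0" "ford (det (N * Q)) = 0"
      using det_mult[OF PQ(1) L] det_mult[OF N PQ(2)] dP dL dN dQ by (simp_all add: ford_mult)
    ultimately show ?thesis using PQ L N mono
      by (intro exI[of _ "P * L"] exI[of _ "N * Q"] exI[of _ \<kappa>]) auto
  qed
qed

text \<open>Smith form with entries given by functions, so that blocks of columns can be taken
  without reindexing. Exponents with index at least min k c are constrained only by
  monotonicity.\<close>

locale smith_form =
  fixes k c :: nat and X U U' V V' :: "nat \<Rightarrow> nat \<Rightarrow> complex fps" and \<kappa> :: "nat \<Rightarrow> enat"
  assumes mono: "mono \<kappa>"
    and UU': "x < k \<Longrightarrow> y < k \<Longrightarrow> (\<Sum>l<k. U x l * U' l y) = (if x = y then 1 else 0)"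
    and U'U: "x < k \<Longrightarrow> y < k \<Longrightarrow> (\<Sum>l<k. U' x l * U l y) = (if x = y then 1 else 0)"
    and VV': "x < c \<Longrightarrow> y < c \<Longrightarrow> (\<Sum>l<c. V x l * V' l y) = (if x = y then 1 else 0)"
    and V'V: "x < c \<Longrightarrow> y < c \<Longrightarrow> (\<Sum>l<c. V' x l * V l y) = (if x = y then 1 else 0)"
    and X_eq: "x < k \<Longrightarrow> y < c \<Longrightarrow> X x y = (\<Sum>i<min k c. U x i * tp (\<kappa> i) * V i y)"
begin

lemma U'X:
  assumes "i < k" "y < c"
  shows "(\<Sum>x<k. U' i x * X x y) = (if i < c then tp (\<kappa> i) * V i y else 0)"
proof -
  have "(\<Sum>x<k. U' i x * X x y) = (\<Sum>x<k. \<Sum>l<min k c. U' i x * U x l * (tp (\<kappa> l) * V l y))"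
    using assms by (intro sum.cong refl) (simp add: X_eq sum_distrib_left mult_ac)
  also have "\<dots> = (\<Sum>l<min k c. (\<Sum>x<k. U' i x * U x l) * (tp (\<kappa> l) * V l y))"
    unfolding sum_distrib_right by (rule sum.swap)
  also have "\<dots> = (\<Sum>l<min k c. if l = i then tp (\<kappa> l) * V l y else 0)"
    using assms by (intro sum.cong refl) (auto simp: U'U)
  finally show ?thesis using assms by simp
qed

lemma XV':
  assumes "x < k" "i < c"
  shows "(\<Sum>y<c. X x y * V' y i) = (if i < k then U x i * tp (\<kappa> i) else 0)"
proof -
  have "(\<Sum>y<c. X x y * V' y i) = (\<Sum>y<c. \<Sum>l<min k c. U x l * tp (\<kappa> l) * (V l y * V' y i))"
    using assms by (intro sum.cong refl) (simp add: X_eq sum_distrib_right mult.assoc)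
  also have "\<dots> = (\<Sum>l<min k c. U x l * tp (\<kappa> l) * (\<Sum>y<c. V l y * V' y i))"
    unfolding sum_distrib_left by (rule sum.swap)
  also have "\<dots> = (\<Sum>l<min k c. if l = i then U x l * tp (\<kappa> l) else 0)"
    using assms by (intro sum.cong refl) (auto simp: VV')
  finally show ?thesis using assms by simp
qed

lemma dord_eq:
  assumes "j \<le> min k c"
  shows "dord k c j X = (\<Sum>i<j. \<kappa> i)"
proof -
  define Y where "Y l y = (if l < c then tp (\<kappa> l) * V l y else 0)" for l y
  have "dord k c j (diag \<kappa>) \<le> dord k c j Y"
  proof (rule dord_mult_right[where R = V])
    fix x y assume "x < k" "y < c"
    have "(\<Sum>l<c. diag \<kappa> x l * V l y) = (\<Sum>l<c. if l = x then tp (\<kappa> x) * V x y else 0)"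
      by (intro sum.cong refl) (auto simp: diag_def)
    then show "Y x y = (\<Sum>l<c. diag \<kappa> x l * V l y)" by (simp add: Y_def)
  qed
  also have "\<dots> \<le> dord k c j X"
  proof (rule dord_mult_left[where L = U])
    fix x y assume "x < k" "y < c"
    have "(\<Sum>l<k. U x l * Y l y) = (\<Sum>l\<in>{..<min k c}. U x l * Y l y)"
      by (rule sum.mono_neutral_right) (auto simp: Y_def)
    also have "\<dots> = X x y" unfolding X_eq[OF \<open>x < k\<close> \<open>y < c\<close>] by (intro sum.cong refl) (auto simp: Y_def)
    finally show "X x y = (\<Sum>l<k. U x l * Y l y)" by simp
  qed
  finally have 1: "dord k c j (diag \<kappa>) \<le> dord k c j X" .
  have "dord k c j X \<le> dord k c j Y"
    by (rule dord_mult_left[where L = U']) (simp add: U'X Y_def)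
  also have "\<dots> \<le> dord k c j (diag \<kappa>)"
  proof (rule dord_mult_right[where R = V'])
    fix x y assume "x < k" "y < c"
    have "(\<Sum>l<c. Y x l * V' l y) = (if x < c then tp (\<kappa> x) * (\<Sum>l<c. V x l * V' l y) else 0)"
      by (simp add: Y_def sum_distrib_left mult_ac)
    then show "diag \<kappa> x y = (\<Sum>l<c. Y x l * V' l y)"
      using \<open>y < c\<close> by (auto simp: VV' diag_def)
  qed
  finally show ?thesis using 1 dord_diag[OF mono assms] by simp
qed

end

lemma smith_form_exists: "\<exists>U U' V V' \<kappa>. smith_form k c X U U' V V' \<kappa>"
proof -
  let ?X = "mat k c (\<lambda>(i, j). X i j)"
  obtain U V \<kappa> where U: "U \<in> carrier_mat k k" "ford (det U) = 0" and V: "V \<in> carrier_mat c c" "ford (det V) = 0"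
    and mono: "mono \<kappa>" and X: "?X = U * (diag_mat' k c \<kappa> * V)"
    using smith_mat[of ?X k c] by auto
  obtain U' where U': "U' \<in> carrier_mat k k" "U * U' = 1\<^sub>m k" "U' * U = 1\<^sub>m k" using unit_det_inverse[OF U] .
  obtain V' where V': "V' \<in> carrier_mat c c" "V * V' = 1\<^sub>m c" "V' * V = 1\<^sub>m c" using unit_det_inverse[OF V] .
  have prod: "(\<Sum>l<n. A $$ (x, l) * B $$ (l, y)) = (if x = y then 1 else 0)"
    if "A \<in> carrier_mat n n" "B \<in> carrier_mat n n" "A * B = 1\<^sub>m n" "x < n" "y < n"
    for A B :: "complex fps mat" and n x y
  proof -
    have 1: "(A * B) $$ (x, y) = (if x = y then 1 else 0)" using that by simp
    have 2: "(A * B) $$ (x, y) = (\<Sum>l<n. A $$ (x, l) * B $$ (l, y))"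
      using that(1,2,4,5) by (simp add: scalar_prod_def atLeast0LessThan)
    show ?thesis using 1 unfolding 2 .
  qed
  have "smith_form k c X (\<lambda>i j. U $$ (i, j)) (\<lambda>i j. U' $$ (i, j)) (\<lambda>i j. V $$ (i, j)) (\<lambda>i j. V' $$ (i, j)) \<kappa>"
  proof
    fix x y assume xy: "x < k" "y < c"
    have "X x y = (U * (diag_mat' k c \<kappa> * V)) $$ (x, y)" unfolding X[symmetric] using xy by simp
    also have "\<dots> = (\<Sum>l<k. U $$ (x, l) * (\<Sum>i<c. diag \<kappa> l i * V $$ (i, y)))"
      using U V xy by (simp add: scalar_prod_def diag_mat'_def atLeast0LessThan)
    also have "\<dots> = (\<Sum>l<k. if l < c then U $$ (x, l) * tp (\<kappa> l) * V $$ (l, y) else 0)"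
    proof (rule sum.cong[OF refl])
      fix l
      have "(\<Sum>i<c. diag \<kappa> l i * V $$ (i, y)) = (\<Sum>i<c. if i = l then tp (\<kappa> l) * V $$ (l, y) else 0)"
        by (intro sum.cong refl) (auto simp: diag_def)
      then show "U $$ (x, l) * (\<Sum>i<c. diag \<kappa> l i * V $$ (i, y)) = (if l < c then U $$ (x, l) * tp (\<kappa> l) * V $$ (l, y) else 0)"
        by (simp add: mult.assoc)
    qed
    also have "\<dots> = (\<Sum>l<min k c. U $$ (x, l) * tp (\<kappa> l) * V $$ (l, y))"
      by (rule sum.mono_neutral_cong_right) auto
    finally show "X x y = (\<Sum>l<min k c. U $$ (x, l) * tp (\<kappa> l) * V $$ (l, y))" .
  qed (use mono prod U U' V V' in auto)
  then show ?thesis by blast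
qed

section \<open>Bordering a diagonal matrix\<close>

text \<open>Applied to the row \<open>z\<close> and, transposed, to the column \<open>wt\<close>.
  \<open>A1\<close> says that the border brings the exponent number r down to at most g - 1,
  \<open>A2\<close> that the next one is at least h. Minors that avoid the border entries of index
  \<ge> r are too large for \<open>A1\<close>, so the least order \<nu> of these entries is small;
  comparing it with the minors in \<open>inner\<close> and \<open>bord\<close> gives the remaining
  conclusions.\<close>

lemma stack_orders:
  fixes \<kappa> :: "nat \<Rightarrow> enat" and St :: "nat \<Rightarrow> nat \<Rightarrow> complex fps" and h :: enat
  assumes mono: "mono \<kappa>" and r: "r < k" "r < c" and g: "\<kappa> r = enat g" "1 \<le> g"
    and small: "\<And>i. i < r \<Longrightarrow> \<kappa> i \<le> enat (g - 1)"
    and St: "\<And>x y. x < k \<Longrightarrow> y < c \<Longrightarrow> St x y = diag \<kappa> x y" and Sz: "\<And>y. y < c \<Longrightarrow> St k y = z y"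
    and A1: "dord (Suc k) c (Suc r) St \<le> dord (Suc k) c r St + enat (g - 1)"
    and A2: "\<And>q. r < q \<Longrightarrow> q < c \<Longrightarrow> dord (Suc k) c (Suc r) St + h \<le> dord (Suc k) c (Suc (Suc r)) St"
  obtains \<nu> q0 where "r \<le> q0" "q0 < c" "\<nu> \<le> g - 1" "ford (z q0) = enat \<nu>"
    "\<And>q. r \<le> q \<Longrightarrow> q < c \<Longrightarrow> enat \<nu> \<le> ford (z q)"
    "\<And>i. i < r \<Longrightarrow> enat \<nu> + \<kappa> i \<le> ford (z i) + enat (g - 1)"
    "\<And>q. r < q \<Longrightarrow> q < c \<Longrightarrow> enat \<nu> + h \<le> ford (z q) + enat g"
proof -
  let ?R = "\<lambda>j. dord (Suc k) c j St"
  obtain kn where kn: "\<And>i. i < r \<Longrightarrow> \<kappa> i = enat (kn i)"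
  proof
    show "\<kappa> i = enat (the_enat (\<kappa> i))" if "i < r" for i using small[OF that] by (cases "\<kappa> i") auto
  qed
  define K where "K = (\<Sum>i<r. kn i)"
  have sumK: "(\<Sum>i<r. \<kappa> i) = enat K" unfolding K_def by (simp add: kn of_nat_eq_enat[symmetric])
  have sumKg: "(\<Sum>i<Suc r. \<kappa> i) = enat (K + g)" using sumK g by simp
  have Rr: "?R r \<le> enat K"
  proof -
    have "?R r \<le> ford (minor r id id St)" using r by (intro dord_le) auto
    also have "minor r id id St = minor r id id (diag \<kappa>)" using r by (intro minor_cong) (auto intro!: St)
    finally show ?thesis by (simp add: minor_diag ford_prod sumK)
  qed
  then obtain a where a: "?R r = enat a" "a \<le> K" by (cases "?R r") auto
  then obtain b where b: "?R (Suc r) = enat b" "b \<le> a + (g - 1)" using A1 by (cases "?R (Suc r)") auto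
  \<comment> \<open>The minor on the first t diagonal entries together with the border row and the
    column q.\<close>
  have bord: "?R (Suc t) \<le> ford (z q) + (\<Sum>i<t. \<kappa> i)" if t: "t \<le> k" "t \<le> q" "q < c" for t q
  proof -
    let ?f = "\<lambda>a. if a < t then a else k" and ?g = "\<lambda>b. if b < t then b else q"
    have "minor (Suc t) ?f ?g St = det (mat (Suc t) (Suc t) (\<lambda>(a, b). if a = t then z (?g b) else if a = b then tp (\<kappa> a) else 0))"
      unfolding minor_def using t by (intro arg_cong[of _ _ det] eq_matI) (auto simp: St Sz diag_def less_Suc_eq)
    also have "\<dots> = z q * (\<Prod>a\<in>{0..<Suc t} - {t}. tp (\<kappa> a))" by (subst det_diag_row) auto
    also have "{0..<Suc t} - {t} = {..<t}" by auto
    finally have "ford (minor (Suc t) ?f ?g St) = ford (z q) + (\<Sum>i<t. \<kappa> i)" by (simp add: ford_mult ford_prod)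
    moreover have "?R (Suc t) \<le> ford (minor (Suc t) ?f ?g St)" using t by (intro dord_le) auto
    ultimately show ?thesis by simp
  qed
  \<comment> \<open>The leading r-minor with its row q replaced by the border.\<close>
  have inner: "?R r + \<kappa> q \<le> ford (z q) + enat K" if q: "q < r" for q
  proof -
    let ?f = "\<lambda>a. if a = q then k else a"
    have "minor r ?f id St = det (mat r r (\<lambda>(a, b). if a = q then z b else if a = b then tp (\<kappa> a) else 0))"
      unfolding minor_def using r by (intro arg_cong[of _ _ det] eq_matI) (auto simp: St Sz diag_def)
    also have "\<dots> = z q * (\<Prod>a\<in>{0..<r} - {q}. tp (\<kappa> a))" using q by (subst det_diag_row) auto
    finally have "ford (minor r ?f id St) = ford (z q) + (\<Sum>i\<in>{0..<r} - {q}. \<kappa> i)" by (simp add: ford_mult ford_prod)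
    moreover have "?R r \<le> ford (minor r ?f id St)" using q r by (intro dord_le) auto
    ultimately have "?R r + \<kappa> q \<le> ford (z q) + (\<Sum>i\<in>{0..<r} - {q}. \<kappa> i) + \<kappa> q" by (simp add: add_right_mono)
    also have "\<dots> = ford (z q) + (\<Sum>i<r. \<kappa> i)"
      using sum.remove[of "{..<r}" q \<kappa>] q by (simp add: atLeast0LessThan add_ac)
    finally show ?thesis by (simp add: sumK)
  qed
  \<comment> \<open>Minors without the border have order at least K + g, and by \<open>inner\<close>
    terms through a border entry of index below r have order at least a + g. Both exceed b, so b is
    controlled by the border entries of index \<ge> r.\<close>
  have lower: "N + K \<le> b" if N: "\<And>q. r \<le> q \<Longrightarrow> q < c \<Longrightarrow> enat N \<le> ford (z q)" for N
  proof -
    have "enat (min (N + K) (a + g)) \<le> ?R (Suc r)"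
    proof (rule dord_geI)
      fix f g' assume f: "\<forall>i<Suc r. f i < Suc k" and g': "\<forall>i<Suc r. g' i < c"
        and inj: "inj_on f {..<Suc r}" "inj_on g' {..<Suc r}"
      show "enat (min (N + K) (a + g)) \<le> ford (minor (Suc r) f g' St)"
      proof (cases "\<exists>l<Suc r. f l = k")
        case False
        then have fk: "f i < k" if "i < Suc r" for i using f that by (auto simp: less_Suc_eq)
        have "minor (Suc r) f g' St = minor (Suc r) f g' (diag \<kappa>)" using fk g' by (intro minor_cong) (auto intro!: St)
        then have "enat (K + g) \<le> ford (minor (Suc r) f g' St)"
          using minor_diag_ge[OF mono inj] unfolding sumKg by simp
        moreover have "enat (min (N + K) (a + g)) \<le> enat (K + g)" using a(2) by simp
        ultimately show ?thesis by (rule order_trans[rotated])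
      next
        case True
        then obtain l where l: "l < Suc r" "f l = k" by blast
        have fk: "f i < k" if "i < Suc r" "i \<noteq> l" for i
          using f that l inj_onD[OF inj(1), of i l] by (force simp: less_Suc_eq)
        have "minor (Suc r) f g' St = det (mat (Suc r) (Suc r) (\<lambda>(a, b). if a = l then z (g' b) else diag \<kappa> (f a) (g' b)))"
          unfolding minor_def by (intro arg_cong[of _ _ det] eq_matI) (use fk l g' in \<open>auto simp: St Sz\<close>)
        also have "enat (min (N + K) (a + g)) \<le> ford \<dots>"
        proof (rule det_diag_row_ge[OF inj l(1)])
          fix q S assume q: "q \<in> g' ` {..<Suc r}" and S: "finite S" "card S = Suc r - 1" "q \<notin> S"
          have qc: "q < c" using q g' by auto
          show "enat (min (N + K) (a + g)) \<le> ford (z q) + (\<Sum>i\<in>S. \<kappa> i)"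
          proof (cases "r \<le> q")
            case True
            have "enat K \<le> (\<Sum>i\<in>S. \<kappa> i)" using sum_ge_initial[OF mono S(1)] S(2) sumK by simp
            then have "enat N + enat K \<le> ford (z q) + (\<Sum>i\<in>S. \<kappa> i)" using N[OF True qc] by (rule add_mono[rotated])
            moreover have "enat (min (N + K) (a + g)) \<le> enat N + enat K" by simp
            ultimately show ?thesis by (rule order_trans[rotated])
          next
            case False
            then have qr: "q < r" by simp
            have "(\<Sum>i<card (insert q S). \<kappa> i) \<le> (\<Sum>i\<in>insert q S. \<kappa> i)" using S by (intro sum_ge_initial[OF mono]) auto
            then have s: "enat (K + g) \<le> \<kappa> q + (\<Sum>i\<in>S. \<kappa> i)" using S sumKg by simp
            note i = inner[OF qr]
            show ?thesis
              using s i kn[OF qr] a by (cases "ford (z q)"; cases "\<Sum>i\<in>S. \<kappa> i") auto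
          qed
        qed
        finally show ?thesis .
      qed
    qed
    then have "min (N + K) (a + g) \<le> b" by (simp add: b(1))
    then show ?thesis using b(2) g(2) by auto
  qed
  define q0 where "q0 = (ARG_MIN (\<lambda>q. ford (z q)) q. q \<in> {r..<c})"
  have ne: "finite {r..<c}" "{r..<c} \<noteq> {}" using r by auto
  have q0: "q0 \<in> {r..<c}" "\<And>q. q \<in> {r..<c} \<Longrightarrow> ford (z q0) \<le> ford (z q)"
    using arg_min_if_finite(1)[OF ne, of "\<lambda>q. ford (z q)"] arg_min_least[OF ne, of _ "\<lambda>q. ford (z q)"]
    unfolding q0_def arg_min_on_def by auto
  have "ford (z q0) \<noteq> \<infinity>"
  proof
    assume "ford (z q0) = \<infinity>"
    then have "Suc b + K \<le> b" using q0(2) by (intro lower) (metis atLeastLessThan_iff enat_ord_simps(3) order_trans)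
    then show False by simp
  qed
  then obtain \<nu> where \<nu>: "ford (z q0) = enat \<nu>" by (cases "ford (z q0)") auto
  have min: "enat \<nu> \<le> ford (z q)" if "r \<le> q" "q < c" for q using q0(2)[of q] that \<nu> by simp
  have \<nu>K: "\<nu> + K \<le> b" by (rule lower) (rule min)
  show ?thesis
  proof (rule that[of q0 \<nu>])
    show "\<nu> \<le> g - 1" using \<nu>K b a by simp
    show "enat \<nu> + \<kappa> i \<le> ford (z i) + enat (g - 1)" if "i < r" for i
      using inner[OF that] kn[OF that] a b \<nu>K by (cases "ford (z i)") auto
    show "enat \<nu> + h \<le> ford (z q) + enat g" if "r < q" "q < c" for q
    proof (cases "ford (z q)")
      case (enat zq)
      have "?R (Suc (Suc r)) \<le> ford (z q) + (\<Sum>i<Suc r. \<kappa> i)" using that r by (intro bord) auto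
      then have "enat b + h \<le> enat zq + enat (K + g)"
        using A2[OF that] unfolding b(1) sumKg enat by (rule order_trans[rotated])
      then show ?thesis using \<nu>K enat by (cases h) auto
    qed simp
  qed (use q0 \<nu> min in auto)
qed

section \<open>Families of matrices\<close>

definition mm :: "nat \<Rightarrow> (nat \<Rightarrow> nat \<Rightarrow> 'a::comm_ring_1) \<Rightarrow> (nat \<Rightarrow> nat \<Rightarrow> 'a) \<Rightarrow> nat \<Rightarrow> nat \<Rightarrow> 'a" where
  "mm n X Y x y = (\<Sum>l<n. X x l * Y l y)"

lemma mm_assoc: "mm n (mm m X Y) Z = mm m X (mm n Y Z)"
proof (intro ext)
  fix x y
  have "mm n (mm m X Y) Z x y = (\<Sum>l<n. \<Sum>i<m. X x i * (Y i l * Z l y))"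
    by (simp add: mm_def sum_distrib_right mult.assoc)
  also have "\<dots> = (\<Sum>i<m. \<Sum>l<n. X x i * (Y i l * Z l y))" by (rule sum.swap)
  also have "\<dots> = mm m X (mm n Y Z) x y" by (simp add: mm_def sum_distrib_left)
  finally show "mm n (mm m X Y) Z x y = mm m X (mm n Y Z) x y" .
qed

lemma mm_cong:
  "(\<And>l. l < n \<Longrightarrow> X x l = X' x l) \<Longrightarrow> (\<And>l. l < n \<Longrightarrow> Y l y = Y' l y) \<Longrightarrow> mm n X Y x y = mm n X' Y' x y"
  by (simp add: mm_def)

lemma mm_id_left:
  assumes "x < n" "\<And>l. l < n \<Longrightarrow> X x l = (if x = l then 1 else 0)"
  shows "mm n X Y x y = Y x y"
proof -
  have "mm n X Y x y = (\<Sum>l<n. if l = x then Y l y else 0)"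
    unfolding mm_def by (intro sum.cong refl) (use assms in auto)
  then show ?thesis using assms by simp
qed

lemma mm_id_right:
  assumes "y < n" "\<And>l. l < n \<Longrightarrow> Y l y = (if l = y then 1 else 0)"
  shows "mm n X Y x y = X x y"
proof -
  have "mm n X Y x y = (\<Sum>l<n. if l = y then X x l else 0)"
    unfolding mm_def by (intro sum.cong refl) (use assms in auto)
  then show ?thesis using assms by simp
qed

lemma dord_mm_left: "(\<And>x y. x < k' \<Longrightarrow> y < c \<Longrightarrow> B x y = mm k L A x y) \<Longrightarrow> dord k c j A \<le> dord k' c j B"
  by (rule dord_mult_left[where L = L]) (simp add: mm_def)

lemma dord_mm_right: "(\<And>x y. x < k \<Longrightarrow> y < c' \<Longrightarrow> B x y = mm c A R x y) \<Longrightarrow> dord k c j A \<le> dord k c' j B"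
  by (rule dord_mult_right[where R = R]) (simp add: mm_def)

text \<open>Continuity at 0 of each coefficient separately. This suffices because a polynomial
  function on the arc space involves only finitely many coefficients.\<close>

definition fcont :: "(complex \<Rightarrow> complex fps) \<Rightarrow> bool" where
  "fcont F \<longleftrightarrow> (\<forall>N. isCont (\<lambda>s. fps_nth (F s) N) 0)"

lemma fcont_const [intro]: "fcont (\<lambda>_. f)" by (simp add: fcont_def)

lemma fcont_fps_const:
  assumes "isCont f 0"
  shows "fcont (\<lambda>s. fps_const (f s))"
  unfolding fcont_def
proof
  fix N
  show "isCont (\<lambda>s. fps_nth (fps_const (f s)) N) 0" using assms by (cases "N = 0") simp_all
qed

lemma fcont_add: "fcont F \<Longrightarrow> fcont G \<Longrightarrow> fcont (\<lambda>s. F s + G s)" by (auto simp: fcont_def)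

lemma fcont_diff: "fcont F \<Longrightarrow> fcont G \<Longrightarrow> fcont (\<lambda>s. F s - G s)" by (auto simp: fcont_def)

lemma fcont_mult: "fcont F \<Longrightarrow> fcont G \<Longrightarrow> fcont (\<lambda>s. F s * G s)"
  unfolding fcont_def fps_mult_nth by (auto intro!: continuous_intros)

lemma fcont_sum: "(\<And>i. i \<in> S \<Longrightarrow> fcont (F i)) \<Longrightarrow> fcont (\<lambda>s. \<Sum>i\<in>S. F i s)"
  by (induction S rule: infinite_finite_induct) (auto intro: fcont_add)

lemma fcont_prod: "(\<And>i. i \<in> S \<Longrightarrow> fcont (F i)) \<Longrightarrow> fcont (\<lambda>s. \<Prod>i\<in>S. F i s)"
  by (induction S rule: infinite_finite_induct) (auto intro: fcont_mult)

lemma fcont_det: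
  assumes "\<And>a b. a < j \<Longrightarrow> b < j \<Longrightarrow> fcont (\<lambda>s. F s a b)"
  shows "fcont (\<lambda>s. det (mat j j (\<lambda>(a, b). F s a b)))"
  unfolding det_mat_Leibniz
proof (intro fcont_sum fcont_mult fcont_const fcont_prod)
  fix p i assume "p \<in> {p. p permutes {0..<j}}" "i \<in> {0..<j}"
  then show "fcont (\<lambda>s. F s i (p i))" using permutes_in_image[of p "{0..<j}" i] by (intro assms) auto
qed

lemma eventually_nth_ne:
  assumes "fcont F" "fps_nth (F 0) m \<noteq> 0"
  shows "eventually (\<lambda>s. fps_nth (F s) m \<noteq> 0) (at 0)"
  using assms by (auto simp: fcont_def isCont_def intro: tendsto_imp_eventually_ne)

text \<open>The coefficient that gives a minor its least order at s = 0 stays nonzero for small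
  s.\<close>

lemma dord_semicontinuous:
  assumes "\<And>x y. x < k \<Longrightarrow> y < c \<Longrightarrow> fcont (\<lambda>s. B s x y)"
  shows "eventually (\<lambda>s. dord k c j (B s) \<le> dord k c j (B 0)) (at 0)"
proof (cases "dord k c j (B 0) < \<infinity>")
  case True
  then obtain f g where fg: "\<forall>a<j. f a < k" "\<forall>b<j. g b < c" and eq: "ford (minor j f g (B 0)) = dord k c j (B 0)"
    by (rule dord_attained)
  then obtain e where e: "ford (minor j f g (B 0)) = enat e" using True by auto
  then have "fps_nth (minor j f g (B 0)) e \<noteq> 0" by (auto simp: ford_eq split: if_splits)
  moreover have "fcont (\<lambda>s. minor j f g (B s))"
    unfolding minor_def by (rule fcont_det) (use fg in \<open>auto intro: assms\<close>)
  ultimately have "eventually (\<lambda>s. fps_nth (minor j f g (B s)) e \<noteq> 0) (at 0)" by (intro eventually_nth_ne)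
  then show ?thesis
  proof eventually_elim
    case (elim s)
    have "dord k c j (B s) \<le> ford (minor j f g (B s))" using fg by (intro dord_le) auto
    also have "\<dots> \<le> enat e" using elim by (rule ford_le)
    finally show ?case using e eq by simp
  qed
qed simp

lemma eventually_avoid_finite: "finite S \<Longrightarrow> eventually (\<lambda>s. s \<notin> S) (at (0 :: complex))"
proof -
  assume S: "finite S"
  have "eventually (\<lambda>s. s \<noteq> x) (at (0 :: complex))" for x
  proof (cases "x = 0")
    case True
    then show ?thesis by (simp add: eventually_at_filter)
  next
    case False
    then show ?thesis using tendsto_imp_eventually_ne[OF tendsto_ident_at, of 0 x UNIV] by simp
  qed
  then have "eventually (\<lambda>s. \<forall>x\<in>S. s \<noteq> x) (at 0)" by (intro eventually_ball_finite[OF S]) auto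
  then show ?thesis by eventually_elim auto
qed

text \<open>Bookkeeping for the coefficients C and D of \<open>dord_before\<close> and
  \<open>dord_after\<close>, which carry one correction at index r and one at the indices below
  r.\<close>

lemma sum_single_corrections:
  fixes t :: "nat \<Rightarrow> 'a::comm_ring_1"
  assumes "r < m"
  shows "(\<Sum>i<m. (a i - (if i = r \<and> Q then b else 0) - (if i < r then d i else 0)) * t i)
    = (\<Sum>i<m. a i * t i) - (if Q then b * t r else 0) - (\<Sum>i<r. d i * t i)"
proof -
  have "(\<Sum>i<m. (a i - (if i = r \<and> Q then b else 0) - (if i < r then d i else 0)) * t i)
    = (\<Sum>i<m. a i * t i) - (\<Sum>i<m. if i = r then (if Q then b * t i else 0) else 0) - (\<Sum>i<m. if i < r then d i * t i else 0)"
    unfolding sum_subtractf[symmetric] by (intro sum.cong refl) (auto simp: algebra_simps)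
  also have "(\<Sum>i<m. if i = r then (if Q then b * t i else 0) else 0) = (if Q then b * t r else 0)"
    using assms by simp
  also have "(\<Sum>i<m. if i < r then d i * t i else 0) = (\<Sum>i<r. d i * t i)"
    using assms by (intro sum.mono_neutral_cong_right) auto
  finally show ?thesis .
qed

text \<open>A change of basis: replacing W p by W p - T * W r adds S times the p-coordinate to the
  r-coordinate. For p different from r this means T = S; for p = r the basis vector is scaled by 1 -
  T and its coordinate by 1 + S.\<close>

lemma sum_twist:
  fixes a W :: "nat \<Rightarrow> 'a::comm_ring_1"
  assumes "r < n" "r \<le> p" "p < n" and ST: "T * (1 + (if p = r then S else 0)) = S"
  shows "(\<Sum>l<n. ((if l < r then 0 else a l) + (if l = r then S * a p else 0)) * (W l - (if l = p then T * W r else 0)))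
    = (\<Sum>l\<in>{r..<n}. a l * W l)"
proof -
  let ?b = "\<lambda>l. (if l < r then 0 else a l) + (if l = r then S * a p else 0)"
  have "(\<Sum>l<n. ?b l * (W l - (if l = p then T * W r else 0)))
    = (\<Sum>l<n. if l < r then 0 else a l * W l) + (\<Sum>l<n. if l = r then S * a p * W l else 0) - (\<Sum>l<n. if l = p then ?b l * (T * W r) else 0)"
    unfolding sum.distrib[symmetric] sum_subtractf[symmetric] by (intro sum.cong refl) (auto simp: algebra_simps)
  also have "(\<Sum>l<n. if l < r then 0 else a l * W l) = (\<Sum>l\<in>{r..<n}. a l * W l)"
    by (rule sum.mono_neutral_cong_right) auto
  also have "(\<Sum>l<n. if l = r then S * a p * W l else 0) = S * a p * W r" using assms by simp
  also have "(\<Sum>l<n. if l = p then ?b l * (T * W r) else 0) = ?b p * (T * W r)"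
    using assms by simp
  also have "?b p * (T * W r) = (T * (1 + (if p = r then S else 0))) * a p * W r"
    using assms(2) by (cases "p = r") (simp_all add: algebra_simps)
  finally show ?thesis unfolding ST by simp
qed

text \<open>Division by \<open>tp e\<close>. For e = \<infinity> the dividend is 0 and any series is
  a quotient.\<close>

definition quot :: "enat \<Rightarrow> complex fps \<Rightarrow> complex fps" where
  "quot e f = (SOME w. f = tp e * w)"

lemma quot: "e \<le> ford f \<Longrightarrow> f = tp e * quot e f"
  unfolding quot_def by (erule tp_dvd) (rule someI)

text \<open>The wedge. In coordinates in which the first \<open>c\<close> columns are the diagonal matrix with
  exponents \<open>\<kappa>\<close>, the column \<open>c\<close> and the linear form vanishing on the first \<open>c - 1\<close> columns have
  the coordinates \<open>wt\<close> and \<open>z\<close>. Adding a multiple of the product of their parts of index at least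
  \<open>r\<close> changes the columns before \<open>c\<close> by row operations and those after \<open>c\<close> by column operations.
  The twist by \<open>tw\<close> makes the two parts pair nontrivially modulo \<open>t\<close>.\<close>

definition tw :: "nat \<Rightarrow> nat \<Rightarrow> complex \<Rightarrow> complex" where
  "tw r p s = (if p = r then s / (1 + s) else s)"

text \<open>\<open>wt\<close> holds the coordinates of column c with respect to the columns of U,
  and \<open>z\<close> those of the coordinate form number c - 1 with respect to the rows of V. The
  order conditions are the conclusions of \<open>stack_orders\<close>; p0 and q0 mark entries of
  least order among the indices \<ge> r.\<close>

locale wedge = smith_form k c A U U' V V' \<kappa>
  for k c :: nat and A U U' V V' :: "nat \<Rightarrow> nat \<Rightarrow> complex fps" and \<kappa> :: "nat \<Rightarrow> enat" +
  fixes r g \<nu> p0 \<nu>' q0 :: nat and h :: enat and wt z :: "nat \<Rightarrow> complex fps"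
  assumes r: "r < k" "r < c" and g: "\<kappa> r = enat g" "1 \<le> g"
    and small: "i < r \<Longrightarrow> \<kappa> i \<le> enat (g - 1)"
    and plateau: "r < i \<Longrightarrow> i < min k c \<Longrightarrow> \<kappa> i = h"
    and wt: "i < k \<Longrightarrow> wt i = (\<Sum>x<k. U' i x * A x c)"
    and z: "i < c \<Longrightarrow> z i = V' (c - 1) i"
    and p0: "r \<le> p0" "p0 < k" "\<nu> \<le> g - 1" "ford (wt p0) = enat \<nu>"
    and q0: "r \<le> q0" "q0 < c" "\<nu>' \<le> g - 1" "ford (z q0) = enat \<nu>'"
    and wt_min: "r \<le> i \<Longrightarrow> i < k \<Longrightarrow> enat \<nu> \<le> ford (wt i)"
    and z_min: "r \<le> i \<Longrightarrow> i < c \<Longrightarrow> enat \<nu>' \<le> ford (z i)"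
    and wt_small: "i < r \<Longrightarrow> enat \<nu> + \<kappa> i \<le> ford (wt i) + enat (g - 1)"
    and z_small: "i < r \<Longrightarrow> enat \<nu>' + \<kappa> i \<le> ford (z i) + enat (g - 1)"
    and wt_plateau: "r < i \<Longrightarrow> i < k \<Longrightarrow> enat \<nu> + h \<le> ford (wt i) + enat g"
begin

text \<open>One less than the exponent \<open>\<kappa> r\<close> = g: the rank-one term has to
  contribute at the order that this exponent is to be lowered to.\<close>

definition "gt = tp (enat (g - 1))"

lemma ford_gt [simp]: "ford gt = enat (g - 1)"
  by (simp add: gt_def)

definition "ws i = quot (enat \<nu>) (wt i)"
definition "zs i = quot (enat \<nu>') (z i)"
text \<open>Used for i < r, where \<open>wt_small\<close> and \<open>z_small\<close> make the
  products with \<open>gt\<close> divisible. These parts of the column and of the form are thereby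
  multiples of the i-th diagonal entry and can be absorbed by the first c columns.\<close>

definition "ba i = quot (enat \<nu> + \<kappa> i) (gt * wt i)"
definition "bz i = quot (enat \<nu>' + \<kappa> i) (gt * z i)"
text \<open>The part of index \<ge> r of column c, divided by t^\<nu>; the coordinate
  \<open>ws p0\<close> is a unit. Likewise \<open>\<zeta>\<close> for the form, with t^\<nu>' and
  the unit \<open>zs q0\<close>.\<close>

definition "\<omega> x = (\<Sum>i\<in>{r..<k}. ws i * U x i)"
definition "\<zeta> y = (\<Sum>i\<in>{r..<c}. zs i * V i y)"

lemma ws: "r \<le> i \<Longrightarrow> i < k \<Longrightarrow> wt i = tp (enat \<nu>) * ws i"
  unfolding ws_def by (rule quot) (rule wt_min)

lemma zs: "r \<le> i \<Longrightarrow> i < c \<Longrightarrow> z i = tp (enat \<nu>') * zs i"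
  unfolding zs_def by (rule quot) (rule z_min)

lemma ba: "i < r \<Longrightarrow> gt * wt i = tp (enat \<nu>) * (tp (\<kappa> i) * ba i)"
  using quot[of "enat \<nu> + \<kappa> i" "gt * wt i"] wt_small[of i]
  by (simp add: ba_def ford_mult add.commute tp_add mult.assoc)

lemma bz: "i < r \<Longrightarrow> gt * z i = tp (enat \<nu>') * (tp (\<kappa> i) * bz i)"
  using quot[of "enat \<nu>' + \<kappa> i" "gt * z i"] z_small[of i]
  by (simp add: bz_def ford_mult add.commute tp_add mult.assoc)

lemma tp_enat_ne: "tp (enat n) \<noteq> 0"
  by (simp add: tp_def)

lemma gt_split:
  assumes "n \<le> g - 1"
  shows "gt = tp (enat n) * tp (enat (g - 1 - n))"
proof -
  have "enat (g - 1) = enat n + enat (g - 1 - n)" using assms by simp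
  then show ?thesis unfolding gt_def by (simp only: tp_add)
qed

text \<open>Exhibits \<open>gt * \<omega>\<close> as a combination of column c and of the vectors
  \<open>U x i * tp (\<kappa> i)\<close>, which by \<open>XV'\<close> are combinations of the first
  c columns. The common factor t^\<nu> is introduced and cancelled at the end.\<close>

lemma gt_\<omega>:
  assumes "x < k"
  shows "gt * \<omega> x = tp (enat (g - 1 - \<nu>)) * A x c - (\<Sum>i<r. ba i * (U x i * tp (\<kappa> i)))"
proof -
  have "(\<Sum>i<k. U x i * wt i) = (\<Sum>i<k. \<Sum>y<k. U x i * U' i y * A y c)"
    by (simp add: wt sum_distrib_left mult.assoc)
  also have "\<dots> = (\<Sum>y<k. (\<Sum>i<k. U x i * U' i y) * A y c)"
    unfolding sum_distrib_right by (rule sum.swap)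
  also have "\<dots> = (\<Sum>y<k. if y = x then A y c else 0)"
    using assms by (intro sum.cong refl) (auto simp: UU')
  also have "\<dots> = A x c" using assms by simp
  finally have e: "A x c = (\<Sum>i<k. U x i * wt i)" ..
  also have "\<dots> = (\<Sum>i<r. U x i * wt i) + (\<Sum>i\<in>{r..<k}. U x i * wt i)"
    using r by (subst sum.union_disjoint[symmetric]) (auto intro!: sum.cong)
  also have "(\<Sum>i\<in>{r..<k}. U x i * wt i) = tp (enat \<nu>) * \<omega> x"
    unfolding \<omega>_def sum_distrib_left by (intro sum.cong refl) (auto simp: ws mult_ac)
  finally have "gt * (tp (enat \<nu>) * \<omega> x) = gt * A x c - (\<Sum>i<r. U x i * (gt * wt i))"
    by (simp add: algebra_simps sum_distrib_left)
  also have "(\<Sum>i<r. U x i * (gt * wt i)) = tp (enat \<nu>) * (\<Sum>i<r. ba i * (U x i * tp (\<kappa> i)))"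
    unfolding sum_distrib_left by (intro sum.cong refl) (subst ba, simp, simp add: mult_ac)
  also have "gt * A x c = tp (enat \<nu>) * (tp (enat (g - 1 - \<nu>)) * A x c)"
    using gt_split[OF p0(3)] by (simp add: mult.assoc)
  finally have "tp (enat \<nu>) * (gt * \<omega> x) = tp (enat \<nu>) * (tp (enat (g - 1 - \<nu>)) * A x c - (\<Sum>i<r. ba i * (U x i * tp (\<kappa> i))))"
    by (simp only: right_diff_distrib mult.left_commute[of "tp (enat \<nu>)" gt])
  then show ?thesis by (rule mult_left_cancel[OF tp_enat_ne, THEN iffD1])
qed

text \<open>On the columns before c - 1 the first term vanishes, and \<open>gt * \<zeta>\<close> is
  a combination of the vectors \<open>tp (\<kappa> i) * V i y\<close>, which by \<open>U'X\<close>
  are combinations of rows.\<close>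

lemma gt_\<zeta>:
  assumes "y < c"
  shows "gt * \<zeta> y = tp (enat (g - 1 - \<nu>')) * (if y = c - 1 then 1 else 0) - (\<Sum>i<r. bz i * (tp (\<kappa> i) * V i y))"
proof -
  have "(\<Sum>i<c. z i * V i y) = (\<Sum>i<c. V' (c - 1) i * V i y)" by (simp add: z)
  also have "\<dots> = (if y = c - 1 then 1 else 0)" using assms by (auto simp: V'V)
  finally have "(if y = c - 1 then 1 else 0) = (\<Sum>i<c. z i * V i y)" ..
  also have "\<dots> = (\<Sum>i<r. z i * V i y) + (\<Sum>i\<in>{r..<c}. z i * V i y)"
    using r by (subst sum.union_disjoint[symmetric]) (auto intro!: sum.cong)
  also have "(\<Sum>i\<in>{r..<c}. z i * V i y) = tp (enat \<nu>') * \<zeta> y"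
    unfolding \<zeta>_def sum_distrib_left by (intro sum.cong refl) (auto simp: zs mult_ac)
  finally have "gt * (tp (enat \<nu>') * \<zeta> y) = gt * (if y = c - 1 then 1 else 0) - (\<Sum>i<r. V i y * (gt * z i))"
    by (simp add: algebra_simps sum_distrib_left)
  also have "(\<Sum>i<r. V i y * (gt * z i)) = tp (enat \<nu>') * (\<Sum>i<r. bz i * (tp (\<kappa> i) * V i y))"
    unfolding sum_distrib_left by (intro sum.cong refl) (subst bz, simp, simp add: mult_ac)
  also have "gt * (if y = c - 1 then 1 else 0) = tp (enat \<nu>') * (tp (enat (g - 1 - \<nu>')) * (if y = c - 1 then 1 else 0))"
    using gt_split[OF q0(3)] by (simp add: mult.assoc)
  finally have "tp (enat \<nu>') * (gt * \<zeta> y) = tp (enat \<nu>') * (tp (enat (g - 1 - \<nu>')) * (if y = c - 1 then 1 else 0) - (\<Sum>i<r. bz i * (tp (\<kappa> i) * V i y)))"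
    by (simp only: right_diff_distrib mult.left_commute[of "tp (enat \<nu>')" gt])
  then show ?thesis by (rule mult_left_cancel[OF tp_enat_ne, THEN iffD1])
qed

abbreviation "m \<equiv> min k c"

definition "us s x i = U x i - (if i = p0 then fps_const (tw r p0 s) * U x r else 0)"
definition "vs s i y = V i y - (if i = q0 then fps_const (tw r q0 s) * V r y else 0)"
text \<open>Only the first c columns change. For 1 + s nonzero they are the product of
  \<open>us\<close>, \<open>G\<close> and \<open>vs\<close>, where \<open>G\<close> is the diagonal
  matrix plus a rank-one term: the diagonal part is carried over to the twisted bases, while
  \<open>\<omega>\<close> and \<open>\<zeta>\<close> remain the same vectors and receive new
  coordinates there.\<close>

definition "B s x y = (if y < c then (\<Sum>i<m. us s x i * (tp (\<kappa> i) * vs s i y)) + fps_const s * gt * \<omega> x * \<zeta> y else A x y)"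

lemma \<kappa>_quot: "r \<le> i \<Longrightarrow> tp (\<kappa> i) = tp (\<kappa> r) * quot (\<kappa> r) (tp (\<kappa> i))"
  by (rule quot) (simp add: monoD[OF mono])

text \<open>On these columns both changes are row operations. The twist at q0 can be moved into the
  r-th diagonal row because \<open>\<kappa> r\<close> \<le> \<open>\<kappa> q0\<close>, and the
  rank-one term is covered by \<open>gt_\<zeta>\<close>.\<close>

lemma dord_before:
  assumes c': "c' < c"
  shows "dord k c' j A \<le> dord k c' j (B s)"
proof -
  \<comment> \<open>Coefficients with respect to the rows \<open>tp (\<kappa> i) * V i y\<close>:
    the second summand undoes the twist of V q0, which occurs in the sum only if q0 < k, and the
    third one produces the rank-one term.\<close>
  define C where "C x i = us s x i - (if i = r \<and> q0 < k then us s x q0 * fps_const (tw r q0 s) * quot (\<kappa> r) (tp (\<kappa> q0)) else 0)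
    - (if i < r then fps_const s * \<omega> x * bz i else 0)" for x i
  have eq: "B s x y = (\<Sum>i<m. C x i * (tp (\<kappa> i) * V i y))" if "x < k" "y < c'" for x y
  proof -
    have y: "y < c" "y \<noteq> c - 1" using that c' by auto
    have "(\<Sum>i<m. C x i * (tp (\<kappa> i) * V i y)) = (\<Sum>i<m. us s x i * (tp (\<kappa> i) * V i y))
      - (if q0 < k then us s x q0 * fps_const (tw r q0 s) * quot (\<kappa> r) (tp (\<kappa> q0)) * (tp (\<kappa> r) * V r y) else 0)
      - (\<Sum>i<r. fps_const s * \<omega> x * bz i * (tp (\<kappa> i) * V i y))"
      unfolding C_def using r by (intro sum_single_corrections) simp
    also have "(if q0 < k then us s x q0 * fps_const (tw r q0 s) * quot (\<kappa> r) (tp (\<kappa> q0)) * (tp (\<kappa> r) * V r y) else 0)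
       = (\<Sum>i<m. if i = q0 then us s x i * (tp (\<kappa> i) * (fps_const (tw r q0 s) * V r y)) else 0)"
      using q0 \<kappa>_quot[OF q0(1)] by (simp add: mult_ac)
    also have "(\<Sum>i<m. us s x i * (tp (\<kappa> i) * V i y)) - \<dots> = (\<Sum>i<m. us s x i * (tp (\<kappa> i) * vs s i y))"
      unfolding sum_subtractf[symmetric] by (intro sum.cong refl) (auto simp: vs_def algebra_simps)
    also have "(\<Sum>i<r. fps_const s * \<omega> x * bz i * (tp (\<kappa> i) * V i y)) = - (fps_const s * \<omega> x * (gt * \<zeta> y))"
      unfolding gt_\<zeta>[OF y(1)] using y(2) by (simp add: sum_distrib_left mult_ac)
    finally show ?thesis using y by (simp add: B_def mult_ac)
  qed
  show ?thesis
  proof (rule dord_mult_left[where L = "\<lambda>x x'. \<Sum>i<m. C x i * U' i x'"])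
    fix x y assume xy: "x < k" "y < c'"
    have "(\<Sum>l<k. (\<Sum>i<m. C x i * U' i l) * A l y) = (\<Sum>l<k. \<Sum>i<m. C x i * (U' i l * A l y))"
      by (simp add: sum_distrib_right mult.assoc)
    also have "\<dots> = (\<Sum>i<m. C x i * (\<Sum>l<k. U' i l * A l y))"
      unfolding sum_distrib_left by (rule sum.swap)
    also have "\<dots> = (\<Sum>i<m. C x i * (tp (\<kappa> i) * V i y))"
      using xy c' by (intro sum.cong refl) (simp add: U'X)
    finally show "B s x y = (\<Sum>l<k. (\<Sum>i<m. C x i * U' i l) * A l y)" using eq[OF xy] by simp
  qed
qed

text \<open>The transposed argument: now column c is available, so \<open>gt_\<omega>\<close> turns
  the rank-one term into a column operation.\<close>

lemma dord_after:
  assumes c': "c < c'"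
  shows "dord k c' j A \<le> dord k c' j (B s)"
proof -
  define D where "D y i = vs s i y - (if i = r \<and> p0 < c then fps_const (tw r p0 s) * quot (\<kappa> r) (tp (\<kappa> p0)) * vs s p0 y else 0)
    - (if i < r then fps_const s * \<zeta> y * ba i else 0)" for y i
  \<comment> \<open>The multiple of column c that is added to column y.\<close>
  define e where "e y = fps_const s * tp (enat (g - 1 - \<nu>)) * \<zeta> y" for y
  have eq: "B s x y = (\<Sum>i<m. D y i * (U x i * tp (\<kappa> i))) + A x c * e y" if "x < k" "y < c" for x y
  proof -
    have "(\<Sum>i<m. D y i * (U x i * tp (\<kappa> i))) = (\<Sum>i<m. vs s i y * (U x i * tp (\<kappa> i)))
      - (if p0 < c then fps_const (tw r p0 s) * quot (\<kappa> r) (tp (\<kappa> p0)) * vs s p0 y * (U x r * tp (\<kappa> r)) else 0)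
      - (\<Sum>i<r. fps_const s * \<zeta> y * ba i * (U x i * tp (\<kappa> i)))"
      unfolding D_def using r by (intro sum_single_corrections) simp
    also have "(if p0 < c then fps_const (tw r p0 s) * quot (\<kappa> r) (tp (\<kappa> p0)) * vs s p0 y * (U x r * tp (\<kappa> r)) else 0)
       = (\<Sum>i<m. if i = p0 then fps_const (tw r p0 s) * U x r * (tp (\<kappa> i) * vs s i y) else 0)"
      using p0 \<kappa>_quot[OF p0(1)] by (simp add: mult_ac)
    also have "(\<Sum>i<m. vs s i y * (U x i * tp (\<kappa> i))) - \<dots> = (\<Sum>i<m. us s x i * (tp (\<kappa> i) * vs s i y))"
      unfolding sum_subtractf[symmetric] by (intro sum.cong refl) (auto simp: us_def algebra_simps)
    also have "(\<Sum>i<r. fps_const s * \<zeta> y * ba i * (U x i * tp (\<kappa> i))) = fps_const s * \<zeta> y * (tp (enat (g - 1 - \<nu>)) * A x c - gt * \<omega> x)"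
      unfolding gt_\<omega>[OF that(1)] by (simp add: sum_distrib_left mult_ac)
    finally show ?thesis using that by (simp add: B_def e_def algebra_simps)
  qed
  define R where "R l y = (if y < c then (if l < c then \<Sum>i<m. V' l i * D y i else if l = c then e y else 0)
      else if l = y then 1 else 0)" for l y
  show ?thesis
  proof (rule dord_mult_right[where R = R])
    fix x y assume xy: "x < k" "y < c'"
    show "B s x y = (\<Sum>l<c'. A x l * R l y)"
    proof (cases "y < c")
      case True
      have "(\<Sum>l<c'. A x l * R l y) = (\<Sum>l\<in>{..<Suc c}. A x l * R l y)"
        using c' True by (intro sum.mono_neutral_right) (auto simp: R_def)
      also have "\<dots> = (\<Sum>l<c. \<Sum>i<m. (A x l * V' l i) * D y i) + A x c * e y"
        using True by (simp add: R_def sum_distrib_left mult.assoc)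
      also have "(\<Sum>l<c. \<Sum>i<m. (A x l * V' l i) * D y i) = (\<Sum>i<m. (\<Sum>l<c. A x l * V' l i) * D y i)"
        unfolding sum_distrib_right by (rule sum.swap)
      also have "\<dots> = (\<Sum>i<m. D y i * (U x i * tp (\<kappa> i)))"
        using xy by (intro sum.cong refl) (simp add: XV' mult.commute)
      finally show ?thesis using eq[OF xy(1) True] by simp
    next
      case False
      have "(\<Sum>l<c'. A x l * R l y) = (\<Sum>l<c'. if l = y then A x l else 0)"
        using False by (intro sum.cong refl) (auto simp: R_def)
      then show ?thesis using xy False by (simp add: B_def)
    qed
  qed
qed

text \<open>By \<open>sum_twist\<close> these are the coordinates of \<open>\<omega>\<close> in the
  twisted basis. The twist adds to the coordinate at r a multiple of the coordinate at p0, which is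
  a unit.\<close>

definition "w2 s i = (if i < r then 0 else ws i) + (if i = r then fps_const s * ws p0 else 0)"
definition "z2 s i = (if i < r then 0 else zs i) + (if i = r then fps_const s * zs q0 else 0)"
definition "G s x y = diag \<kappa> x y + fps_const s * gt * w2 s x * z2 s y"

lemma tw_eq:
  assumes "1 + s \<noteq> 0"
  shows "fps_const (tw r p s) * (1 + (if p = r then fps_const s else 0)) = fps_const s"
proof (cases "p = r")
  case True
  have "(1 :: complex fps) + fps_const s = fps_const (1 + s)" by (simp add: fps_const_add[symmetric] del: fps_const_add)
  then show ?thesis using assms True by (simp add: tw_def)
qed (simp add: tw_def)

lemma B_eq:
  assumes "1 + s \<noteq> 0" "x < k" "y < c"
  shows "B s x y = mm k (us s) (mm c (G s) (vs s)) x y"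
proof -
  have 1: "mm c (G s) (vs s) i y = (if i < c then tp (\<kappa> i) * vs s i y else 0) + fps_const s * gt * w2 s i * \<zeta> y" for i
  proof -
    have "mm c (G s) (vs s) i y = (\<Sum>l<c. diag \<kappa> i l * vs s l y) + fps_const s * gt * w2 s i * (\<Sum>l<c. z2 s l * vs s l y)"
      unfolding mm_def G_def by (simp add: distrib_right sum.distrib sum_distrib_left mult.assoc)
    also have "(\<Sum>l<c. diag \<kappa> i l * vs s l y) = (\<Sum>l<c. if l = i then tp (\<kappa> i) * vs s i y else 0)"
      by (intro sum.cong refl) (auto simp: diag_def)
    also have "(\<Sum>l<c. z2 s l * vs s l y) = \<zeta> y"
      unfolding z2_def vs_def \<zeta>_def by (rule sum_twist) (use r q0 tw_eq[OF assms(1)] in auto)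
    finally show ?thesis by simp
  qed
  have "mm k (us s) (mm c (G s) (vs s)) x y
    = (\<Sum>i<k. us s x i * (if i < c then tp (\<kappa> i) * vs s i y else 0)) + (\<Sum>i<k. fps_const s * gt * \<zeta> y * (w2 s i * us s x i))"
    unfolding mm_def[of k] 1 sum.distrib[symmetric] by (intro sum.cong refl) (simp add: algebra_simps)
  also have "(\<Sum>i<k. fps_const s * gt * \<zeta> y * (w2 s i * us s x i)) = fps_const s * gt * \<zeta> y * (\<Sum>i<k. w2 s i * us s x i)"
    by (simp add: sum_distrib_left)
  also have "(\<Sum>i<k. w2 s i * us s x i) = \<omega> x"
    unfolding w2_def us_def \<omega>_def by (rule sum_twist) (use r p0 tw_eq[OF assms(1)] in auto)
  also have "(\<Sum>i<k. us s x i * (if i < c then tp (\<kappa> i) * vs s i y else 0)) = (\<Sum>i<m. us s x i * (tp (\<kappa> i) * vs s i y))"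
    by (rule sum.mono_neutral_cong_right) auto
  finally show ?thesis using assms by (simp add: B_def mult_ac)
qed

text \<open>Gives the inverse of the twisted basis: W' r is changed by s times W' p.\<close>

lemma twist_inverse:
  assumes "1 + s \<noteq> 0" and uu: "\<And>i l. i < n \<Longrightarrow> l < n \<Longrightarrow> (\<Sum>x<n. W' i x * W x l) = (if i = l then 1 else 0)"
    and il: "i < n" "l < n" and "r < n" "p < n"
  shows "(\<Sum>x<n. (W' i x + (if i = r then fps_const s * W' p x else 0)) * (W x l - (if l = p then fps_const (tw r p s) * W x r else 0)))
    = (if i = l then 1 else 0)"
proof -
  let ?d = "\<lambda>i l :: nat. (if i = l then 1 else 0) :: complex fps"
  have "(\<Sum>x<n. (W' i x + (if i = r then fps_const s * W' p x else 0)) * (W x l - (if l = p then fps_const (tw r p s) * W x r else 0)))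
    = (\<Sum>x<n. W' i x * W x l) + (if i = r then fps_const s else 0) * (\<Sum>x<n. W' p x * W x l)
      - (if l = p then fps_const (tw r p s) else 0) * (\<Sum>x<n. W' i x * W x r)
      - (if i = r then fps_const s else 0) * (if l = p then fps_const (tw r p s) else 0) * (\<Sum>x<n. W' p x * W x r)"
    unfolding sum_distrib_left sum.distrib[symmetric] sum_subtractf[symmetric]
    by (intro sum.cong refl) (auto simp: algebra_simps)
  also have "\<dots> = ?d i l + (if i = r then fps_const s else 0) * ?d p l
      - (if l = p then fps_const (tw r p s) else 0) * ?d i r
      - (if i = r then fps_const s else 0) * (if l = p then fps_const (tw r p s) else 0) * ?d p r"
    using assms by (simp add: uu)
  also have "\<dots> = ?d i l + (if i = r \<and> l = p then fps_const s - fps_const (tw r p s) * (1 + (if p = r then fps_const s else 0)) else 0)"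
    by (auto simp: algebra_simps)
  also have "\<dots> = ?d i l" unfolding tw_eq[OF assms(1)] by simp
  finally show ?thesis .
qed

lemma dord_B_eq_G:
  assumes s: "1 + s \<noteq> 0"
  shows "dord k c j (B s) = dord k c j (G s)"
proof (rule antisym)
  have "dord k c j (G s) \<le> dord k c j (mm c (G s) (vs s))" by (rule dord_mm_right) simp
  also have "\<dots> \<le> dord k c j (B s)" by (rule dord_mm_left[where L = "us s"]) (rule B_eq[OF s])
  finally show "dord k c j (G s) \<le> dord k c j (B s)" .
  define L where "L i x = U' i x + (if i = r then fps_const s * U' p0 x else 0)" for i x
  define R where "R y l = V' y l + (if l = r then fps_const s * V' y q0 else 0)" for y l
  have Lus: "mm k L (us s) i l = (if i = l then 1 else 0)" if "i < k" "l < k" for i l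
    unfolding mm_def L_def us_def by (rule twist_inverse[OF s]) (use U'U that r p0 in auto)
  have V'V_swap: "(\<Sum>x<c. V' x i * V l x) = (if i = l then 1 else 0)" if "i < c" "l < c" for i l
  proof -
    have "(\<Sum>x<c. V' x i * V l x) = (\<Sum>x<c. V l x * V' x i)" by (intro sum.cong refl) (rule mult.commute)
    then show ?thesis using VV'[OF that(2,1)] by auto
  qed
  have vsR: "mm c (vs s) R l i = (if l = i then 1 else 0)" if "i < c" "l < c" for i l
  proof -
    have "mm c (vs s) R l i = (\<Sum>x<c. (V' x i + (if i = r then fps_const s * V' x q0 else 0)) * (V l x - (if l = q0 then fps_const (tw r q0 s) * V r x else 0)))"
      unfolding mm_def R_def vs_def by (intro sum.cong refl) (rule mult.commute)
    also have "\<dots> = (if i = l then 1 else 0)"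
      by (rule twist_inverse[OF s, of c "\<lambda>x y. V' y x" "\<lambda>x y. V y x" i l q0, OF V'V_swap]) (use that r q0 in auto)
    finally show ?thesis by auto
  qed
  have "dord k c j (B s) \<le> dord k c j (mm c (B s) R)" by (rule dord_mm_right) simp
  also have "\<dots> \<le> dord k c j (G s)"
  proof (rule dord_mm_left[where L = L])
    fix x y assume xy: "x < k" "y < c"
    have "mm k L (mm c (B s) R) x y = mm k L (mm c (mm k (us s) (mm c (G s) (vs s))) R) x y"
      using B_eq[OF s] by (intro mm_cong refl) simp
    also have "mm c (mm k (us s) (mm c (G s) (vs s))) R = mm k (us s) (mm c (G s) (mm c (vs s) R))"
      by (simp only: mm_assoc)
    also have "mm k L (mm k (us s) (mm c (G s) (mm c (vs s) R))) = mm k (mm k L (us s)) (mm c (G s) (mm c (vs s) R))"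
      by (simp only: mm_assoc)
    also have "mm k (mm k L (us s)) (mm c (G s) (mm c (vs s) R)) x y = mm c (G s) (mm c (vs s) R) x y"
      using xy by (intro mm_id_left) (auto simp: Lus)
    also have "\<dots> = G s x y" using xy by (intro mm_id_right) (auto simp: vsR)
    finally show "G s x y = mm k L (mm c (B s) R) x y" ..
  qed
  finally show "dord k c j (B s) \<le> dord k c j (G s)" .
qed

definition "\<kappa>' = \<kappa>(r := enat (g - 1))"

lemma minor_G: "minor j f g' (G s) = minor j f g' (diag \<kappa>)
  + (\<Sum>l<j. fps_const s * gt * w2 s (f l) * det (mat j j (\<lambda>(a, b). if a = l then z2 s (g' b) else diag \<kappa> (f a) (g' b))))"
  using det_rank_one_update[of j "\<lambda>a b. diag \<kappa> (f a) (g' b)" "\<lambda>a. fps_const s * gt * w2 s (f a)" "\<lambda>b. z2 s (g' b)"]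
  unfolding minor_def G_def .

lemma ws_plateau:
  assumes "r < i" "i < k"
  shows "h \<le> ford (ws i) + enat g"
proof -
  have "enat \<nu> + h \<le> enat \<nu> + (ford (ws i) + enat g)"
    using wt_plateau[OF assms] ws[of i] assms by (simp add: ford_mult add.assoc)
  then show ?thesis by (cases h; cases "ford (ws i)") auto
qed

lemma \<kappa>'_le: "\<kappa>' i \<le> \<kappa> i"
  using g by (simp add: \<kappa>'_def)

lemma sum_\<kappa>'_split: "r < j \<Longrightarrow> (\<Sum>i<j. \<kappa>' i) = (\<Sum>i\<in>{..<j} - {r}. \<kappa> i) + enat (g - 1)"
  by (subst sum.remove[of _ r]) (auto simp: \<kappa>'_def add.commute intro!: arg_cong2[of _ _ _ _ "(+)"] sum.cong)

lemma sum_\<kappa>'_le: "(\<Sum>i<Suc j. \<kappa>' i) \<le> enat (g - 1) + (\<Sum>i<j. \<kappa> i)" if "j \<le> r"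
proof -
  have 1: "(\<Sum>i<j. \<kappa>' i) \<le> (\<Sum>i<j. \<kappa> i)" by (intro sum_mono \<kappa>'_le)
  have 2: "\<kappa>' j \<le> enat (g - 1)" using small[of j] that by (cases "j = r") (auto simp: \<kappa>'_def)
  show ?thesis using add_mono[OF 1 2] by (simp add: add.commute)
qed

text \<open>By \<open>minor_G\<close> a minor of G is a diagonal minor plus terms in which one row
  is replaced by \<open>z2\<close>. Terms through an index below r vanish by the definition of
  \<open>w2\<close> and \<open>z2\<close>; in the others \<open>gt\<close> supplies g - 1 and the
  set S of \<open>det_diag_row_ge\<close> supplies j - 1 exponents.\<close>

lemma dord_G_ge:
  assumes j: "j \<le> m"
  shows "(\<Sum>i<j. \<kappa>' i) \<le> dord k c j (G s)"
proof (rule dord_geI)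
  fix f g' assume f: "\<forall>a<j. f a < k" and g': "\<forall>b<j. g' b < c" and inj: "inj_on f {..<j}" "inj_on g' {..<j}"
  show "(\<Sum>i<j. \<kappa>' i) \<le> ford (minor j f g' (G s))"
    unfolding minor_G
  proof (intro ford_add_ge ford_sum_ge)
    have "(\<Sum>i<j. \<kappa>' i) \<le> (\<Sum>i<j. \<kappa> i)" by (intro sum_mono \<kappa>'_le)
    also have "\<dots> \<le> ford (minor j f g' (diag \<kappa>))" by (rule minor_diag_ge[OF mono inj])
    finally show "(\<Sum>i<j. \<kappa>' i) \<le> ford (minor j f g' (diag \<kappa>))" .
  next
    fix l assume l: "l \<in> {..<j}"
    let ?T = "\<Sum>i<j. \<kappa>' i" and ?M = "mat j j (\<lambda>(a, b). if a = l then z2 s (g' b) else diag \<kappa> (f a) (g' b))"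
    let ?e = "ford (gt * w2 s (f l))"
    have "?T \<le> ?e + ford (det ?M)"
    proof (cases ?e)
      case (enat en)
      have "?T - ?e \<le> ford (det ?M)"
      proof (rule det_diag_row_ge[OF inj])
        show "l < j" using l by simp
        fix q S assume q: "q \<in> g' ` {..<j}" and S: "finite S" "card S = j - 1" "q \<notin> S" "f l \<notin> S"
        have "?T \<le> ?e + (ford (z2 s q) + (\<Sum>i\<in>S. \<kappa> i))"
        proof (cases "f l < r \<or> q < r")
          case True
          then have "gt * w2 s (f l) = 0 \<or> z2 s q = 0" by (auto simp: w2_def z2_def)
          then show ?thesis by auto
        next
          case False
          have "?T \<le> ?e + (\<Sum>i\<in>S. \<kappa> i)"
          proof (cases "j \<le> Suc r")
            case True
            obtain j' where j': "j = Suc j'" using l by (cases j) auto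
            have "?T \<le> enat (g - 1) + (\<Sum>i<j'. \<kappa> i)" using sum_\<kappa>'_le[of j'] True j' by simp
            also have "\<dots> \<le> ?e + (\<Sum>i\<in>S. \<kappa> i)"
              using sum_ge_initial[OF mono S(1)] S(2) j' by (intro add_mono) (auto simp: ford_mult)
            finally show ?thesis .
          next
            case False
            then have jr: "Suc r < j" by simp
            \<comment> \<open>If S misses r, the exponent g at r is exchanged for the g - 1 of
              \<open>gt\<close>. If S contains r, then f l > r, and \<open>ws_plateau\<close>
              provides the missing difference between h and g.\<close>
            show ?thesis
            proof (cases "r \<in> S")
              case False
              have "(\<Sum>i<j. \<kappa> i) \<le> (\<Sum>i\<in>insert r S. \<kappa> i)"
                using sum_ge_initial[OF mono, of "insert r S"] S False jr by simp
              moreover have "(\<Sum>i<j. \<kappa> i) = \<kappa> r + (\<Sum>i\<in>{..<j} - {r}. \<kappa> i)" using jr by (subst sum.remove[of _ r]) auto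
              ultimately have "(\<Sum>i\<in>{..<j} - {r}. \<kappa> i) \<le> (\<Sum>i\<in>S. \<kappa> i)"
                using S False g by simp
              then show ?thesis using jr by (simp add: sum_\<kappa>'_split ford_mult add_mono add.commute add_increasing2)
            next
              case True
              then have "f l \<noteq> r" using S(4) by metis
              then have fl: "r < f l" "f l < k" using \<open>\<not> (f l < r \<or> q < r)\<close> f l by simp_all
              then have w: "ford (w2 s (f l)) = ford (ws (f l))" by (simp add: w2_def)
              obtain j' where j': "j = Suc j'" "r < j'" using jr by (cases j) auto
              have "?T = (\<Sum>i<j'. \<kappa>' i) + h" using j' j plateau[of j'] by (simp add: \<kappa>'_def)
              also have "\<dots> = (\<Sum>i\<in>{..<j'} - {r}. \<kappa> i) + enat (g - 1) + h" using j' by (simp add: sum_\<kappa>'_split)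
              also have "\<dots> \<le> (\<Sum>i\<in>{..<j'} - {r}. \<kappa> i) + enat (g - 1) + (ford (ws (f l)) + enat g)"
                by (intro add_left_mono ws_plateau fl)
              also have "\<dots> = ?e + (\<Sum>i<j'. \<kappa> i)"
                using j' g w by (subst (2) sum.remove[of _ r]) (auto simp: ford_mult add_ac)
              also have "\<dots> \<le> ?e + (\<Sum>i\<in>S. \<kappa> i)"
                using sum_ge_initial[OF mono S(1)] S(2) j' by (intro add_left_mono) auto
              finally show ?thesis .
            qed
          qed
          also have "\<dots> \<le> ?e + (ford (z2 s q) + (\<Sum>i\<in>S. \<kappa> i))" by (intro add_left_mono) (simp add: add_increasing)
          finally show ?thesis .
        qed
        then show "?T - ?e \<le> ford (z2 s q) + (\<Sum>i\<in>S. \<kappa> i)"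
          unfolding enat by (cases ?T; cases "ford (z2 s q) + (\<Sum>i\<in>S. \<kappa> i)") auto
      qed
      then show ?thesis unfolding enat by (cases ?T; cases "ford (det ?M)") auto
    next
      case infinity
      then show ?thesis unfolding infinity by simp
    qed
    then have "?T \<le> ford (gt * w2 s (f l) * det ?M)" unfolding ford_mult[of "gt * w2 s (f l)"] .
    moreover have "ford (gt * w2 s (f l) * det ?M) \<le> ford (fps_const s * gt * w2 s (f l) * det ?M)"
      using le_ford_mult[OF order_refl, of "gt * w2 s (f l) * det ?M" "fps_const s"] by (simp add: mult.assoc)
    ultimately show "?T \<le> ford (fps_const s * gt * w2 s (f l) * det ?M)" by (rule order_trans)
  qed
qed

text \<open>For r < j and finite exponents, s times this number is the coefficient of t^T in the
  leading j-minor of \<open>G s\<close>, where T is the sum of the first j exponents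
  \<open>\<kappa>'\<close>.\<close>

definition "pairing s j = (fps_nth (ws r) 0 + s * fps_nth (ws p0) 0) * (fps_nth (zs r) 0 + s * fps_nth (zs q0) 0)
  + (\<Sum>l\<in>{r<..<j}. fps_nth (quot (h - enat g) (ws l)) 0 * fps_nth (zs l) 0)"

text \<open>The leading minor alone attains the bound; \<open>det_diag_row\<close> evaluates every
  term of its expansion.\<close>

lemma dord_G_le:
  assumes j: "j \<le> m" and s: "s \<noteq> 0" "pairing s j \<noteq> 0"
  shows "dord k c j (G s) \<le> (\<Sum>i<j. \<kappa>' i)"
proof -
  have le: "dord k c j (G s) \<le> ford (minor j id id (G s))" using j by (intro dord_le) auto
  have dr: "det (mat j j (\<lambda>(a, b). if a = l then z2 s b else diag \<kappa> a b)) = z2 s l * (\<Prod>i\<in>{0..<j} - {l}. tp (\<kappa> i))"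
    if "l < j" for l
    using det_diag_row[OF that, of "z2 s" "\<lambda>i. tp (\<kappa> i)"] by (simp add: diag_def cong: if_cong)
  have M: "minor j id id (G s) = (\<Prod>i<j. tp (\<kappa> i))
    + (\<Sum>l<j. fps_const s * gt * w2 s l * (z2 s l * (\<Prod>i\<in>{0..<j} - {l}. tp (\<kappa> i))))"
    unfolding minor_G minor_diag id_apply by (intro arg_cong2[of _ _ _ _ "(+)"] sum.cong refl) (simp add: dr)
  show ?thesis
  proof (cases "r < j")
    case False
    then have "minor j id id (G s) = (\<Prod>i<j. tp (\<kappa> i))" unfolding M by (simp add: w2_def)
    moreover have "(\<Sum>i<j. \<kappa>' i) = (\<Sum>i<j. \<kappa> i)" using False by (intro sum.cong) (auto simp: \<kappa>'_def)
    ultimately show ?thesis using le by (simp add: ford_prod)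
  next
    case rj: True
    show ?thesis
    proof (cases "(\<Sum>i<j. \<kappa>' i) = \<infinity>")
      case False
      have fin: "\<kappa> i \<noteq> \<infinity>" if "i < j" for i
      proof (cases "i = r")
        case False
        then have "\<kappa> i = \<kappa>' i" by (simp add: \<kappa>'_def)
        also have "\<dots> \<le> (\<Sum>i<j. \<kappa>' i)" using that by (intro member_le_sum) auto
        finally have le: "\<kappa> i \<le> (\<Sum>i<j. \<kappa>' i)" .
        show ?thesis
        proof
          assume "\<kappa> i = \<infinity>"
          then show False using le \<open>(\<Sum>i<j. \<kappa>' i) \<noteq> \<infinity>\<close> by simp
        qed
      qed (use g in simp)
      define kn where "kn i = the_enat (\<kappa> i)" for i
      have kn: "\<kappa> i = enat (kn i)" if "i < j" for i
        unfolding kn_def using fin[OF that] by (cases "\<kappa> i") simp_all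
      have knr: "kn r = g" using kn[OF rj] g by simp
      define T where "T = (\<Sum>i\<in>{..<j} - {r}. kn i) + (g - 1)"
      have sumT: "(\<Sum>i<j. \<kappa>' i) = enat T"
      proof -
        have "(\<Sum>i\<in>{..<j} - {r}. \<kappa> i) = (\<Sum>i\<in>{..<j} - {r}. enat (kn i))" by (intro sum.cong) (auto simp: kn)
        then show ?thesis unfolding sum_\<kappa>'_split[OF rj] T_def by (simp add: of_nat_eq_enat[symmetric])
      qed
      have prodl: "(\<Prod>i\<in>S. tp (\<kappa> i)) = fps_X ^ (\<Sum>i\<in>S. kn i)" if "S \<subseteq> {..<j}" for S
        unfolding power_sum using that by (intro prod.cong refl) (auto simp: kn tp_def)
      have gtX: "gt = fps_X ^ (g - 1)" by (simp add: gt_def tp_def)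
      have "(\<Sum>i<j. kn i) = Suc T"
        unfolding T_def using sum.remove[of "{..<j}" r kn] rj g knr by simp
      \<comment> \<open>The diagonal minor has order T + 1, so the coefficient of t^T comes from the
        rank-one part alone.\<close>
      then have first: "(\<Prod>i<j. tp (\<kappa> i)) = fps_X ^ T * fps_X" using prodl[of "{..<j}"] by (simp add: mult.commute)
      define y where "y l = (if l = r then w2 s r * z2 s r else quot (h - enat g) (ws l) * zs l)" for l
      have trm: "gt * w2 s l * (z2 s l * (\<Prod>i\<in>{0..<j} - {l}. tp (\<kappa> i))) = fps_X ^ T * (if r \<le> l then y l else 0)"
        if l: "l < j" for l
      proof -
        consider "l < r" | "l = r" | "r < l" by linarith
        then show ?thesis
        proof cases
          case 1
          then show ?thesis by (simp add: w2_def)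
        next
          case 2
          have "gt * (\<Prod>i\<in>{0..<j} - {l}. tp (\<kappa> i)) = fps_X ^ T"
            unfolding gtX T_def 2 by (subst prodl) (auto simp: power_add mult.commute atLeast0LessThan)
          then show ?thesis using 2 by (simp add: y_def mult_ac)
        next
          \<comment> \<open>Here the product omits the exponent h instead of g; the divisibility of
            \<open>ws l\<close> by t^(h-g) compensates, so this term too is a multiple of
            t^T.\<close>
          case 3
          have lm: "l < min k c" using l j by simp
          obtain hn where hn: "h = enat hn" using kn[OF l] plateau[OF 3 lm] by auto
          have "kn l = hn" using kn[OF l] plateau[OF 3 lm] hn by simp
          have "g \<le> hn" using monoD[OF mono, of r l] 3 plateau[OF 3 lm] hn g by simp
          have "h - enat g \<le> ford (ws l)" using ws_plateau[OF 3] lm hn by (cases "ford (ws l)") auto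
          then have wl: "ws l = fps_X ^ (hn - g) * quot (h - enat g) (ws l)"
            using quot[of "h - enat g" "ws l"] by (simp add: hn tp_def)
          have "(\<Sum>i\<in>{0..<j} - {l}. kn i) + hn = (\<Sum>i\<in>{..<j} - {r}. kn i) + g"
            using sum.remove[of "{..<j}" r kn] sum.remove[of "{..<j}" l kn] l rj knr \<open>kn l = hn\<close>
            by (simp add: atLeast0LessThan)
          then have ex: "(g - 1) + ((hn - g) + (\<Sum>i\<in>{0..<j} - {l}. kn i)) = T"
            unfolding T_def using \<open>g \<le> hn\<close> by simp
          have pr: "(\<Prod>i\<in>{0..<j} - {l}. tp (\<kappa> i)) = fps_X ^ (\<Sum>i\<in>{0..<j} - {l}. kn i)" by (rule prodl) auto
          have "w2 s l = ws l" using 3 by (simp add: w2_def)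
          then have w2l: "w2 s l = fps_X ^ (hn - g) * quot (h - enat g) (ws l)" using wl by (rule trans)
          have z2l: "z2 s l = zs l" using 3 by (simp add: z2_def)
          have "gt * w2 s l * (z2 s l * (\<Prod>i\<in>{0..<j} - {l}. tp (\<kappa> i)))
            = (fps_X ^ (g - 1) * (fps_X ^ (hn - g) * fps_X ^ (\<Sum>i\<in>{0..<j} - {l}. kn i))) * (quot (h - enat g) (ws l) * zs l)"
            unfolding gtX w2l z2l pr by (simp only: mult_ac)
          then show ?thesis unfolding power_add[symmetric] ex using 3 by (simp add: y_def)
        qed
      qed
      have "minor j id id (G s) = fps_X ^ T * fps_X + (\<Sum>l<j. fps_const s * (fps_X ^ T * (if r \<le> l then y l else 0)))"
        unfolding M first by (intro arg_cong2[of _ _ _ _ "(+)"] sum.cong refl) (simp add: trm[symmetric] mult.assoc)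
      also have "\<dots> = fps_X ^ T * (fps_X + fps_const s * (\<Sum>l<j. if r \<le> l then y l else 0))"
        by (simp add: algebra_simps sum_distrib_left)
      also have "(\<Sum>l<j. if r \<le> l then y l else 0) = (\<Sum>l\<in>insert r {r<..<j}. y l)"
        using rj by (intro sum.mono_neutral_cong_right) auto
      also have "\<dots> = w2 s r * z2 s r + (\<Sum>l\<in>{r<..<j}. quot (h - enat g) (ws l) * zs l)"
        by (simp add: y_def)
      finally have e: "minor j id id (G s) = fps_X ^ T * (fps_X + fps_const s * (w2 s r * z2 s r + (\<Sum>l\<in>{r<..<j}. quot (h - enat g) (ws l) * zs l)))" .
      have "fps_nth (minor j id id (G s)) T = s * pairing s j"
        unfolding e by (simp add: fps_X_power_mult_nth w2_def z2_def pairing_def fps_sum_nth fps_mult_nth_0)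
      then have "ford (minor j id id (G s)) \<le> enat T" using s by (intro ford_le) simp
      then show ?thesis using le sumT by simp
    qed simp
  qed
qed

text \<open>A polynomial in s whose coefficient of s^2 is the product of the constant terms of
  \<open>ws p0\<close> and \<open>zs q0\<close>, nonzero by the choice of p0 and q0. This is the
  purpose of the twist: at s = 0 the sum may well cancel.\<close>

lemma eventually_pairing: "eventually (\<lambda>s. pairing s j \<noteq> 0) (at 0)"
proof -
  let ?\<gamma> = "\<Sum>l\<in>{r<..<j}. fps_nth (quot (h - enat g) (ws l)) 0 * fps_nth (zs l) 0"
  define P where "P = [:fps_nth (ws r) 0, fps_nth (ws p0) 0:] * [:fps_nth (zs r) 0, fps_nth (zs q0) 0:] + [:?\<gamma>:]"
  have unit: "fps_nth f 0 \<noteq> 0" if "ford (tp (enat n) * f) = enat n" for f n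
  proof -
    have "ford f = 0" using that by (cases "ford f") (auto simp: ford_mult zero_enat_def)
    then show ?thesis by (simp add: ford_eq_0_iff)
  qed
  have "fps_nth (ws p0) 0 \<noteq> 0" using p0 ws[of p0] by (intro unit[of \<nu>]) simp
  moreover have "fps_nth (zs q0) 0 \<noteq> 0" using q0 zs[of q0] by (intro unit[of \<nu>']) simp
  ultimately have "coeff P 2 \<noteq> 0" by (simp add: P_def numeral_2_eq_2)
  then have "P \<noteq> 0" by auto
  then have "finite {s. poly P s = 0}" by (rule poly_roots_finite)
  then have "eventually (\<lambda>s. s \<notin> {s. poly P s = 0}) (at 0)" by (rule eventually_avoid_finite)
  moreover have "poly P s = pairing s j" for s by (simp add: P_def pairing_def algebra_simps)
  ultimately show ?thesis by simp
qed

lemma fcont_tw: "fcont (\<lambda>s. fps_const (tw r p s))"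
proof (rule fcont_fps_const)
  have "isCont (\<lambda>s :: complex. s / (1 + s)) 0" by (intro continuous_intros) auto
  then show "isCont (tw r p) 0" unfolding tw_def by (cases "p = r") auto
qed

lemma fcont_B: "fcont (\<lambda>s. B s x y)"
proof (cases "y < c")
  case True
  have "fcont (\<lambda>s. us s x i)" for i
    unfolding us_def by (cases "i = p0") (auto intro!: fcont_diff fcont_mult fcont_tw)
  moreover have "fcont (\<lambda>s. vs s i y)" for i
    unfolding vs_def by (cases "i = q0") (auto intro!: fcont_diff fcont_mult fcont_tw)
  moreover have "fcont (\<lambda>s. fps_const s)" by (rule fcont_fps_const) simp
  ultimately show ?thesis
    unfolding B_def using True by (auto intro!: fcont_add fcont_sum fcont_mult)
qed (auto simp: B_def)

lemma B_0:
  assumes "x < k"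
  shows "B 0 x y = A x y"
proof -
  have "tw r p 0 = 0" for p by (simp add: tw_def)
  then have "us 0 x i = U x i" "vs 0 i y = V i y" for i by (simp_all add: us_def vs_def)
  then show ?thesis using assms by (simp add: B_def X_eq mult.assoc)
qed

text \<open>The values of s to avoid are 0, the pole -1 of the twist and the zeros of finitely many
  pairings. For c' other than c, row or column operations give one inequality and semicontinuity at
  s = 0 the other.\<close>

theorem wedge_family:
  "eventually (\<lambda>s. \<forall>j\<le>m. dord k c j (B s) = (\<Sum>i<j. \<kappa>' i)) (at 0)"
  "c' \<noteq> c \<Longrightarrow> eventually (\<lambda>s. dord k c' j (B s) = dord k c' j A) (at 0)"
proof -
  have "eventually (\<lambda>s. \<forall>j\<in>{..m}. pairing s j \<noteq> 0) (at 0)"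
    by (intro eventually_ball_finite) (auto intro: eventually_pairing)
  moreover have "eventually (\<lambda>s. s \<notin> {0, - 1}) (at (0 :: complex))" by (rule eventually_avoid_finite) simp
  ultimately show "eventually (\<lambda>s. \<forall>j\<le>m. dord k c j (B s) = (\<Sum>i<j. \<kappa>' i)) (at 0)"
  proof eventually_elim
    case (elim s)
    then have s: "s \<noteq> 0" "1 + s \<noteq> 0" by (auto simp: add_eq_0_iff)
    show ?case
    proof (intro allI impI)
      fix j assume "j \<le> m"
      then show "dord k c j (B s) = (\<Sum>i<j. \<kappa>' i)"
        using dord_G_ge[of j s] dord_G_le[of j s] elim s unfolding dord_B_eq_G[OF s(2)] by auto
    qed
  qed
  assume "c' \<noteq> c"
  have "eventually (\<lambda>s. dord k c' j (B s) \<le> dord k c' j (B 0)) (at 0)"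
    by (rule dord_semicontinuous) (rule fcont_B)
  moreover have "dord k c' j (B 0) = dord k c' j A" by (rule dord_cong) (rule B_0)
  moreover have "dord k c' j A \<le> dord k c' j (B s)" for s
    using \<open>c' \<noteq> c\<close> dord_before dord_after by (cases "c' < c") auto
  ultimately show "eventually (\<lambda>s. dord k c' j (B s) = dord k c' j A) (at 0)"
  proof (elim eventually_mono)
    fix s assume "dord k c' j (B s) \<le> dord k c' j (B 0)" "dord k c' j (B 0) = dord k c' j A"
    then show "dord k c' j (B s) = dord k c' j A"
      using \<open>\<And>s. dord k c' j A \<le> dord k c' j (B s)\<close>[of s] by (intro antisym) simp_all
  qed
qed

end

section \<open>Bordered matrices in Smith coordinates\<close>

context smith_form begin

text \<open>Row operations act on all c + 1 columns and turn column c into its coordinates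
  \<open>wt\<close>; column operations act on the first c columns only.\<close>

lemma dord_border_col:
  assumes wt: "\<And>i. i < k \<Longrightarrow> wt i = (\<Sum>x<k. U' i x * X x c)"
  shows "dord k (Suc c) j (\<lambda>x y. if y < c then diag \<kappa> x y else wt x) = dord k (Suc c) j X"
proof (rule antisym)
  let ?T = "\<lambda>x y. if y < c then diag \<kappa> x y else wt x"
  let ?Y = "\<lambda>x y. if y < c then (if x < c then tp (\<kappa> x) * V x y else 0) else wt x"
  have "dord k (Suc c) j ?T \<le> dord k (Suc c) j ?Y"
  proof (rule dord_mult_right[where R = "\<lambda>l y. if y < c then (if l < c then V l y else 0) else if l < c then 0 else 1"])
    fix x y assume "x < k" "y < Suc c"
    have "(\<Sum>l<c. diag \<kappa> x l * V l y) = (\<Sum>l<c. if l = x then tp (\<kappa> x) * V x y else 0)"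
      by (intro sum.cong refl) (auto simp: diag_def)
    then show "?Y x y = (\<Sum>l<Suc c. ?T x l * (if y < c then (if l < c then V l y else 0) else if l < c then 0 else 1))"
      by simp
  qed
  also have "\<dots> \<le> dord k (Suc c) j X"
  proof (rule dord_mult_left[where L = U])
    fix x y assume xy: "x < k" "y < Suc c"
    show "X x y = (\<Sum>l<k. U x l * ?Y l y)"
    proof (cases "y < c")
      case True
      have "(\<Sum>l<k. U x l * ?Y l y) = (\<Sum>l\<in>{..<min k c}. U x l * tp (\<kappa> l) * V l y)"
        using True by (intro sum.mono_neutral_cong_right) (auto simp: mult.assoc)
      then show ?thesis using X_eq[OF xy(1) True] by simp
    next
      case False
      have "(\<Sum>l<k. U x l * ?Y l y) = (\<Sum>l<k. \<Sum>i<k. U x l * U' l i * X i c)"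
        using False by (simp add: wt sum_distrib_left mult.assoc)
      also have "\<dots> = (\<Sum>i<k. (\<Sum>l<k. U x l * U' l i) * X i c)"
        unfolding sum_distrib_right by (rule sum.swap)
      also have "\<dots> = (\<Sum>i<k. if i = x then X i c else 0)" using xy by (intro sum.cong refl) (auto simp: UU')
      finally show ?thesis using xy False by (simp add: less_Suc_eq)
    qed
  qed
  finally show "dord k (Suc c) j ?T \<le> dord k (Suc c) j X" .
  have "dord k (Suc c) j X \<le> dord k (Suc c) j ?Y"
    by (rule dord_mult_left[where L = U']) (auto simp: wt U'X less_Suc_eq)
  also have "\<dots> \<le> dord k (Suc c) j ?T"
  proof (rule dord_mult_right[where R = "\<lambda>l y. if y < c then (if l < c then V' l y else 0) else if l < c then 0 else 1"])
    fix x y assume xy: "x < k" "y < Suc c"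
    have "(\<Sum>l<c. (if x < c then tp (\<kappa> x) * V x l else 0) * V' l y) = (if x < c then tp (\<kappa> x) * (\<Sum>l<c. V x l * V' l y) else 0)"
      by (simp add: sum_distrib_left mult_ac)
    then show "?T x y = (\<Sum>l<Suc c. ?Y x l * (if y < c then (if l < c then V' l y else 0) else if l < c then 0 else 1))"
      using xy by (auto simp: VV' diag_def)
  qed
  finally show "dord k (Suc c) j X \<le> dord k (Suc c) j ?T" .
qed

text \<open>Multiplied by V the row \<open>z\<close> becomes the unit row at c - 1, and by
  \<open>dord_stack\<close> this row has the effect of deleting the column c - 1; hence the shift
  from j to j + 1.\<close>

lemma dord_border_row:
  assumes c: "0 < c" and z: "\<And>i. i < c \<Longrightarrow> z i = V' (c - 1) i"
  shows "dord (Suc k) c (Suc j) (\<lambda>x y. if x < k then diag \<kappa> x y else z y) = dord k (c - 1) j X"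
proof -
  let ?T = "\<lambda>x y. if x < k then diag \<kappa> x y else z y"
  let ?S = "\<lambda>x y. if x < k then X x y else if y = c - 1 then 1 else 0"
  let ?Y = "\<lambda>x y. if x < k then (if x < c then tp (\<kappa> x) * V x y else 0) else if y = c - 1 then 1 else 0"
  have zV: "(\<Sum>l<c. z l * V l y) = (if y = c - 1 then 1 else 0)" if "y < c" for y
    using that c by (auto simp: z V'V)
  have zV': "V' (c - 1) y = z y" if "y < c" for y using z that by simp
  have dV: "(\<Sum>l<c. diag \<kappa> x l * V l y) = (if x < c then tp (\<kappa> x) * V x y else 0)" for x y
  proof -
    have "(\<Sum>l<c. diag \<kappa> x l * V l y) = (\<Sum>l<c. if l = x then tp (\<kappa> x) * V x y else 0)"
      by (intro sum.cong refl) (auto simp: diag_def)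
    then show ?thesis by simp
  qed
  have "dord (Suc k) c (Suc j) ?T \<le> dord (Suc k) c (Suc j) ?Y"
    by (rule dord_mult_right[where R = V]) (simp add: dV zV)
  also have "\<dots> \<le> dord (Suc k) c (Suc j) ?S"
  proof (rule dord_mult_left[where L = "\<lambda>x l. if x < k then (if l < k then U x l else 0) else if l < k then 0 else 1"])
    fix x y assume xy: "x < Suc k" "y < c"
    have "(\<Sum>l<k. U x l * (if l < c then tp (\<kappa> l) * V l y else 0)) = X x y" if "x < k"
    proof -
      have "(\<Sum>l<k. U x l * (if l < c then tp (\<kappa> l) * V l y else 0)) = (\<Sum>l\<in>{..<min k c}. U x l * tp (\<kappa> l) * V l y)"
        by (intro sum.mono_neutral_cong_right) (auto simp: mult.assoc)
      then show ?thesis using X_eq[OF that xy(2)] by simp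
    qed
    then show "?S x y = (\<Sum>l<Suc k. (if x < k then (if l < k then U x l else 0) else if l < k then 0 else 1) * ?Y l y)"
      by simp
  qed
  finally have 1: "dord (Suc k) c (Suc j) ?T \<le> dord (Suc k) c (Suc j) ?S" .
  have "dord (Suc k) c (Suc j) ?S \<le> dord (Suc k) c (Suc j) ?Y"
    by (rule dord_mult_left[where L = "\<lambda>x l. if x < k then (if l < k then U' x l else 0) else if l < k then 0 else 1"])
      (auto simp: U'X)
  also have "\<dots> \<le> dord (Suc k) c (Suc j) ?T"
  proof (rule dord_mult_right[where R = V'])
    fix x y assume xy: "x < Suc k" "y < c"
    have "(\<Sum>l<c. (if x < c then tp (\<kappa> x) * V x l else 0) * V' l y) = (if x < c then tp (\<kappa> x) * (\<Sum>l<c. V x l * V' l y) else 0)"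
      by (simp add: sum_distrib_left mult_ac)
    moreover have "(\<Sum>l<c. (if l = c - 1 then 1 else 0) * V' l y) = (\<Sum>l<c. if l = c - 1 then V' l y else 0)"
      by (intro sum.cong refl) auto
    ultimately show "?T x y = (\<Sum>l<c. ?Y x l * V' l y)"
      using xy c by (auto simp: VV' diag_def zV'[unfolded One_nat_def])
  qed
  finally have "dord (Suc k) c (Suc j) ?T = dord (Suc k) c (Suc j) ?S" using 1 by simp
  also have "\<dots> = dord k (c - 1) j X"
    using dord_stack[of k "c - 1" ?S X j] c by simp
  finally show ?thesis .
qed

end

text \<open>\<open>\<rho>1\<close> and \<open>\<rho>2\<close> are the hypotheses of
  \<open>stack_orders\<close> for the border column, read off from the first c + 1 columns;
  \<open>\<mu>1\<close> and \<open>\<mu>2\<close> are those for the border row, read off from the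
  first c - 1 columns with sizes shifted by one.\<close>

theorem wedge_exists:
  assumes sf: "smith_form k c A U U' V V' \<kappa>" and r: "r < k" "r < c" and g: "\<kappa> r = enat g" "1 \<le> g"
    and small: "\<And>i. i < r \<Longrightarrow> \<kappa> i \<le> enat (g - 1)"
    and plateau: "\<And>i. r < i \<Longrightarrow> i < min k c \<Longrightarrow> \<kappa> i = h"
    and \<rho>1: "dord k (Suc c) (Suc r) A \<le> dord k (Suc c) r A + enat (g - 1)"
    and \<rho>2: "Suc r < k \<Longrightarrow> dord k (Suc c) (Suc r) A + h \<le> dord k (Suc c) (Suc (Suc r)) A"
    and \<mu>1: "0 < r \<Longrightarrow> dord k (c - 1) r A \<le> dord k (c - 1) (r - 1) A + enat (g - 1)"
    and \<mu>2: "Suc r < c \<Longrightarrow> dord k (c - 1) r A + h \<le> dord k (c - 1) (Suc r) A"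
  obtains B where "\<And>x y. fcont (\<lambda>s. B s x y)" "\<And>x y. x < k \<Longrightarrow> B 0 x y = A x y"
    "eventually (\<lambda>s. \<forall>j\<le>min k c. dord k c j (B s) = (\<Sum>i<j. (\<kappa>(r := enat (g - 1))) i)) (at 0)"
    "\<And>c' j. c' \<noteq> c \<Longrightarrow> eventually (\<lambda>s. dord k c' j (B s) = dord k c' j A) (at 0)"
proof -
  interpret smith_form k c A U U' V V' \<kappa> by fact
  define wt where "wt i = (\<Sum>x<k. U' i x * A x c)" for i
  define z where "z i = V' (c - 1) i" for i
  define T where "T x y = (if y < c then diag \<kappa> x y else wt x)" for x y
  define St where "St x y = (if x < k then diag \<kappa> x y else z y)" for x y
  have T: "dord (Suc c) k j (\<lambda>x y. T y x) = dord k (Suc c) j A" for j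
    unfolding dord_transpose[of "Suc c" k j T] unfolding T_def using wt_def by (rule dord_border_col)
  have St0: "dord (Suc k) c 0 St = 0" and StS: "dord (Suc k) c (Suc j) St = dord k (c - 1) j A" for j
    unfolding St_def using dord_border_row[of z j] r z_def by simp_all
  obtain \<nu> p0 where p0: "r \<le> p0" "p0 < k" "\<nu> \<le> g - 1" "ford (wt p0) = enat \<nu>"
    and p1: "\<And>q. r \<le> q \<Longrightarrow> q < k \<Longrightarrow> enat \<nu> \<le> ford (wt q)"
    and p2: "\<And>i. i < r \<Longrightarrow> enat \<nu> + \<kappa> i \<le> ford (wt i) + enat (g - 1)"
    and p3: "\<And>q. r < q \<Longrightarrow> q < k \<Longrightarrow> enat \<nu> + h \<le> ford (wt q) + enat g"
  proof (rule stack_orders[OF mono r(2,1) g small, of "\<lambda>x y. T y x" wt h])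
    show "dord (Suc c) k (Suc r) (\<lambda>x y. T y x) \<le> dord (Suc c) k r (\<lambda>x y. T y x) + enat (g - 1)"
      unfolding T by (rule \<rho>1)
    show "dord (Suc c) k (Suc r) (\<lambda>x y. T y x) + h \<le> dord (Suc c) k (Suc (Suc r)) (\<lambda>x y. T y x)"
      if "r < q" "q < k" for q
      unfolding T using that by (intro \<rho>2) simp
  qed (auto simp: T_def diag_def)
  obtain \<nu>' q0 where q0: "r \<le> q0" "q0 < c" "\<nu>' \<le> g - 1" "ford (z q0) = enat \<nu>'"
    and q1: "\<And>q. r \<le> q \<Longrightarrow> q < c \<Longrightarrow> enat \<nu>' \<le> ford (z q)"
    and q2: "\<And>i. i < r \<Longrightarrow> enat \<nu>' + \<kappa> i \<le> ford (z i) + enat (g - 1)"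
  proof (rule stack_orders[OF mono r g small, of St z h])
    show "dord (Suc k) c (Suc r) St \<le> dord (Suc k) c r St + enat (g - 1)"
    proof (cases r)
      case 0
      then show ?thesis by (simp add: StS)
    next
      case (Suc r')
      then show ?thesis using \<mu>1 by (simp add: StS)
    qed
    show "dord (Suc k) c (Suc r) St + h \<le> dord (Suc k) c (Suc (Suc r)) St" if "r < q" "q < c" for q
      unfolding StS using that by (intro \<mu>2) simp
  qed (auto simp: St_def)
  interpret wedge k c A U U' V V' \<kappa> r g \<nu> p0 \<nu>' q0 h wt z
    by unfold_locales (use r g small plateau p0 q0 p1 p2 p3 q1 q2 in \<open>auto simp: wt_def z_def\<close>)
  show ?thesis
    using that[of B] fcont_B B_0 wedge_family unfolding \<kappa>'_def by blast
qed

section \<open>Rank conditions on complex matrices\<close>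

lemma pick_lt_iff:
  fixes I :: "nat set"
  assumes "finite I" "x < card I"
  shows "pick I x < c \<longleftrightarrow> x < card (I \<inter> {..<c})"
proof
  have c: "card {a \<in> I. a < pick I x} = x" by (rule card_pick) (use assms in auto)
  have m: "pick I x \<in> I" by (rule pick_in_set) (use assms in auto)
  {
    assume "pick I x < c"
    then have "insert (pick I x) {a \<in> I. a < pick I x} \<subseteq> I \<inter> {..<c}" using m by auto
    then have "card (insert (pick I x) {a \<in> I. a < pick I x}) \<le> card (I \<inter> {..<c})"
      using assms by (intro card_mono) auto
    then show "x < card (I \<inter> {..<c})" using c assms by simp
  }
  assume x: "x < card (I \<inter> {..<c})"
  show "pick I x < c"
  proof (rule ccontr)
    assume "\<not> pick I x < c"
    then have "I \<inter> {..<c} \<subseteq> {a \<in> I. a < pick I x}" by auto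
    then have "card (I \<inter> {..<c}) \<le> x" using assms c card_mono[of "{a \<in> I. a < pick I x}"] by simp
    then show False using x by simp
  qed
qed

lemma card_below_pick: "finite I \<Longrightarrow> x < card I \<Longrightarrow> card (I \<inter> {..<pick I x}) = x"
  using card_pick[of x I] by (simp add: Int_def lessThan_def conj_commute)

lemma pick_card_below: "c \<in> I \<Longrightarrow> pick I (card (I \<inter> {..<c})) = c"
  using pick_card_in_set[of c I] by (simp add: Int_def lessThan_def)

lemma pick_mem: "finite I \<Longrightarrow> x < card I \<Longrightarrow> pick I x \<in> I"
  by (rule pick_in_set) auto

definition cm :: "nat \<Rightarrow> nat \<Rightarrow> nat set \<Rightarrow> (nat \<Rightarrow> 'r::comm_ring_1) \<Rightarrow> nat \<Rightarrow> nat \<Rightarrow> 'r" where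
  "cm k n I x i c = (if c \<in> I then (if card (I \<inter> {..<c}) = i then 1 else 0)
     else x (i * (n - k) + card ({..<c} - I)))"

lemma chart_mat_cm: "chart_mat k n I x = mat k n (\<lambda>(i, c). cm k n I x i c)"
  by (simp add: chart_mat_def cm_def)

lemma cm_pick:
  assumes "I \<in> charts k n" "l < k"
  shows "cm k n I x i (pick I l) = (if l = i then 1 else 0)"
proof -
  have "finite I" "l < card I" using assms by (auto simp: charts_def intro: finite_subset)
  then show ?thesis by (simp add: cm_def pick_mem card_below_pick)
qed

text \<open>Gaussian elimination: \<open>a f\<close> is the relation in which \<open>f\<close> is the only free variable that
  does not vanish.\<close>

lemma relations:
  fixes h :: "'a \<Rightarrow> 'b \<Rightarrow> complex"
  assumes "finite B" "finite S"
  shows "\<exists>F a. F \<subseteq> S \<and> card S \<le> card F + card B \<and> (\<forall>f\<in>F. \<forall>f'\<in>F. a f f' = (if f = f' then 1 else 0))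
    \<and> (\<forall>f\<in>F. \<forall>m\<in>B. (\<Sum>c\<in>S. a f c * h c m) = 0)"
  using assms
proof (induction B arbitrary: S h rule: finite_induct)
  case empty
  then show ?case by (intro exI[of _ S] exI[of _ "\<lambda>f c. if f = c then 1 else 0"]) auto
next
  case (insert m B)
  show ?case
  proof (cases "\<forall>c\<in>S. h c m = 0")
    case True
    obtain F a where "F \<subseteq> S" "card S \<le> card F + card B" "\<forall>f\<in>F. \<forall>f'\<in>F. a f f' = (if f = f' then 1 else 0)"
      "\<forall>f\<in>F. \<forall>m\<in>B. (\<Sum>c\<in>S. a f c * h c m) = 0"
      using insert.IH[of S h] insert.prems by blast
    then show ?thesis using True insert.hyps by (intro exI[of _ F] exI[of _ a]) auto
  next
    case False
    then obtain d where d: "d \<in> S" "h d m \<noteq> 0" by auto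
    let ?h = "\<lambda>c b. h c b - h c m / h d m * h d b"
    obtain F a where F: "F \<subseteq> S - {d}" "card (S - {d}) \<le> card F + card B"
      "\<forall>f\<in>F. \<forall>f'\<in>F. a f f' = (if f = f' then 1 else 0)"
      "\<forall>f\<in>F. \<forall>m\<in>B. (\<Sum>c\<in>S - {d}. a f c * ?h c m) = 0"
      using insert.IH[of "S - {d}" ?h] insert.prems by blast
    define A where "A f = (\<Sum>c\<in>S - {d}. a f c * h c m) / h d m" for f
    define a' where "a' f = (a f)(d := - A f)" for f
    have sum: "(\<Sum>c\<in>S. a' f c * h c b) = (\<Sum>c\<in>S - {d}. a f c * h c b) - A f * h d b" for b f
    proof -
      have "(\<Sum>c\<in>S. a' f c * h c b) = a' f d * h d b + (\<Sum>c\<in>S - {d}. a' f c * h c b)"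
        using d insert.prems by (intro sum.remove) auto
      also have "(\<Sum>c\<in>S - {d}. a' f c * h c b) = (\<Sum>c\<in>S - {d}. a f c * h c b)"
        by (intro sum.cong) (auto simp: a'_def)
      finally show ?thesis by (simp add: a'_def)
    qed
    have "(\<Sum>c\<in>S. a' f c * h c b) = (\<Sum>c\<in>S - {d}. a f c * ?h c b)" for b f
    proof -
      have "A f * h d b = (\<Sum>c\<in>S - {d}. a f c * (h c m / h d m * h d b))"
        unfolding A_def sum_divide_distrib sum_distrib_right by (rule sum.cong) auto
      then show ?thesis unfolding sum by (simp add: right_diff_distrib sum_subtractf)
    qed
    moreover have "(\<Sum>c\<in>S. a' f c * h c m) = 0" for f unfolding sum[of f m] using d by (simp add: A_def)
    moreover have "\<forall>f\<in>F. \<forall>f'\<in>F. a' f f' = (if f = f' then 1 else 0)" using F(1,3) by (auto simp: a'_def)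
    moreover have "card S \<le> card F + card (insert m B)" using F(2) d insert by simp
    ultimately show ?thesis using F by (intro exI[of _ F] exI[of _ a']) auto
  qed
qed

text \<open>Stated for families, so that a repeated vector counts as a dependence.\<close>

definition independent :: "nat \<Rightarrow> nat \<Rightarrow> (nat \<Rightarrow> nat \<Rightarrow> complex) \<Rightarrow> bool" where
  "independent n i b \<longleftrightarrow> (\<forall>\<alpha>. (\<forall>y<n. (\<Sum>l<i. \<alpha> l * b l y) = 0) \<longrightarrow> (\<forall>l<i. \<alpha> l = 0))"

lemma independentD:
  assumes "independent n i b" "\<And>y. y < n \<Longrightarrow> (\<Sum>l<i. \<alpha> l * b l y) = 0" "l < i"
  shows "\<alpha> l = 0"
  using assms(1)[unfolded independent_def, THEN spec, of \<alpha>] assms(2,3) by simp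

text \<open>Turns dimensions into independent families, the only form in which they are used. A
  maximal independent subset of W exists because such sets have at most n elements, and it is a
  basis.\<close>

lemma dim_ge_iff:
  assumes W: "VectorSpace.subspace class_ring W (cspace n)"
  shows "i \<le> subspace_dim n W \<longleftrightarrow> (\<exists>b. (\<forall>l<i. b l \<in> W) \<and> independent n i (\<lambda>l y. b l $ y))"
proof -
  interpret V: vec_space "TYPE(complex)" n .
  have sub: "submodule class_ring W (cspace n)" using W by (simp add: subspace_def)
  have WC: "W \<subseteq> carrier_vec n" using sub by (auto simp: submodule_def module_vec_def)
  interpret W: vectorspace class_ring "V.vs W" by (rule V.subspace_is_vs[OF W])
  have li: "W.lin_dep A \<longleftrightarrow> V.lin_dep A" if "A \<subseteq> W" for A
    using V.span_li_not_depend(2)[OF that sub] .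
  have bound: "finite A \<and> card A \<le> n" if "A \<subseteq> W" "\<not> W.lin_dep A" for A
    using V.li_le_dim[of A] that li WC by (auto simp: V.dim_is_n)
  have "\<exists>A. finite A \<and> maximal A (\<lambda>S. S \<subseteq> carrier (V.vs W) \<and> \<not> W.lin_dep S)"
  proof (rule maximal_exists)
    show "{} \<subseteq> carrier (V.vs W) \<and> \<not> W.lin_dep {}" by (auto simp: W.lin_dep_def)
  qed (use bound in auto)
  then obtain A where A: "finite A" "W.basis A" using W.max_li_is_basis by blast
  have dim: "subspace_dim n W = card A" unfolding subspace_dim_def using W.dim_basis[OF A] by simp
  have AW: "A \<subseteq> W" and Ali: "\<not> V.lin_dep A" using A(2) li by (auto simp: W.basis_def)
  have Wfin: "W.fin_dim" using A by (auto simp: W.fin_dim_def W.basis_def)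
  show ?thesis
  proof
    assume i: "i \<le> subspace_dim n W"
    obtain e where e: "bij_betw e {0..<card A} A" using ex_bij_betw_nat_finite[OF A(1)] by blast
    have inj: "inj_on e {..<i}" using e i unfolding dim bij_betw_def by (auto intro: inj_on_subset)
    have eA: "e l \<in> A" if "l < i" for l using e i that unfolding dim bij_betw_def by auto
    have "independent n i (\<lambda>l y. e l $ y)"
      unfolding independent_def
    proof (intro allI impI)
      fix \<alpha> l assume z: "\<forall>y<n. (\<Sum>l<i. \<alpha> l * e l $ y) = 0" and l: "l < i"
      define a where "a v = \<alpha> (inv_into {..<i} e v)" for v
      have sub: "e ` {..<i} \<subseteq> carrier_vec n" using eA AW WC by auto
      have "V.lincomb a (e ` {..<i}) = 0\<^sub>v n"
      proof (rule eq_vecI)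
        show "dim_vec (V.lincomb a (e ` {..<i})) = dim_vec (0\<^sub>v n)"
          using V.lincomb_dim[of "e ` {..<i}" a] sub by simp
        fix y assume "y < dim_vec (0\<^sub>v n :: complex vec)"
        then have y: "y < n" by simp
        have "V.lincomb a (e ` {..<i}) $ y = (\<Sum>v\<in>e ` {..<i}. a v * v $ y)" by (rule V.lincomb_index[OF y sub])
        also have "\<dots> = (\<Sum>l<i. \<alpha> l * e l $ y)"
          unfolding sum.reindex[OF inj] o_def by (intro sum.cong refl) (simp add: a_def inv_into_f_f[OF inj])
        finally show "V.lincomb a (e ` {..<i}) $ y = 0\<^sub>v n $ y" using z y by simp
      qed
      moreover have "\<not> V.lin_dep (e ` {..<i})" by (rule V.subset_li_is_li[OF Ali]) (use eA in auto)
      ultimately have "a (e l) = 0"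
        using V.lin_dep_crit[where A = "e ` {..<i}" and S = "e ` {..<i}" and a = a and v = "e l"] l by (auto simp: class_ring_simps module_vec_simps)
      then show "\<alpha> l = 0" using l by (simp add: a_def inv_into_f_f[OF inj])
    qed
    then show "\<exists>b. (\<forall>l<i. b l \<in> W) \<and> independent n i (\<lambda>l y. b l $ y)" using eA AW by blast
  next
    assume "\<exists>b. (\<forall>l<i. b l \<in> W) \<and> independent n i (\<lambda>l y. b l $ y)"
    then obtain b where b: "\<And>l. l < i \<Longrightarrow> b l \<in> W" and ind: "independent n i (\<lambda>l y. b l $ y)" by blast
    have inj: "inj_on b {..<i}"
    proof (rule inj_onI, rule ccontr)
      fix l l' assume l: "l \<in> {..<i}" "l' \<in> {..<i}" "b l = b l'" "l \<noteq> l'"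
      define \<alpha> :: "nat \<Rightarrow> complex" where "\<alpha> x = (if x = l then 1 else 0) - (if x = l' then 1 else 0)" for x
      have z: "(\<Sum>x<i. \<alpha> x * b x $ y) = 0" for y
      proof -
        have "(\<Sum>x<i. \<alpha> x * b x $ y) = (\<Sum>x<i. if x = l then b x $ y else 0) - (\<Sum>x<i. if x = l' then b x $ y else 0)"
          unfolding sum_subtractf[symmetric] by (rule sum.cong[OF refl]) (simp add: \<alpha>_def)
        also have "(\<Sum>x<i. if x = l then b x $ y else 0) = b l $ y" using l(1) by (simp only: sum.delta finite_lessThan if_True)
        also have "(\<Sum>x<i. if x = l' then b x $ y else 0) = b l' $ y" using l(2) by (simp only: sum.delta finite_lessThan if_True)
        also have "b l $ y - b l' $ y = 0" unfolding l(3) by simp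
        finally show ?thesis .
      qed
      have "l < i" using l(1) by simp
      have "\<alpha> l = 0" by (rule independentD[OF ind z \<open>l < i\<close>])
      then show False using l by (simp add: \<alpha>_def)
    qed
    have sub: "b ` {..<i} \<subseteq> W" using b by auto
    have "\<not> V.lin_dep (b ` {..<i})"
    proof (rule V.finite_lin_indpt2)
      fix a assume z: "V.lincomb a (b ` {..<i}) = 0\<^sub>v n"
      have "(\<Sum>l<i. a (b l) * b l $ y) = 0" if y: "y < n" for y
      proof -
        have "V.lincomb a (b ` {..<i}) $ y = (\<Sum>v\<in>b ` {..<i}. a v * v $ y)"
          using sub WC by (intro V.lincomb_index[OF y]) auto
        then show ?thesis unfolding z sum.reindex[OF inj] o_def using y by simp
      qed
      then have "a (b l) = 0" if "l < i" for l using that by (rule independentD[OF ind, of "\<lambda>l. a (b l)"])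
      then show "\<forall>v\<in>b ` {..<i}. a v = 0" by auto
    qed (use sub WC in \<open>auto simp: module_vec_simps\<close>)
    then have "card (b ` {..<i}) \<le> W.dim" using W.li_le_dim(2)[OF Wfin, of "b ` {..<i}"] sub li by auto
    then show "i \<le> subspace_dim n W" using inj by (simp add: card_image subspace_dim_def)
  qed
qed

text \<open>The reason why a Schubert condition concerns an initial block of columns: the last n - c
  basis vectors span the common kernel of the first c coordinates.\<close>

lemma flag_iff: "c \<le> n \<Longrightarrow> v \<in> flag n (n - c) \<longleftrightarrow> v \<in> carrier_vec n \<and> (\<forall>y<c. v $ y = 0)"
proof -
  assume c: "c \<le> n"
  interpret V: vec_space "TYPE(complex)" n .
  have f: "flag n (n - c) = V.span (unit_vec n ` {c..<n})" using c by (simp add: flag_def)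
  have sub: "unit_vec n ` {c..<n} \<subseteq> carrier_vec n" by auto
  show ?thesis
  proof
    assume "v \<in> flag n (n - c)"
    then obtain a A where A: "v = V.lincomb a A" "finite A" "A \<subseteq> unit_vec n ` {c..<n}"
      unfolding f using V.in_spanE by blast
    have AC: "A \<subseteq> carrier_vec n" using A(3) sub by blast
    have "v \<in> carrier_vec n" using A AC V.lincomb_dim[of A a] by (auto intro: carrier_vecI)
    moreover have "v $ y = 0" if "y < c" for y
    proof -
      have "y < n" using that c by simp
      have "v $ y = (\<Sum>x\<in>A. a x * x $ y)" unfolding A(1) by (rule V.lincomb_index[OF \<open>y < n\<close> AC])
      also have "\<dots> = 0" using A(3) that \<open>y < n\<close> by (intro sum.neutral) auto
      finally show ?thesis .
    qed
    ultimately show "v \<in> carrier_vec n \<and> (\<forall>y<c. v $ y = 0)" by blast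
  next
    assume v: "v \<in> carrier_vec n \<and> (\<forall>y<c. v $ y = 0)"
    have inj: "inj_on (unit_vec n :: nat \<Rightarrow> complex vec) {c..<n}"
    proof (rule inj_onI)
      fix i j assume ij: "i \<in> {c..<n}" "j \<in> {c..<n}" "unit_vec n i = (unit_vec n j :: complex vec)"
      then have "unit_vec n j $ i = (1 :: complex)" by (metis atLeastLessThan_iff index_unit_vec(2))
      then show "i = j" using ij by (auto split: if_splits)
    qed
    define a where "a u = v $ (inv_into {c..<n} (unit_vec n) u)" for u :: "complex vec"
    have "v = V.lincomb a (unit_vec n ` {c..<n})"
    proof (rule eq_vecI)
      show "dim_vec v = dim_vec (V.lincomb a (unit_vec n ` {c..<n}))" using v V.lincomb_dim[OF _ sub, of a] by simp
      fix y assume "y < dim_vec (V.lincomb a (unit_vec n ` {c..<n}))"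
      then have y: "y < n" using V.lincomb_dim[OF _ sub, of a] by simp
      have "V.lincomb a (unit_vec n ` {c..<n}) $ y = (\<Sum>x\<in>unit_vec n ` {c..<n}. a x * x $ y)"
        by (rule V.lincomb_index[OF y sub])
      also have "\<dots> = (\<Sum>j\<in>{c..<n}. v $ j * unit_vec n j $ y)"
        unfolding sum.reindex[OF inj] o_def by (intro sum.cong refl) (simp add: a_def inv_into_f_f[OF inj])
      also have "\<dots> = (\<Sum>j\<in>{c..<n}. if j = y then v $ j else 0)" using y by (intro sum.cong refl) auto
      also have "\<dots> = v $ y" using v y by auto
      finally show "v $ y = V.lincomb a (unit_vec n ` {c..<n}) $ y" by simp
    qed
    then show "v \<in> flag n (n - c)" unfolding f by (intro V.in_spanI) auto
  qed
qed

lemma row_space_iff: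
  assumes "(M :: complex mat) \<in> carrier_mat k n"
  shows "w \<in> vec_space.row_space n M \<longleftrightarrow> w \<in> carrier_vec n \<and> (\<exists>\<gamma>. \<forall>y<n. w $ y = (\<Sum>x<k. \<gamma> x * M $$ (x, y)))"
proof -
  interpret V: vec_space "TYPE(complex)" n .
  have idx: "(M\<^sup>T *\<^sub>v u) $ y = (\<Sum>x<k. u $ x * M $$ (x, y))" if "u \<in> carrier_vec k" "y < n" for u y
    using assms that by (simp add: scalar_prod_def atLeast0LessThan mult.commute)
  show ?thesis
  proof
    assume "w \<in> V.row_space M"
    then obtain u where u: "w \<in> carrier_vec n" "u \<in> carrier_vec k" "M\<^sup>T *\<^sub>v u = w"
      unfolding V.row_space_eq[OF assms] using assms by auto
    then show "w \<in> carrier_vec n \<and> (\<exists>\<gamma>. \<forall>y<n. w $ y = (\<Sum>x<k. \<gamma> x * M $$ (x, y)))"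
      using idx[OF u(2)] by auto
  next
    assume "w \<in> carrier_vec n \<and> (\<exists>\<gamma>. \<forall>y<n. w $ y = (\<Sum>x<k. \<gamma> x * M $$ (x, y)))"
    then obtain \<gamma> where w: "w \<in> carrier_vec n" "\<And>y. y < n \<Longrightarrow> w $ y = (\<Sum>x<k. \<gamma> x * M $$ (x, y))" by blast
    have "M\<^sup>T *\<^sub>v vec k \<gamma> = w"
      by (rule eq_vecI) (use w assms idx[of "vec k \<gamma>"] in auto)
    then show "w \<in> V.row_space M" unfolding V.row_space_eq[OF assms] using w assms by (auto intro!: bexI[of _ "vec k \<gamma>"])
  qed
qed

lemma row_space_subspace:
  assumes "(M :: complex mat) \<in> carrier_mat k n"
  shows "VectorSpace.subspace class_ring (vec_space.row_space n M) (cspace n)"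
proof -
  interpret V: vec_space "TYPE(complex)" n .
  have "set (rows M) \<subseteq> carrier_vec n" using assms by (auto simp: rows_def)
  then show ?thesis unfolding V.row_space_def by (intro V.span_is_subspace) (simp add: module_vec_simps)
qed

locale complex_chart =
  fixes k n :: nat and I :: "nat set" and \<xi> :: "nat \<Rightarrow> complex"
  assumes I: "I \<in> charts k n"
begin

abbreviation "X \<equiv> cm k n I \<xi>"
abbreviation "RS \<equiv> vec_space.row_space n (chart_mat k n I \<xi>)"

lemma I': "I \<subseteq> {..<n}" "card I = k" "finite I"
  using I by (auto simp: charts_def intro: finite_subset)

lemma mem_RS: "w \<in> RS \<longleftrightarrow> w \<in> carrier_vec n \<and> (\<exists>\<gamma>. \<forall>y<n. w $ y = (\<Sum>x<k. \<gamma> x * X x y))"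
  using row_space_iff[of "chart_mat k n I \<xi>" k n w] by (simp add: chart_mat_cm)

lemma RS_subspace: "VectorSpace.subspace class_ring RS (cspace n)"
  by (rule row_space_subspace[of _ k]) (simp add: chart_mat_cm)

lemma pick_n: "l < k \<Longrightarrow> pick I l < n"
  using I' pick_mem[of I l] by auto

lemma coeff_eq: "l < k \<Longrightarrow> (\<Sum>x<k. \<gamma> x * X x (pick I l)) = \<gamma> l"
proof -
  assume l: "l < k"
  have "(\<Sum>x<k. \<gamma> x * X x (pick I l)) = (\<Sum>x<k. if x = l then \<gamma> x else 0)"
    by (intro sum.cong refl) (auto simp: cm_pick[OF I l])
  then show ?thesis using l by simp
qed

text \<open>By the identity columns, vectors of the row space are independent iff their coefficient
  vectors are.\<close>

lemma RS_dim: "subspace_dim n RS = k"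
proof (rule antisym)
  show "k \<le> subspace_dim n RS"
    unfolding dim_ge_iff[OF RS_subspace]
  proof (intro exI conjI allI impI)
    fix l assume l: "l < k"
    show "vec n (X l) \<in> RS"
      unfolding mem_RS
    proof (intro conjI exI[of _ "\<lambda>x. if x = l then 1 else 0"] allI impI)
      fix y assume "y < n"
      have "(\<Sum>x<k. (if x = l then 1 else 0) * X x y) = (\<Sum>x<k. if x = l then X x y else 0)"
        by (intro sum.cong refl) auto
      then show "vec n (X l) $ y = (\<Sum>x<k. (if x = l then 1 else 0) * X x y)" using l \<open>y < n\<close> by simp
    qed simp
  next
    show "independent n k (\<lambda>l y. vec n (X l) $ y)"
      unfolding independent_def
    proof (intro allI impI)
      fix \<alpha> l assume z: "\<forall>y<n. (\<Sum>l<k. \<alpha> l * vec n (X l) $ y) = 0" and l: "l < k"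
      have "(\<Sum>x<k. \<alpha> x * X x (pick I l)) = 0" using z[rule_format, OF pick_n[OF l]] pick_n[OF l] by simp
      then show "\<alpha> l = 0" using coeff_eq[OF l] by simp
    qed
  qed
  show "subspace_dim n RS \<le> k"
  proof (rule ccontr)
    assume "\<not> ?thesis"
    then have "Suc k \<le> subspace_dim n RS" by simp
    then obtain b where b: "\<forall>l<Suc k. b l \<in> RS" and ind: "independent n (Suc k) (\<lambda>l y. b l $ y)"
      unfolding dim_ge_iff[OF RS_subspace] by blast
    then have "\<forall>l. \<exists>\<gamma>. l < Suc k \<longrightarrow> (\<forall>y<n. b l $ y = (\<Sum>x<k. \<gamma> x * X x y))" unfolding mem_RS by blast
    then obtain \<gamma> where \<gamma>: "\<And>l y. l < Suc k \<Longrightarrow> y < n \<Longrightarrow> b l $ y = (\<Sum>x<k. \<gamma> l x * X x y)" by metis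
    obtain a where a: "\<exists>c\<in>{..<Suc k}. a c \<noteq> 0" "\<forall>x\<in>{..<k}. (\<Sum>l<Suc k. a l * \<gamma> l x) = 0"
      using linear_dependence[of "{..<k}" "{..<Suc k}" \<gamma>] by auto
    have "(\<Sum>l<Suc k. a l * b l $ y) = 0" if "y < n" for y
    proof -
      have "(\<Sum>l<Suc k. a l * b l $ y) = (\<Sum>l<Suc k. \<Sum>x<k. a l * \<gamma> l x * X x y)"
        using that by (intro sum.cong refl) (simp add: \<gamma> sum_distrib_left mult.assoc)
      also have "\<dots> = (\<Sum>x<k. (\<Sum>l<Suc k. a l * \<gamma> l x) * X x y)"
        unfolding sum_distrib_right by (rule sum.swap)
      also have "\<dots> = 0" using a(2) by (intro sum.neutral) auto
      finally show ?thesis .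
    qed
    then have "a l = 0" if "l < Suc k" for l using that by (rule independentD[OF ind])
    then show False using a(1) by auto
  qed
qed

context
  fixes a b c :: nat
  assumes ab: "1 \<le> a" "a \<le> k" "1 \<le> b" "b \<le> n - k" and c_def: "c = k - a + b" and kn: "k < n"
begin

lemma c_le: "c \<le> n" "n - k + a - b = n - c"
  using ab kn by (auto simp: c_def)

lemma inter_subspace: "VectorSpace.subspace class_ring (RS \<inter> flag n (n - c)) (cspace n)"
proof -
  interpret V: vec_space "TYPE(complex)" n .
  have s: "VectorSpace.subspace class_ring (flag n (n - c)) (cspace n)"
    unfolding flag_def by (intro V.span_is_subspace) (auto simp: module_vec_simps)
  have "submodule class_ring (RS \<inter> flag n (n - c)) (cspace n)"
    using RS_subspace s unfolding subspace_def submodule_def by auto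
  then show ?thesis using s by (simp add: subspace_def)
qed

lemma schubert_iff: "RS \<in> schubert_rect k n a b \<longleftrightarrow>
    (\<exists>v. (\<forall>l<a. v l \<in> RS \<and> (\<forall>y<c. v l $ y = 0)) \<and> independent n a (\<lambda>l y. v l $ y))"
proof -
  have "RS \<in> grassmannian k n" using RS_subspace RS_dim by (simp add: grassmannian_def)
  moreover have "w \<in> RS \<inter> flag n (n - c) \<longleftrightarrow> w \<in> RS \<and> (\<forall>y<c. w $ y = 0)" for w
    using flag_iff[OF c_le(1)] by (auto simp: mem_RS)
  ultimately show ?thesis
    unfolding schubert_rect_def mem_Collect_eq c_le(2) dim_ge_iff[OF inter_subspace] by simp
qed

text \<open>Among a independent combinations of rows that vanish on the first c columns, some
  nonzero combination uses only the k - a + 1 rows chosen by f, since the other rows impose a - 1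
  conditions. Its coefficients are a relation between the rows of the minor.\<close>

lemma schubert_minor:
  assumes "RS \<in> schubert_rect k n a b" and f: "\<forall>i<k - a + 1. f i < k" and g: "\<forall>i<k - a + 1. g i < c"
  shows "minor (k - a + 1) f g X = 0"
proof (cases "inj_on f {..<k - a + 1}")
  case True
  let ?r = "k - a + 1"
  obtain v where v: "\<forall>l<a. v l \<in> RS \<and> (\<forall>y<c. v l $ y = 0)" and ind: "independent n a (\<lambda>l y. v l $ y)"
    using assms(1) unfolding schubert_iff by blast
  then have "\<forall>l. \<exists>\<gamma>. l < a \<longrightarrow> (\<forall>y<n. v l $ y = (\<Sum>x<k. \<gamma> x * X x y))" unfolding mem_RS by blast
  then obtain \<gamma> where \<gamma>: "\<And>l y. l < a \<Longrightarrow> y < n \<Longrightarrow> v l $ y = (\<Sum>x<k. \<gamma> l x * X x y)" by metis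
  let ?B = "{..<k} - f ` {..<?r}"
  have "card ?B = k - ?r" using f True by (subst card_Diff_subset) (auto simp: card_image)
  then have "card ?B < card {..<a}" using ab by simp
  then obtain \<beta> where \<beta>: "\<exists>l\<in>{..<a}. \<beta> l \<noteq> 0" "\<forall>x\<in>?B. (\<Sum>l<a. \<beta> l * \<gamma> l x) = 0"
    using linear_dependence[of ?B "{..<a}" \<gamma>] by auto
  define \<delta> where "\<delta> x = (\<Sum>l<a. \<beta> l * \<gamma> l x)" for x
  have sum: "(\<Sum>x<k. \<delta> x * X x y) = (\<Sum>l<a. \<beta> l * v l $ y)" if "y < n" for y
  proof -
    have "(\<Sum>x<k. \<delta> x * X x y) = (\<Sum>x<k. \<Sum>l<a. \<beta> l * (\<gamma> l x * X x y))"
      by (simp add: \<delta>_def sum_distrib_right mult.assoc)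
    also have "\<dots> = (\<Sum>l<a. \<Sum>x<k. \<beta> l * (\<gamma> l x * X x y))" by (rule sum.swap)
    also have "\<dots> = (\<Sum>l<a. \<beta> l * v l $ y)" using that by (intro sum.cong refl) (simp add: \<gamma> sum_distrib_left)
    finally show ?thesis .
  qed
  have "\<exists>x\<in>f ` {..<?r}. \<delta> x \<noteq> 0"
  proof (rule ccontr)
    assume "\<not> ?thesis"
    then have "\<delta> x = 0" if "x < k" for x using \<beta>(2) that by (cases "x \<in> f ` {..<?r}") (auto simp: \<delta>_def)
    then have "(\<Sum>l<a. \<beta> l * v l $ y) = 0" if "y < n" for y using sum[OF that] by simp
    then have "\<beta> l = 0" if "l < a" for l using that by (rule independentD[OF ind])
    then show False using \<beta>(1) by auto
  qed
  then obtain i0 where i0: "i0 < ?r" "\<delta> (f i0) \<noteq> 0" by auto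
  let ?M = "mat ?r ?r (\<lambda>(p, q). X (f q) (g p))"
  have "?M *\<^sub>v vec ?r (\<lambda>i. \<delta> (f i)) = 0\<^sub>v ?r"
  proof (rule eq_vecI)
    fix p assume "p < dim_vec (0\<^sub>v ?r :: complex vec)"
    then have p: "p < ?r" by simp
    have gp: "g p < n" "g p < c" using g p c_le by auto
    have "(?M *\<^sub>v vec ?r (\<lambda>i. \<delta> (f i))) $ p = (\<Sum>q<?r. \<delta> (f q) * X (f q) (g p))"
      using p by (simp add: scalar_prod_def atLeast0LessThan mult.commute)
    also have "\<dots> = (\<Sum>x\<in>f ` {..<?r}. \<delta> x * X x (g p))" unfolding sum.reindex[OF True] o_def ..
    also have "\<dots> = (\<Sum>x<k. \<delta> x * X x (g p))"
      using \<beta>(2) f by (intro sum.mono_neutral_left) (auto simp: \<delta>_def)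
    also have "\<dots> = 0" unfolding sum[OF gp(1)] using v gp by (intro sum.neutral) auto
    finally show "(?M *\<^sub>v vec ?r (\<lambda>i. \<delta> (f i))) $ p = 0\<^sub>v ?r $ p" using p by simp
  qed simp
  moreover have "vec ?r (\<lambda>i. \<delta> (f i)) \<noteq> 0\<^sub>v ?r"
    using i0 by (metis index_vec index_zero_vec(1))
  ultimately have "det ?M = 0" by (subst det_0_iff_vec_prod_zero_field[of _ ?r]) (auto intro!: exI[of _ "vec ?r (\<lambda>i. \<delta> (f i))"])
  moreover have "?M = (mat ?r ?r (\<lambda>(p, q). X (f p) (g q)))\<^sup>T" by (rule eq_matI) auto
  ultimately show ?thesis unfolding minor_def by (metis det_transpose mat_carrier)
qed (rule minor_noninj_row)

text \<open>The rows from number p = card (I \<inter> {..<c}) on vanish in the columns of I before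
  c, so only the other columns matter. There they factor through card T dimensions, and
  \<open>relations\<close> leaves at least a combinations that vanish on the first c columns; their
  independence is visible in the identity columns.\<close>

lemma schubert_memI:
  assumes T: "finite T" "card (I \<inter> {..<c}) + card T \<le> k - a"
    and X: "\<And>x y. card (I \<inter> {..<c}) \<le> x \<Longrightarrow> x < k \<Longrightarrow> y < c \<Longrightarrow> y \<notin> I \<Longrightarrow> X x y = (\<Sum>i\<in>T. u i x * v i y)"
  shows "RS \<in> schubert_rect k n a b"
proof -
  let ?p = "card (I \<inter> {..<c})"
  obtain F \<gamma> where F: "F \<subseteq> {?p..<k}" "card {?p..<k} \<le> card F + card T"
    "\<forall>f\<in>F. \<forall>f'\<in>F. \<gamma> f f' = (if f = f' then 1 else (0 :: complex))"
    "\<forall>f\<in>F. \<forall>i\<in>T. (\<Sum>x\<in>{?p..<k}. \<gamma> f x * u i x) = 0"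
    using relations[OF T(1), of "{?p..<k}" "\<lambda>x i. u i x"] by auto
  have finF: "finite F" using F(1) finite_subset by blast
  have aF: "a \<le> card F" using F(2) T(2) ab by simp
  obtain e where e: "bij_betw e {0..<card F} F" using ex_bij_betw_nat_finite[OF finF] by blast
  have eF: "e l \<in> F" if "l < a" for l using e that aF unfolding bij_betw_def by auto
  have einj: "e l = e l' \<longleftrightarrow> l = l'" if "l < a" "l' < a" for l l'
    using e that aF unfolding bij_betw_def by (auto dest: inj_onD)
  define w where "w l = vec n (\<lambda>y. \<Sum>x\<in>{?p..<k}. \<gamma> (e l) x * X x y)" for l
  have ext: "(\<Sum>x\<in>{?p..<k}. \<gamma> (e l) x * X x y) = (\<Sum>x<k. (if ?p \<le> x then \<gamma> (e l) x else 0) * X x y)" for l y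
    by (intro sum.mono_neutral_cong_left) auto
  show ?thesis
    unfolding schubert_iff
  proof (intro exI[of _ w] conjI allI impI)
    fix l assume l: "l < a"
    show "w l \<in> RS" unfolding mem_RS
      by (intro conjI exI[of _ "\<lambda>x. if ?p \<le> x then \<gamma> (e l) x else 0"]) (auto simp: w_def ext)
    fix y assume y: "y < c"
    have yn: "y < n" using y c_le by simp
    show "w l $ y = 0"
    proof (cases "y \<in> I")
      case True
      have "card (I \<inter> {..<y}) < ?p"
      proof (rule psubset_card_mono)
        show "I \<inter> {..<y} \<subset> I \<inter> {..<c}" using True y by auto
      qed (use I' in auto)
      then have "X x y = 0" if "?p \<le> x" for x using that True by (simp add: cm_def)
      then show ?thesis using yn by (simp add: w_def)
    next
      case False
      have "w l $ y = (\<Sum>x\<in>{?p..<k}. \<Sum>i\<in>T. \<gamma> (e l) x * u i x * v i y)"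
        unfolding w_def using yn y False by (simp add: X sum_distrib_left mult.assoc)
      also have "\<dots> = (\<Sum>i\<in>T. (\<Sum>x\<in>{?p..<k}. \<gamma> (e l) x * u i x) * v i y)"
        unfolding sum_distrib_right by (rule sum.swap)
      also have "\<dots> = 0" using F(4) eF[OF l] by simp
      finally show ?thesis .
    qed
  next
    show "independent n a (\<lambda>l y. w l $ y)"
      unfolding independent_def
    proof (intro allI impI)
      fix \<alpha> l' assume z: "\<forall>y<n. (\<Sum>l<a. \<alpha> l * w l $ y) = 0" and l': "l' < a"
      have ek: "e l' < k" "?p \<le> e l'" using F(1) eF[OF l'] by auto
      have wl: "w l $ pick I (e l') = \<gamma> (e l) (e l')" for l
        using pick_n[OF ek(1)] ek by (simp add: w_def ext coeff_eq)
      have "0 = (\<Sum>l<a. \<alpha> l * w l $ pick I (e l'))" using z pick_n[OF ek(1)] by simp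
      also have "\<dots> = (\<Sum>l<a. if l = l' then \<alpha> l else 0)"
        unfolding wl using F(3) eF l' einj by (intro sum.cong refl) auto
      also have "\<dots> = \<alpha> l'" using l' by simp
      finally show "\<alpha> l' = 0" by simp
    qed
  qed
qed

end

end

section \<open>Contact orders of closed points\<close>

lemma minor_hom:
  assumes "comm_ring_hom h"
  shows "h (minor j f g X) = minor j f g (\<lambda>x y. h (X x y))"
proof -
  interpret comm_ring_hom h by fact
  have "map_mat h (mat j j (\<lambda>(a, b). X (f a) (g b))) = mat j j (\<lambda>(a, b). h (X (f a) (g b)))"
    by (rule eq_matI) auto
  then show ?thesis unfolding minor_def hom_det[symmetric] by simp
qed

lemma cm_hom:
  assumes "comm_ring_hom h"
  shows "h (cm k n I x i c) = cm k n I (\<lambda>v. h (x v)) i c"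
proof -
  interpret comm_ring_hom h by fact
  show ?thesis by (simp add: cm_def)
qed

definition fmap :: "('a::comm_ring_1 \<Rightarrow> 'b::comm_ring_1) \<Rightarrow> 'a fps \<Rightarrow> 'b fps" where
  "fmap h F = Abs_fps (\<lambda>m. h (fps_nth F m))"

lemma fmap_nth [simp]: "fps_nth (fmap h F) m = h (fps_nth F m)"
  by (simp add: fmap_def)

lemma fmap_hom:
  assumes "comm_ring_hom h"
  shows "comm_ring_hom (fmap h)"
proof -
  interpret comm_ring_hom h by fact
  show ?thesis
    by unfold_locales (auto intro!: fps_ext simp: fps_mult_nth hom_sum hom_add hom_mult)
qed

lemma fps_const_hom: "comm_ring_hom (fps_const :: complex \<Rightarrow> complex fps)"
  by unfold_locales (simp_all add: fps_const_add[symmetric] fps_const_mult[symmetric] del: fps_const_add fps_const_mult)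

text \<open>The specialization of \<open>universal_coord\<close> at the closed point \<xi>.\<close>

definition arcc :: "nat \<Rightarrow> nat \<Rightarrow> (nat \<Rightarrow> complex) \<Rightarrow> nat \<Rightarrow> complex fps" where
  "arcc k n \<xi> v = Abs_fps (\<lambda>m. \<xi> (m * (k * (n - k)) + v))"

lemma ev_universal:
  "ev \<xi> (fps_nth (eval_poly (\<lambda>c. fps_const (const c)) (universal_coord k n) f) m) =
    fps_nth (eval_poly fps_const (arcc k n \<xi>) f) m"
proof -
  have "fmap (ev \<xi>) (eval_poly (\<lambda>c. fps_const (const c)) (universal_coord k n) f)
    = eval_poly (\<lambda>c. fmap (ev \<xi>) (fps_const (const c))) (\<lambda>v. fmap (ev \<xi>) (universal_coord k n v)) f"
    by (rule hom_eval_poly[OF fmap_hom[OF ev_hom]])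
  also have "(\<lambda>c. fmap (ev \<xi>) (fps_const (const c))) = fps_const"
    by (intro ext fps_ext) (simp add: fmap_def)
  also have "(\<lambda>v. fmap (ev \<xi>) (universal_coord k n v)) = arcc k n \<xi>"
    by (intro ext fps_ext) (simp add: universal_coord_def arcc_def)
  finally show ?thesis by (metis fmap_nth)
qed

lemma ord_mod_ev_ker:
  "ord_mod (ev_ker \<xi>) (eval_poly (\<lambda>c. fps_const (const c)) (universal_coord k n) f) =
    ford (eval_poly fps_const (arcc k n \<xi>) f)"
  by (simp add: ord_mod_def ford_def ev_ker_def ev_universal)

section \<open>Variables occurring in sums, products and minors\<close>

lemma vars_add: "vars (p + q) \<subseteq> vars p \<union> vars q"
  using keys_add[of p q] by (auto simp: vars_def)

lemma vars_mult: "vars (p * q) \<subseteq> vars p \<union> vars q"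
proof
  fix v assume "v \<in> vars (p * q)"
  then obtain m where m: "m \<in> Poly_Mapping.keys (p * q)" "v \<in> Poly_Mapping.keys m" by (auto simp: vars_def)
  then obtain a b where "a \<in> Poly_Mapping.keys p" "b \<in> Poly_Mapping.keys q" "m = a + b" using keys_mult[of p q] by blast
  then show "v \<in> vars p \<union> vars q" using m keys_add[of a b] by (auto simp: vars_def)
qed

lemma vars_single: "vars (Poly_Mapping.single m c) \<subseteq> Poly_Mapping.keys m"
  by (simp add: vars_def)

lemma vars_const [simp]: "vars (const c) = {}"
  using vars_single[of 0 c] by (auto simp: const_def)

lemma vars_0 [simp]: "vars 0 = {}" by (simp add: vars_def)

lemma vars_1 [simp]: "vars 1 = {}"
  using vars_const[of 1] by (simp add: const_def)

lemma vars_var: "vars (var v) \<subseteq> {v}"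
  using vars_single[of "Poly_Mapping.single v 1" 1] by (auto simp: var_def)

lemma vars_uminus [simp]: "vars (- p) = vars p"
  by (simp add: vars_def)

lemma vars_sum: "(\<And>i. i \<in> S \<Longrightarrow> vars (p i) \<subseteq> W) \<Longrightarrow> vars (\<Sum>i\<in>S. p i) \<subseteq> W"
proof (induction S rule: infinite_finite_induct)
  case (insert i S)
  then show ?case using vars_add[of "p i" "\<Sum>i\<in>S. p i"] by fastforce
qed auto

lemma vars_prod: "(\<And>i. i \<in> S \<Longrightarrow> vars (p i) \<subseteq> W) \<Longrightarrow> vars (\<Prod>i\<in>S. p i) \<subseteq> W"
proof (induction S rule: infinite_finite_induct)
  case (insert i S)
  then show ?case using vars_mult[of "p i" "\<Prod>i\<in>S. p i"] by fastforce
qed auto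

lemma vars_minor:
  assumes "\<And>a b. a < j \<Longrightarrow> b < j \<Longrightarrow> vars (X (f a) (g b)) \<subseteq> W"
  shows "vars (minor j f g X) \<subseteq> W"
  unfolding minor_def det_mat_Leibniz
proof (rule vars_sum)
  fix p assume p: "p \<in> {p. p permutes {0..<j}}"
  have "vars (\<Prod>i = 0..<j. X (f i) (g (p i))) \<subseteq> W"
    using permutes_in_image[of p "{0..<j}"] p by (intro vars_prod assms) auto
  then show "vars (signof p * (\<Prod>i = 0..<j. X (f i) (g (p i)))) \<subseteq> W"
    by (cases p rule: sign_cases) auto
qed

lemma card_compl_below:
  assumes "I \<in> charts k n" "c \<le> n"
  shows "c \<notin> I \<Longrightarrow> c < n \<Longrightarrow> card ({..<c} - I) < n - k"
    and "card ({..<n} - I) = n - k"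
proof -
  have I: "I \<subseteq> {..<n}" "card I = k" "finite I" using assms by (auto simp: charts_def intro: finite_subset)
  show e: "card ({..<n} - I) = n - k" using I by (simp add: card_Diff_subset)
  assume "c \<notin> I" "c < n"
  then have "{..<c} - I \<subset> {..<n} - I" by auto
  then have "card ({..<c} - I) < card ({..<n} - I)" by (intro psubset_card_mono) auto
  then show "card ({..<c} - I) < n - k" using e by simp
qed

lemma compl_pick:
  assumes "I \<in> charts k n"
  shows "y < n \<Longrightarrow> y \<notin> I \<Longrightarrow> pick ({..<n} - I) (card ({..<y} - I)) = y"
    and "j < n - k \<Longrightarrow> pick ({..<n} - I) j < n \<and> pick ({..<n} - I) j \<notin> I \<and> card ({..<pick ({..<n} - I) j} - I) = j"
proof -
  let ?J = "{..<n} - I"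
  have cJ: "card ?J = n - k" by (rule card_compl_below(2)[OF assms order_refl])
  have int: "?J \<inter> {..<y} = {..<y} - I" if "y \<le> n" for y using that by auto
  show "pick ?J (card ({..<y} - I)) = y" if "y < n" "y \<notin> I"
    using pick_card_below[of y ?J] int[of y] that by simp
  assume j: "j < n - k"
  then have m: "pick ?J j \<in> ?J" using cJ by (intro pick_mem) auto
  then show "pick ?J j < n \<and> pick ?J j \<notin> I \<and> card ({..<pick ?J j} - I) = j"
    using card_below_pick[of ?J j] int[of "pick ?J j"] j cJ by simp
qed

lemma coord_index_less: "i < k \<Longrightarrow> j < m \<Longrightarrow> i * m + j < k * (m :: nat)"
proof -
  assume "i < k" "j < m"
  then have "i * m + j < Suc i * m" by simp
  also have "\<dots> \<le> k * m" using \<open>i < k\<close> by (intro mult_le_mono1) simp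
  finally show ?thesis .
qed

lemma cm_cong:
  assumes "I \<in> charts k n" "i < k" "y < n" "\<And>v. v < k * (n - k) \<Longrightarrow> x v = x' v"
  shows "cm k n I x i y = cm k n I x' i y"
  using assms card_compl_below(1)[OF assms(1), of y] by (auto simp: cm_def intro!: assms(4) coord_index_less)

text \<open>Multi-affine functions of the subset \<open>T\<close>, where the variable number \<open>i\<close> takes the value
  \<open>t i\<close> for \<open>i \<in> T\<close> and the value 0 otherwise.\<close>

definition multiaffine :: "nat \<Rightarrow> (nat \<Rightarrow> 'r::comm_ring_1) \<Rightarrow> (nat set \<Rightarrow> 'r) \<Rightarrow> bool" where
  "multiaffine K t h \<longleftrightarrow> (\<exists>cf. \<forall>T\<subseteq>{..<K}. h T = (\<Sum>S\<in>Pow T. cf S * (\<Prod>i\<in>S. t i)))"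

lemma multiaffine_const: "multiaffine K t (\<lambda>_. a)"
  unfolding multiaffine_def
proof (intro exI allI impI)
  fix T assume "T \<subseteq> {..<K}"
  then have fin: "finite T" using finite_subset by blast
  have "(\<Sum>S\<in>Pow T. (if S = {} then a else 0) * (\<Prod>i\<in>S. t i)) = (\<Sum>S\<in>{{}}. (if S = {} then a else 0) * (\<Prod>i\<in>S. t i))"
    using fin by (intro sum.mono_neutral_right) auto
  then show "a = (\<Sum>S\<in>Pow T. (if S = {} then a else 0) * (\<Prod>i\<in>S. t i))" by simp
qed

lemma multiaffine_linear: "multiaffine K t (\<lambda>T. \<Sum>l\<in>T. b l * t l)"
  unfolding multiaffine_def
proof (intro exI allI impI)
  fix T assume "T \<subseteq> {..<K}"
  then have fin: "finite T" using finite_subset by blast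
  let ?cf = "\<lambda>S. if card S = 1 then b (the_elem S) else 0"
  have "(\<Sum>S\<in>Pow T. ?cf S * (\<Prod>i\<in>S. t i)) = (\<Sum>S\<in>(\<lambda>l. {l}) ` T. ?cf S * (\<Prod>i\<in>S. t i))"
    using fin by (intro sum.mono_neutral_right) (auto simp: card_1_singleton_iff)
  also have "\<dots> = (\<Sum>l\<in>T. b l * t l)" by (subst sum.reindex) auto
  finally show "(\<Sum>l\<in>T. b l * t l) = (\<Sum>S\<in>Pow T. ?cf S * (\<Prod>i\<in>S. t i))" ..
qed

lemma multiaffine_add:
  assumes "multiaffine K t g" "multiaffine K t h"
  shows "multiaffine K t (\<lambda>T. g T + h T)"
proof -
  obtain c d where "\<forall>T\<subseteq>{..<K}. g T = (\<Sum>S\<in>Pow T. c S * (\<Prod>i\<in>S. t i))"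
    "\<forall>T\<subseteq>{..<K}. h T = (\<Sum>S\<in>Pow T. d S * (\<Prod>i\<in>S. t i))"
    using assms unfolding multiaffine_def by blast
  then show ?thesis unfolding multiaffine_def
    by (intro exI[of _ "\<lambda>S. c S + d S"]) (simp add: distrib_right sum.distrib)
qed

text \<open>The product of the monomials of two sets is the monomial of their union times that of
  their intersection; the second factor is absorbed into the coefficient, which keeps the result
  squarefree.\<close>

lemma multiaffine_mult:
  assumes "multiaffine K t g" "multiaffine K t h"
  shows "multiaffine K t (\<lambda>T. g T * h T)"
proof -
  obtain c d where c: "\<forall>T\<subseteq>{..<K}. g T = (\<Sum>S\<in>Pow T. c S * (\<Prod>i\<in>S. t i))"
    and d: "\<forall>T\<subseteq>{..<K}. h T = (\<Sum>S\<in>Pow T. d S * (\<Prod>i\<in>S. t i))"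
    using assms unfolding multiaffine_def by blast
  define e where "e W = (\<Sum>SS\<in>{SS \<in> Pow W \<times> Pow W. fst SS \<union> snd SS = W}. c (fst SS) * d (snd SS) * (\<Prod>i\<in>fst SS \<inter> snd SS. t i))" for W
  have "g T * h T = (\<Sum>W\<in>Pow T. e W * (\<Prod>i\<in>W. t i))" if T: "T \<subseteq> {..<K}" for T
  proof -
    have fin: "finite T" using T finite_subset by blast
    let ?t = "\<lambda>SS. c (fst SS) * (\<Prod>i\<in>fst SS. t i) * (d (snd SS) * (\<Prod>i\<in>snd SS. t i))"
    have "g T * h T = (\<Sum>SS\<in>Pow T \<times> Pow T. ?t SS)"
      using c d T by (simp add: sum_product sum.cartesian_product case_prod_beta)
    also have "\<dots> = (\<Sum>W\<in>Pow T. \<Sum>SS\<in>{SS \<in> Pow T \<times> Pow T. fst SS \<union> snd SS = W}. ?t SS)"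
      using fin by (intro sum.group[symmetric]) auto
    also have "\<dots> = (\<Sum>W\<in>Pow T. e W * (\<Prod>i\<in>W. t i))"
    proof (rule sum.cong[OF refl])
      fix W assume W: "W \<in> Pow T"
      have E: "{SS \<in> Pow T \<times> Pow T. fst SS \<union> snd SS = W} = {SS \<in> Pow W \<times> Pow W. fst SS \<union> snd SS = W}"
        using W by auto
      have Tm: "?t SS = c (fst SS) * d (snd SS) * (\<Prod>i\<in>fst SS \<inter> snd SS. t i) * (\<Prod>i\<in>W. t i)"
        if SS: "SS \<in> {SS \<in> Pow W \<times> Pow W. fst SS \<union> snd SS = W}" for SS
      proof -
        have "finite (fst SS)" "finite (snd SS)" "fst SS \<union> snd SS = W" using SS W fin finite_subset by auto
        then have "(\<Prod>i\<in>fst SS. t i) * (\<Prod>i\<in>snd SS. t i) = (\<Prod>i\<in>W. t i) * (\<Prod>i\<in>fst SS \<inter> snd SS. t i)"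
          using prod.union_inter[of "fst SS" "snd SS" t] by simp
        moreover have "?t SS = c (fst SS) * d (snd SS) * ((\<Prod>i\<in>fst SS. t i) * (\<Prod>i\<in>snd SS. t i))" by (simp only: mult_ac)
        ultimately show ?thesis by (simp only: mult_ac)
      qed
      show "(\<Sum>SS\<in>{SS \<in> Pow T \<times> Pow T. fst SS \<union> snd SS = W}. ?t SS) = e W * (\<Prod>i\<in>W. t i)"
        unfolding e_def sum_distrib_right by (rule sum.cong[OF E Tm])
    qed
    finally show ?thesis .
  qed
  then show ?thesis unfolding multiaffine_def by blast
qed

lemma multiaffine_sum: "(\<And>i. i \<in> S \<Longrightarrow> multiaffine K t (h i)) \<Longrightarrow> multiaffine K t (\<lambda>T. \<Sum>i\<in>S. h i T)"
  by (induction S rule: infinite_finite_induct) (auto intro: multiaffine_add multiaffine_const)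

lemma multiaffine_prod: "(\<And>i. i \<in> S \<Longrightarrow> multiaffine K t (h i)) \<Longrightarrow> multiaffine K t (\<lambda>T. \<Prod>i\<in>S. h i T)"
  by (induction S rule: infinite_finite_induct) (auto intro: multiaffine_mult multiaffine_const)

lemma multiaffine_power: "multiaffine K t h \<Longrightarrow> multiaffine K t (\<lambda>T. h T ^ e)"
  by (induction e) (auto intro: multiaffine_mult multiaffine_const)

lemma multiaffine_eval_poly:
  assumes "\<And>v. multiaffine K t (\<lambda>T. x T v)"
  shows "multiaffine K t (\<lambda>T. eval_poly \<phi> (x T) f)"
  unfolding eval_poly_def
  by (intro multiaffine_sum multiaffine_mult multiaffine_prod multiaffine_power multiaffine_const assms)

text \<open>By induction on its size, the monomial term of a set with fewer than q elements
  vanishes, because h vanishes on that set and the terms of its proper subsets are already 0. The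
  other terms contain at least q diagonal entries.\<close>

lemma multiaffine_order:
  assumes h: "multiaffine K (\<lambda>i. tp (\<kappa> i)) h" and mono: "mono \<kappa>"
    and van: "\<And>T. T \<subseteq> {..<K} \<Longrightarrow> card T < q \<Longrightarrow> h T = 0"
  shows "(\<Sum>i<q. \<kappa> i) \<le> ford (h {..<K})"
proof -
  obtain cf where cf: "\<And>T. T \<subseteq> {..<K} \<Longrightarrow> h T = (\<Sum>S\<in>Pow T. cf S * (\<Prod>i\<in>S. tp (\<kappa> i)))"
    using h unfolding multiaffine_def by blast
  have small: "cf T * (\<Prod>i\<in>T. tp (\<kappa> i)) = 0" if "T \<subseteq> {..<K}" "card T < q" for T
    using that
  proof (induction "card T" arbitrary: T rule: less_induct)
    case less
    have fin: "finite T" using less.prems finite_subset by blast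
    have "0 = (\<Sum>S\<in>Pow T. cf S * (\<Prod>i\<in>S. tp (\<kappa> i)))" using van[OF less.prems] cf[OF less.prems(1)] by simp
    also have "\<dots> = cf T * (\<Prod>i\<in>T. tp (\<kappa> i)) + (\<Sum>S\<in>Pow T - {T}. cf S * (\<Prod>i\<in>S. tp (\<kappa> i)))"
      using fin by (intro sum.remove) auto
    also have "(\<Sum>S\<in>Pow T - {T}. cf S * (\<Prod>i\<in>S. tp (\<kappa> i))) = 0"
    proof (rule sum.neutral, rule)
      fix S assume "S \<in> Pow T - {T}"
      then have "S \<subset> T" by auto
      then have "card S < card T" "S \<subseteq> {..<K}" using less.prems psubset_card_mono[OF fin] by auto
      then show "cf S * (\<Prod>i\<in>S. tp (\<kappa> i)) = 0"
        using less.prems by (intro less.hyps) auto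
    qed
    finally show ?case by simp
  qed
  have "(\<Sum>i<q. \<kappa> i) \<le> ford (cf S * (\<Prod>i\<in>S. tp (\<kappa> i)))" if "S \<in> Pow {..<K}" for S
  proof (cases "card S < q")
    case False
    have fin: "finite S" using that finite_subset by blast
    have "(\<Sum>i<q. \<kappa> i) \<le> (\<Sum>i<card S. \<kappa> i)" using False by (intro sum_mono2) auto
    also have "\<dots> \<le> (\<Sum>i\<in>S. \<kappa> i)" by (rule sum_ge_initial[OF mono fin])
    finally show ?thesis by (simp add: ford_mult ford_prod[OF fin] add_increasing)
  next
    case True
    have "cf S * (\<Prod>i\<in>S. tp (\<kappa> i)) = 0" by (rule small) (use that True in auto)
    then show ?thesis by (simp only: ford_0 enat_ord_simps)
  qed
  then show ?thesis unfolding cf[OF order_refl] by (intro ford_sum_ge)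
qed

definition same_upto :: "nat \<Rightarrow> complex fps \<Rightarrow> complex fps \<Rightarrow> bool" where
  "same_upto N F G \<longleftrightarrow> (\<forall>m\<le>N. fps_nth F m = fps_nth G m)"

lemma same_upto_refl [simp]: "same_upto N F F" by (simp add: same_upto_def)

lemma same_upto_mult: "same_upto N F F' \<Longrightarrow> same_upto N G G' \<Longrightarrow> same_upto N (F * G) (F' * G')"
  unfolding same_upto_def fps_mult_nth by (auto intro!: sum.cong)

lemma same_upto_sum: "(\<And>i. i \<in> S \<Longrightarrow> same_upto N (F i) (G i)) \<Longrightarrow> same_upto N (\<Sum>i\<in>S. F i) (\<Sum>i\<in>S. G i)"
  unfolding same_upto_def fps_sum_nth by (auto intro!: sum.cong)

lemma same_upto_prod: "(\<And>i. i \<in> S \<Longrightarrow> same_upto N (F i) (G i)) \<Longrightarrow> same_upto N (\<Prod>i\<in>S. F i) (\<Prod>i\<in>S. G i)"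
  by (induction S rule: infinite_finite_induct) (auto intro: same_upto_mult)

lemma same_upto_power: "same_upto N F G \<Longrightarrow> same_upto N (F ^ e) (G ^ e)"
  by (induction e) (auto intro: same_upto_mult)

lemma same_upto_eval_poly: "(\<And>v. same_upto N (x v) (y v)) \<Longrightarrow> same_upto N (eval_poly \<phi> x f) (eval_poly \<phi> y f)"
  unfolding eval_poly_def by (intro same_upto_sum same_upto_mult same_upto_prod same_upto_power same_upto_refl)

text \<open>Unlike a power series, a polynomial has values at complex numbers, and membership in
  \<open>chart_ideal\<close> is a statement about complex points.\<close>

definition trunc_poly :: "nat \<Rightarrow> complex fps \<Rightarrow> complex poly" where
  "trunc_poly N F = Poly (map (fps_nth F) [0..<Suc N])"

lemma same_upto_trunc: "same_upto N (fps_of_poly (trunc_poly N F)) F"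
  by (auto simp: same_upto_def trunc_poly_def coeff_Poly_eq nth_default_def less_Suc_eq_le simp del: upt_Suc)

locale closed_arc =
  fixes k n :: nat and I :: "nat set" and \<xi> :: "nat \<Rightarrow> complex"
  assumes I: "I \<in> charts k n" and kn: "k < n"
begin

abbreviation "A \<equiv> cm k n I (arcc k n \<xi>)"

lemma I': "I \<subseteq> {..<n}" "card I = k" "finite I"
  using I by (auto simp: charts_def intro: finite_subset)

definition "ccol v = pick ({..<n} - I) (v mod (n - k))"

lemma decode:
  assumes "x < k" "y < n" "y \<notin> I"
  defines "v \<equiv> x * (n - k) + card ({..<y} - I)"
  shows "v < k * (n - k)" "v div (n - k) = x" "ccol v = y"
proof -
  have c: "card ({..<y} - I) < n - k" by (rule card_compl_below(1)[OF I]) (use assms in auto)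
  then show "v < k * (n - k)" using assms by (simp add: coord_index_less)
  show "v div (n - k) = x" "ccol v = y"
    using c kn compl_pick(1)[OF I assms(2,3)] by (simp_all add: v_def ccol_def)
qed

lemma encode:
  assumes "v < k * (n - k)"
  shows "v div (n - k) < k" "ccol v < n" "ccol v \<notin> I" "v div (n - k) * (n - k) + card ({..<ccol v} - I) = v"
proof -
  have "v mod (n - k) < n - k" using kn by simp
  from compl_pick(2)[OF I this] show "ccol v < n" "ccol v \<notin> I" "v div (n - k) * (n - k) + card ({..<ccol v} - I) = v"
    by (auto simp: ccol_def div_mult_mod_eq)
  show "v div (n - k) < k" using assms by (simp add: less_mult_imp_div_less)
qed

lemma A_col: "v < k * (n - k) \<Longrightarrow> A (v div (n - k)) (ccol v) = arcc k n \<xi> v"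
  using encode[of v] by (simp add: cm_def)

context
  fixes a b c :: nat
  assumes ab: "1 \<le> a" "a \<le> k" "1 \<le> b" "b \<le> n - k" and c_def: "c = k - a + b"
begin

text \<open>The minors of the generic chart matrix are functions that vanish on the Schubert
  variety, by \<open>schubert_minor\<close>.\<close>

lemma arc_ord_le: "arc_ord k n (schubert_rect k n a b) (I, ev_ker \<xi>) \<le> dord k c (k - a + 1) A"
  unfolding le_dord_iff
proof (intro allI impI)
  let ?r = "k - a + 1"
  fix f g assume f: "\<forall>i<?r. f i < k" and g: "\<forall>i<?r. g i < c"
  have cn: "c \<le> n" using ab kn by (auto simp: c_def)
  define q where "q = minor ?r f g (cm k n I var)"
  have ev_q: "eval_poly \<phi> x q = minor ?r f g (cm k n I x)" if "comm_ring_hom \<phi>" for \<phi> :: "complex \<Rightarrow> 'r::comm_ring_1" and x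
    unfolding q_def minor_hom[OF comm_ring_hom_eval_poly[OF that]] cm_hom[OF comm_ring_hom_eval_poly[OF that]]
      eval_poly_var[OF that] ..
  have "vars q \<subseteq> {..<k * (n - k)}"
    unfolding q_def
  proof (rule vars_minor)
    fix i j assume "i < ?r" "j < ?r"
    then have "f i < k" "g j < n" using f g cn by (auto intro: order.strict_trans2)
    then show "vars (cm k n I var (f i) (g j)) \<subseteq> {..<k * (n - k)}"
      using card_compl_below(1)[OF I, of "g j"] by (auto simp: cm_def intro!: coord_index_less dest!: subsetD[OF vars_var])
  qed
  moreover have "eval_poly id x q = 0" if "vec_space.row_space n (chart_mat k n I x) \<in> schubert_rect k n a b" for x
  proof -
    interpret complex_chart k n I x by unfold_locales (rule I)
    show ?thesis unfolding ev_q[OF id_hom] by (rule schubert_minor[OF ab c_def kn that f g])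
  qed
  ultimately have "q \<in> chart_ideal k n I (schubert_rect k n a b)" by (simp add: chart_ideal_def)
  then have "arc_ord k n (schubert_rect k n a b) (I, ev_ker \<xi>) \<le> ford (eval_poly fps_const (arcc k n \<xi>) q)"
    unfolding arc_ord_def split_conv ord_mod_ev_ker by (rule INF_lower)
  then show "arc_ord k n (schubert_rect k n a b) (I, ev_ker \<xi>) \<le> ford (minor ?r f g A)"
    unfolding ev_q[OF fps_const_hom] .
qed

text \<open>Holds for every function f vanishing on the variety. The rows below the identity rows in
  the first c columns are put into Smith form, and f is regarded as a function of the set T of
  diagonal entries that are kept. If T has fewer than q elements, the arc lies in the Schubert
  variety and f vanishes; \<open>multiaffine_order\<close> then applies.\<close>

lemma arc_ord_ge: "dord k c (k - a + 1) A \<le> arc_ord k n (schubert_rect k n a b) (I, ev_ker \<xi>)"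
  unfolding arc_ord_def split_conv ord_mod_ev_ker
proof (rule INF_greatest)
  let ?r = "k - a + 1" and ?p = "card (I \<inter> {..<c})"
  fix f assume f: "f \<in> chart_ideal k n I (schubert_rect k n a b)"
  have cn: "c \<le> n" and rc: "?r \<le> c" and rk: "?r \<le> k" using ab kn by (auto simp: c_def)
  show "dord k c ?r A \<le> ford (eval_poly fps_const (arcc k n \<xi>) f)"
  proof (cases "?r \<le> ?p")
    case True
    have pk: "?p \<le> k" using I' card_mono[of I "I \<inter> {..<c}"] by auto
    \<comment> \<open>Enough identity columns lie among the first c, so that one of the minors is
      1.\<close>
    have "minor ?r id (pick I) A = minor ?r id id (diag (\<lambda>_. 0))"
      by (rule minor_cong) (use rk in \<open>auto simp: cm_pick[OF I] diag_def\<close>)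
    also have "\<dots> = 1" unfolding minor_diag by simp
    finally have "ford (minor ?r id (pick I) A) = 0" by simp
    moreover have "dord k c ?r A \<le> ford (minor ?r id (pick I) A)"
    proof (rule dord_le)
      show "pick I l < c" if "l < ?r" for l
        using that True rk I' by (subst pick_lt_iff) auto
    qed (use rk in auto)
    ultimately show ?thesis by simp
  next
    case False
    define q where "q = ?r - ?p"
    have rq: "?r = ?p + q" using False by (simp add: q_def)
    define G where "G x y = A (?p + x) y" for x y
    obtain U U' V V' \<kappa> where "smith_form (k - ?p) c G U U' V V' \<kappa>" using smith_form_exists by blast
    then interpret S: smith_form "k - ?p" c G U U' V V' \<kappa> .
    let ?M = "min (k - ?p) c"
    \<comment> \<open>Bordering a q-minor of G by the identity columns of the first p rows gives a
      minor of A of size p + q with the same value.\<close>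
    have "dord k c ?r A \<le> dord (k - ?p) c q G"
      unfolding le_dord_iff[of _ "k - ?p"]
    proof (intro allI impI)
      fix f g assume f: "\<forall>i<q. f i < k - ?p" and g: "\<forall>i<q. g i < c"
      let ?f = "\<lambda>i. if i < ?p then i else ?p + f (i - ?p)" and ?g = "\<lambda>i. if i < ?p then pick I i else g (i - ?p)"
      have "mat ?r ?r (\<lambda>(i, j). A (?f i) (?g j))
        = four_block_mat (1\<^sub>m ?p) (mat ?p q (\<lambda>(i, j). A i (g j))) (0\<^sub>m q ?p) (mat q q (\<lambda>(i, j). G (f i) (g j)))"
        unfolding rq using rk False by (intro eq_matI) (auto simp: cm_pick[OF I] G_def)
      then have "minor ?r ?f ?g A = det (1\<^sub>m ?p :: complex fps mat) * minor q f g G"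
        unfolding minor_def by (simp only:) (rule det_four_block_mat_lower_left_zero, auto)
      moreover have "dord k c ?r A \<le> ford (minor ?r ?f ?g A)"
      proof (rule dord_le)
        fix i assume i: "i < ?r"
        show "?f i < k"
        proof (cases "i < ?p")
          case False
          then have "f (i - ?p) < k - ?p" using f i rq by simp
          then show ?thesis using False by simp
        qed (use i rk in simp)
        show "?g i < c"
        proof (cases "i < ?p")
          case True
          then show ?thesis using I' i rk by (simp add: pick_lt_iff)
        qed (use i g rq in auto)
      qed
      ultimately show "dord k c ?r A \<le> ford (minor q f g G)" by simp
    qed
    also have "\<dots> = (\<Sum>i<q. \<kappa> i)" by (rule S.dord_eq) (use rk rc in \<open>auto simp: q_def\<close>)
    also have "\<dots> \<le> ford (eval_poly fps_const (arcc k n \<xi>) f)"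
    proof -
      \<comment> \<open>\<open>low\<close> marks the chart coordinates that are entries of G;
        \<open>XT T\<close> keeps in them only the summands of the Smith form with index in
        T.\<close>
      define low where "low v \<longleftrightarrow> ?p \<le> v div (n - k) \<and> ccol v < c" for v
      define XT where "XT T v = (if low v then \<Sum>l\<in>T. U (v div (n - k) - ?p) l * V l (ccol v) * tp (\<kappa> l) else arcc k n \<xi> v)" for T v
      have full: "XT {..<?M} v = arcc k n \<xi> v" if v: "v < k * (n - k)" for v
      proof (cases "low v")
        case True
        have "XT {..<?M} v = (\<Sum>l<?M. U (v div (n - k) - ?p) l * tp (\<kappa> l) * V l (ccol v))"
          using True by (simp add: XT_def mult_ac)
        also have "\<dots> = G (v div (n - k) - ?p) (ccol v)"
          using True encode(1)[OF v] by (intro S.X_eq[symmetric]) (auto simp: low_def)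
        also have "\<dots> = arcc k n \<xi> v" using True A_col[OF v] by (simp add: G_def low_def)
        finally show ?thesis .
      qed (simp add: XT_def)
      have "multiaffine ?M (\<lambda>i. tp (\<kappa> i)) (\<lambda>T. eval_poly fps_const (XT T) f)"
      proof (rule multiaffine_eval_poly)
        fix v
        show "multiaffine ?M (\<lambda>i. tp (\<kappa> i)) (\<lambda>T. XT T v)"
          unfolding XT_def by (cases "low v") (simp_all add: multiaffine_linear multiaffine_const)
      qed
      moreover have "eval_poly fps_const (XT T) f = 0" if T: "T \<subseteq> {..<?M}" "card T < q" for T
      proof (rule fps_ext)
        fix N
        have finT: "finite T" using T finite_subset by blast
        \<comment> \<open>The coefficient of t^N depends only on coefficients up to N, so the series
          may be truncated; then t can be replaced by any complex number \<tau>, which gives a point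
          of the Schubert variety.\<close>
        define P where "P v = (if low v then \<Sum>l\<in>T. trunc_poly N (U (v div (n - k) - ?p) l) * trunc_poly N (V l (ccol v)) * trunc_poly N (tp (\<kappa> l))
          else trunc_poly N (arcc k n \<xi> v))" for v
        have P_XT: "same_upto N (fps_of_poly (P v)) (XT T v)" for v
          unfolding P_def XT_def
          by (auto simp: fps_of_poly_sum fps_of_poly_mult intro!: same_upto_sum same_upto_mult same_upto_trunc)
        have pc_hom: "comm_ring_hom (\<lambda>c :: complex. [:c:])"
          by unfold_locales (simp_all add: one_pCons)
        have "poly (eval_poly (\<lambda>c. [:c:]) P f) \<tau> = 0" for \<tau>
        proof -
          have "comm_ring_hom (\<lambda>p. poly p \<tau>)" by unfold_locales simp_all
          from hom_eval_poly[OF this, of "\<lambda>c. [:c:]" P f]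
          have "poly (eval_poly (\<lambda>c. [:c:]) P f) \<tau> = eval_poly id (\<lambda>v. poly (P v) \<tau>) f" by (simp add: id_def)
          also have "\<dots> = 0"
          proof -
            interpret complex_chart k n I "\<lambda>v. poly (P v) \<tau>" by unfold_locales (rule I)
            have "vec_space.row_space n (chart_mat k n I (\<lambda>v. poly (P v) \<tau>)) \<in> schubert_rect k n a b"
            proof (rule schubert_memI[OF ab c_def kn finT,
                where u = "\<lambda>l x. poly (trunc_poly N (U (x - ?p) l)) \<tau>" and v = "\<lambda>l y. poly (trunc_poly N (V l y)) \<tau> * poly (trunc_poly N (tp (\<kappa> l))) \<tau>"])
              show "?p + card T \<le> k - a" using T(2) rq by simp
              fix x y assume xy: "?p \<le> x" "x < k" "y < c" "y \<notin> I"
              then have "y < n" using cn by simp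
              note d = decode[OF xy(2) this xy(4)]
              show "cm k n I (\<lambda>v. poly (P v) \<tau>) x y
                = (\<Sum>i\<in>T. poly (trunc_poly N (U (x - ?p) i)) \<tau> * (poly (trunc_poly N (V i y)) \<tau> * poly (trunc_poly N (tp (\<kappa> i))) \<tau>))"
                using xy d by (simp add: cm_def P_def low_def poly_sum mult.assoc)
            qed
            then show ?thesis using f by (auto simp: chart_ideal_def)
          qed
          finally show ?thesis .
        qed
        then have "eval_poly (\<lambda>c. [:c:]) P f = 0" by (simp add: poly_all_0_iff_0[symmetric])
        then have "fps_of_poly (eval_poly (\<lambda>c. [:c:]) P f) = 0" by simp
        moreover have "comm_ring_hom (fps_of_poly :: complex poly \<Rightarrow> complex fps)"
          by unfold_locales (simp_all add: fps_of_poly_add fps_of_poly_mult)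
        ultimately have "eval_poly fps_const (\<lambda>v. fps_of_poly (P v)) f = 0"
          using hom_eval_poly[of fps_of_poly "\<lambda>c. [:c:]" P f] by (simp add: fps_of_poly_const)
        moreover have "same_upto N (eval_poly fps_const (\<lambda>v. fps_of_poly (P v)) f) (eval_poly fps_const (XT T) f)"
          by (rule same_upto_eval_poly) (rule P_XT)
        ultimately show "fps_nth (eval_poly fps_const (XT T) f) N = fps_nth 0 N" by (simp add: same_upto_def)
      qed
      ultimately have "(\<Sum>i<q. \<kappa> i) \<le> ford (eval_poly fps_const (XT {..<?M}) f)"
        using S.mono by (intro multiaffine_order)
      also have "eval_poly fps_const (XT {..<?M}) f = eval_poly fps_const (arcc k n \<xi>) f"
        using f by (intro eval_poly_cong full) (auto simp: chart_ideal_def)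
      finally show ?thesis .
    qed
    finally show ?thesis .
  qed
qed

end

lemma schubert_ord_closed:
  "i \<in> {1..k} \<Longrightarrow> j \<in> {1..n - k} \<Longrightarrow> schubert_ord k n (I, ev_ker \<xi>) i j = dord k (k - i + j) (k - i + 1) A"
  using arc_ord_le[of i j "k - i + j"] arc_ord_ge[of i j "k - i + j"] by (simp add: schubert_ord_def)

lemma A_pick_unit: "minor k id (pick I) A = 1"
proof -
  have "minor k id (pick I) A = minor k id id (diag (\<lambda>_. 0))"
    by (rule minor_cong) (auto simp: cm_pick[OF I] diag_def)
  also have "\<dots> = 1" unfolding minor_diag by simp
  finally show ?thesis .
qed

lemma dord_full: "dord k n k A = 0"
proof -
  have "ford (minor k id (pick I) A) = 0" by (simp add: A_pick_unit)
  moreover have "dord k n k A \<le> ford (minor k id (pick I) A)"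
    using pick_mem[of I] I' by (intro dord_le) auto
  ultimately show ?thesis by simp
qed

text \<open>An arc in the Grassmannian has a unit k-minor, and each deleted column costs at most one
  in size, by \<open>dord_Suc_ge\<close>.\<close>

lemma dord_deleted: "i \<le> k \<Longrightarrow> dord k (n - i) (k - i) A = 0"
proof (induction i)
  case (Suc i)
  then show ?case using dord_Suc_ge[of k "n - Suc i" "k - Suc i" A] kn by (simp add: Suc_diff_Suc)
qed (use dord_full in simp)

lemma (in -) sum_enat_infinity:
  fixes f :: "'a \<Rightarrow> enat"
  shows "finite S \<Longrightarrow> sum f S = \<infinity> \<Longrightarrow> \<exists>x\<in>S. f x = \<infinity>"
  by (induction S rule: finite_induct) (auto simp: plus_eq_infty_iff_enat)

lemma profile_closed:
  assumes ij: "i \<in> {1..k}" "j \<in> {1..n - k}" and mono: "mono \<kappa>"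
    and type: "\<And>l. l \<le> min k (k - i + j) \<Longrightarrow> dord k (k - i + j) l A = (\<Sum>x<l. \<kappa> x)"
  shows "profile k n (I, ev_ker \<xi>) i j = \<kappa> (k - i)"
proof -
  let ?s = "\<Sum>x<k - i. \<kappa> x"
  have 1: "schubert_ord k n (I, ev_ker \<xi>) i j = ?s + \<kappa> (k - i)"
    unfolding schubert_ord_closed[OF ij] using ij by (subst type) auto
  have 2: "schubert_ord k n (I, ev_ker \<xi>) (i + 1) (j + 1) = ?s"
  proof (cases "i + 1 \<le> k \<and> j + 1 \<le> n - k")
    case True
    then have e: "k - (i + 1) + (j + 1) = k - i + j" "k - (i + 1) + 1 = k - i" by arith+
    have "schubert_ord k n (I, ev_ker \<xi>) (i + 1) (j + 1) = dord k (k - i + j) (k - i) A"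
      by (rule schubert_ord_closed[of "i + 1" "j + 1", unfolded e]) (use True in auto)
    also have "\<dots> = ?s" by (rule type) (use ij in auto)
    finally show ?thesis .
  next
    \<comment> \<open>Outside the rectangle the order is 0 by convention, and the sum agrees with
      it: it is empty for i = k, and for j = n - k the first n - i columns still have a unit minor
      of size k - i.\<close>
    case False
    have "?s = 0"
    proof (cases "i = k")
      case i: False
      then have "k - i + j = n - i" using False ij kn by auto
      then have "?s = dord k (n - i) (k - i) A" using type[of "k - i"] ij by simp
      then show ?thesis using dord_deleted[of i] ij by simp
    qed simp
    then show ?thesis using False by (auto simp: schubert_ord_def)
  qed
  \<comment> \<open>By monotonicity an infinite partial sum forces the next exponent to be infinite,
    in accordance with \<infinity> - \<infinity> = \<infinity>.\<close>
  have "?s = \<infinity> \<Longrightarrow> \<kappa> (k - i) = \<infinity>"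
  proof -
    assume "?s = \<infinity>"
    then obtain x where "x < k - i" "\<kappa> x = \<infinity>" using sum_enat_infinity[of "{..<k - i}" \<kappa>] by auto
    then show ?thesis using monoD[OF mono, of x "k - i"] by simp
  qed
  then have "?s + \<kappa> (k - i) - ?s = \<kappa> (k - i)" by (cases ?s; cases "\<kappa> (k - i)") auto
  then show ?thesis unfolding profile_def 1 2 .
qed

end

section \<open>Normalization in a chart\<close>

text \<open>The formula of \<open>transition_mat\<close> over a general ring; it serves both for
  power series over the field of fractions and for complex power series.\<close>

definition ncoord :: "nat \<Rightarrow> nat \<Rightarrow> nat set \<Rightarrow> 'r::{comm_ring_1,inverse} mat \<Rightarrow> nat \<Rightarrow> 'r" where
  "ncoord k n J M v = (let S = submatrix M UNIV J in
     (inverse (det S) \<cdot>\<^sub>m (adj_mat S * M)) $$ (v div (n - k), pick ({..<n} - J) (v mod (n - k))))"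

lemma submatrix_chart:
  assumes "J \<in> charts k n" "M \<in> carrier_mat k n"
  shows "submatrix M UNIV J = mat k k (\<lambda>(a, b). M $$ (a, pick J b))"
proof -
  have J: "J \<subseteq> {..<n}" "card J = k" using assms by (auto simp: charts_def)
  have "{j. j < n \<and> j \<in> J} = J" using J by auto
  then show ?thesis unfolding submatrix_def using J assms by (auto simp: pick_UNIV intro!: eq_matI)
qed

lemma normalize:
  fixes M :: "'r::{comm_ring_1,inverse} mat"
  assumes J: "J \<in> charts k n" and M: "M \<in> carrier_mat k n" and kn: "k < n"
    and inv: "inverse (det (submatrix M UNIV J)) * det (submatrix M UNIV J) = 1"
    and iy: "i < k" "y < n"
  shows "cm k n J (ncoord k n J M) i y = (inverse (det (submatrix M UNIV J)) \<cdot>\<^sub>m (adj_mat (submatrix M UNIV J) * M)) $$ (i, y)"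
proof -
  let ?S = "submatrix M UNIV J"
  have S: "?S = mat k k (\<lambda>(a, b). M $$ (a, pick J b))" by (rule submatrix_chart[OF J M])
  have Sc: "?S \<in> carrier_mat k k" unfolding S by simp
  have J': "J \<subseteq> {..<n}" "card J = k" "finite J" using J by (auto simp: charts_def intro: finite_subset)
  show ?thesis
  proof (cases "y \<in> J")
    case True
    let ?b = "card (J \<inter> {..<y})"
    have "J \<inter> {..<y} \<subset> J" using True by auto
    then have b: "?b < k" using J' psubset_card_mono[of J "J \<inter> {..<y}"] by auto
    have yb: "pick J ?b = y" by (rule pick_card_below[OF True])
    have "(adj_mat ?S * M) $$ (i, y) = (adj_mat ?S * ?S) $$ (i, ?b)"
      using iy b M adj_mat(1)[OF Sc] Sc by (simp add: scalar_prod_def) (simp add: S yb)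
    also have "\<dots> = det ?S * (if ?b = i then 1 else 0)"
      unfolding adj_mat(3)[OF Sc] using iy b by auto
    finally show ?thesis using True iy M adj_mat(1)[OF Sc] inv
      by (simp add: cm_def mult.assoc[symmetric])
  next
    case False
    have c: "card ({..<y} - J) < n - k" using card_compl_below(1)[OF J, of y] False iy by simp
    then show ?thesis using False compl_pick(1)[OF J iy(2) False] by (simp add: cm_def ncoord_def Let_def)
  qed
qed

definition fun_mat :: "nat \<Rightarrow> nat \<Rightarrow> (nat \<Rightarrow> nat \<Rightarrow> 'a) \<Rightarrow> 'a mat" where
  "fun_mat k n B = mat k n (\<lambda>(i, j). B i j)"

text \<open>The closed point, in the chart J, of the arc spanned by the rows of B, provided the
  minor of B in the columns J is a unit.\<close>

definition npoint :: "nat \<Rightarrow> nat \<Rightarrow> nat set \<Rightarrow> (nat \<Rightarrow> nat \<Rightarrow> complex fps) \<Rightarrow> nat \<Rightarrow> complex" where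
  "npoint k n J B w = fps_nth (ncoord k n J (fun_mat k n B) (w mod (k * (n - k)))) (w div (k * (n - k)))"

lemma arcc_npoint: "v < k * (n - k) \<Longrightarrow> arcc k n (npoint k n J B) v = ncoord k n J (fun_mat k n B) v"
proof (rule fps_ext)
  fix m
  have "(m * K + v) div K = m \<and> (m * K + v) mod K = v" if "v < K" for K
    using that by (cases "K = 0") auto
  moreover assume "v < k * (n - k)"
  ultimately have "(m * (k * (n - k)) + v) div (k * (n - k)) = m" "(m * (k * (n - k)) + v) mod (k * (n - k)) = v" by blast+
  then show "fps_nth (arcc k n (npoint k n J B) v) m = fps_nth (ncoord k n J (fun_mat k n B) v) m"
    unfolding arcc_def npoint_def fps_nth_Abs_fps by (simp only:)
qed

lemma index_mult_sum:
  assumes "X \<in> carrier_mat a m" "Y \<in> carrier_mat m b" "i < a" "j < b"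
  shows "(X * Y) $$ (i, j) = (\<Sum>l<m. X $$ (i, l) * Y $$ (l, j))"
  using assms by (simp add: scalar_prod_def atLeast0LessThan)

text \<open>Normalization multiplies from the left by an invertible matrix, so no order changes in
  either direction.\<close>

lemma dord_npoint:
  assumes J: "J \<in> charts k n" and kn: "k < n"
    and unit: "fps_nth (minor k id (pick J) B) 0 \<noteq> 0" and c: "c \<le> n"
  shows "dord k c j (cm k n J (arcc k n (npoint k n J B))) = dord k c j B"
proof -
  let ?M = "fun_mat k n B" and ?N = "cm k n J (arcc k n (npoint k n J B))"
  let ?S = "submatrix ?M UNIV J"
  have M: "?M \<in> carrier_mat k n" by (simp add: fun_mat_def)
  have J': "J \<subseteq> {..<n}" "card J = k" "finite J" using J by (auto simp: charts_def intro: finite_subset)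
  have pJ: "pick J b < n" if "b < k" for b using pick_mem[of J b] J' that by auto
  have S: "?S = mat k k (\<lambda>(a, b). B a (pick J b))"
    unfolding submatrix_chart[OF J M] by (rule eq_matI) (auto simp: fun_mat_def pJ)
  have Sc: "?S \<in> carrier_mat k k" unfolding S by simp
  have d: "det ?S = minor k id (pick J) B" unfolding S minor_def by simp
  have inv: "inverse (det ?S) * det ?S = 1" using unit by (intro inverse_mult_eq_1) (simp add: d)
  let ?L = "inverse (det ?S) \<cdot>\<^sub>m adj_mat ?S"
  have N: "?N i y = (?L * ?M) $$ (i, y)" if "i < k" "y < n" for i y
  proof -
    have "?N i y = cm k n J (ncoord k n J ?M) i y" by (rule cm_cong[OF J that]) (rule arcc_npoint)
    also have "\<dots> = (inverse (det ?S) \<cdot>\<^sub>m (adj_mat ?S * ?M)) $$ (i, y)" by (rule normalize[OF J M kn inv that])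
    also have "inverse (det ?S) \<cdot>\<^sub>m (adj_mat ?S * ?M) = ?L * ?M"
      by (rule mult_smult_assoc_mat[OF adj_mat(1)[OF Sc] M, symmetric])
    finally show ?thesis .
  qed
  have Lc: "?L \<in> carrier_mat k k" using adj_mat(1)[OF Sc] by simp
  have "?S * (?L * ?M) = ?M"
  proof -
    have "?S * (?L * ?M) = (?S * ?L) * ?M" by (rule assoc_mult_mat[OF Sc Lc M, symmetric])
    also have "?S * ?L = inverse (det ?S) \<cdot>\<^sub>m (?S * adj_mat ?S)" by (rule mult_smult_distrib[OF Sc adj_mat(1)[OF Sc]])
    also have "\<dots> = (inverse (det ?S) * det ?S) \<cdot>\<^sub>m 1\<^sub>m k" unfolding adj_mat(2)[OF Sc] by (rule eq_matI) auto
    also have "\<dots> = 1\<^sub>m k" unfolding inv by (rule eq_matI) auto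
    finally show ?thesis using M by simp
  qed
  then have B: "B i y = (\<Sum>l<k. ?S $$ (i, l) * ?N l y)" if "i < k" "y < n" for i y
  proof -
    have "B i y = (?S * (?L * ?M)) $$ (i, y)" using \<open>?S * (?L * ?M) = ?M\<close> that by (simp add: fun_mat_def)
    also have "\<dots> = (\<Sum>l<k. ?S $$ (i, l) * (?L * ?M) $$ (l, y))"
      by (rule index_mult_sum[OF Sc mult_carrier_mat[OF Lc M] that])
    finally show ?thesis using that by (simp add: N)
  qed
  have N': "?N i y = (\<Sum>l<k. ?L $$ (i, l) * B l y)" if "i < k" "y < n" for i y
    unfolding N[OF that] index_mult_sum[OF Lc M that] using that by (simp add: fun_mat_def)
  show ?thesis
  proof (rule antisym)
    show "dord k c j ?N \<le> dord k c j B"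
      by (rule dord_mult_left[where L = "\<lambda>i l. ?S $$ (i, l)"]) (rule B, use c in auto)
    show "dord k c j B \<le> dord k c j ?N"
      by (rule dord_mult_left[where L = "\<lambda>i l. ?L $$ (i, l)"]) (rule N', use c in auto)
  qed
qed

section \<open>Gluing\<close>

lemma submatrix_fun_mat:
  assumes J: "J \<in> charts k n"
  shows "submatrix (fun_mat k n B) UNIV J = mat k k (\<lambda>(a, b). B a (pick J b))"
proof -
  have J': "J \<subseteq> {..<n}" "card J = k" "finite J" using J by (auto simp: charts_def intro: finite_subset)
  have pJ: "pick J b < n" if "b < k" for b using pick_mem[of J b] J' that by auto
  have "fun_mat k n B \<in> carrier_mat k n" by (simp add: fun_mat_def)
  then show ?thesis
    unfolding submatrix_chart[OF J \<open>fun_mat k n B \<in> carrier_mat k n\<close>] by (intro eq_matI) (auto simp: fun_mat_def pJ)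
qed

text \<open>Cramer's rule written out, so that regularity at a closed point and continuity in a
  parameter can be verified factor by factor.\<close>

lemma ncoord_eq:
  fixes B :: "nat \<Rightarrow> nat \<Rightarrow> 'r::{comm_ring_1,inverse}"
  assumes J: "J \<in> charts k n" and kn: "k < n" and v: "v < k * (n - k)"
  defines "i \<equiv> v div (n - k)" and "y \<equiv> pick ({..<n} - J) (v mod (n - k))"
  shows "i < k" "y < n"
    "ncoord k n J (fun_mat k n B) v = inverse (minor k id (pick J) B) * (\<Sum>l<k. (- 1) ^ (l + i) *
      minor (k - 1) (\<lambda>a. if a < l then a else Suc a) (\<lambda>b. pick J (if b < i then b else Suc b)) B * B l y)"
proof -
  let ?S = "mat k k (\<lambda>(a, b). B a (pick J b))" and ?M = "fun_mat k n B"
  show i: "i < k" using v by (simp add: i_def less_mult_imp_div_less)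
  show y: "y < n" using compl_pick(2)[OF J, of "v mod (n - k)"] kn by (simp add: y_def)
  have M: "?M \<in> carrier_mat k n" by (simp add: fun_mat_def)
  have Sc: "?S \<in> carrier_mat k k" by simp
  have A: "adj_mat ?S \<in> carrier_mat k k" by (rule adj_mat(1)[OF Sc])
  have "ncoord k n J ?M v = (inverse (det ?S) \<cdot>\<^sub>m (adj_mat ?S * ?M)) $$ (i, y)"
    by (simp add: ncoord_def submatrix_fun_mat[OF J] i_def y_def Let_def)
  also have "\<dots> = inverse (det ?S) * (\<Sum>l<k. adj_mat ?S $$ (i, l) * ?M $$ (l, y))"
    using A M i y index_mult_sum[OF A M i y] by simp
  also have "det ?S = minor k id (pick J) B" by (simp add: minor_def)
  also have "(\<Sum>l<k. adj_mat ?S $$ (i, l) * ?M $$ (l, y)) = (\<Sum>l<k. (- 1) ^ (l + i) *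
      minor (k - 1) (\<lambda>a. if a < l then a else Suc a) (\<lambda>b. pick J (if b < i then b else Suc b)) B * B l y)"
  proof (rule sum.cong[OF refl])
    fix l assume "l \<in> {..<k}"
    then have l: "l < k" by simp
    have "mat_delete ?S l i = mat (k - 1) (k - 1) (\<lambda>(a, b). B (if a < l then a else Suc a) (pick J (if b < i then b else Suc b)))"
      unfolding mat_delete_def using l i by (intro eq_matI) auto
    then have "det (mat_delete ?S l i) = minor (k - 1) (\<lambda>a. if a < l then a else Suc a) (\<lambda>b. pick J (if b < i then b else Suc b)) B"
      by (simp only: minor_def)
    then show "adj_mat ?S $$ (i, l) * ?M $$ (l, y) = (- 1) ^ (l + i) *
      minor (k - 1) (\<lambda>a. if a < l then a else Suc a) (\<lambda>b. pick J (if b < i then b else Suc b)) B * B l y"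
      using l i y by (simp add: adj_mat_def cofactor_def fun_mat_def)
  qed
  finally show "ncoord k n J (fun_mat k n B) v = inverse (minor k id (pick J) B) * (\<Sum>l<k. (- 1) ^ (l + i) *
      minor (k - 1) (\<lambda>a. if a < l then a else Suc a) (\<lambda>b. pick J (if b < i then b else Suc b)) B * B l y)" .
qed

text \<open>The fraction \<open>u\<close> is defined at the closed point \<open>\<xi>\<close> and has the value \<open>c\<close> there.\<close>

definition ratio :: "(nat \<Rightarrow> complex) \<Rightarrow> cpoly fract \<Rightarrow> complex \<Rightarrow> bool" where
  "ratio \<xi> u c \<longleftrightarrow> (\<exists>p q. u = Fract p q \<and> ev \<xi> q \<noteq> 0 \<and> c * ev \<xi> q = ev \<xi> p)"

lemma ratio_Fract: "ratio \<xi> (Fract p 1) (ev \<xi> p)"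
  unfolding ratio_def by (intro exI[of _ p] exI[of _ 1]) simp

lemma ratio_0: "ratio \<xi> 0 0" using ratio_Fract[of \<xi> 0] by (simp add: Zero_fract_def)

lemma ratio_1: "ratio \<xi> 1 1" using ratio_Fract[of \<xi> 1] by (simp add: One_fract_def)

lemma ratioE:
  assumes "ratio \<xi> u c"
  obtains p q where "u = Fract p q" "q \<noteq> 0" "ev \<xi> q \<noteq> 0" "c * ev \<xi> q = ev \<xi> p"
proof -
  obtain p q where "u = Fract p q" "ev \<xi> q \<noteq> 0" "c * ev \<xi> q = ev \<xi> p" using assms by (auto simp: ratio_def)
  moreover have "q \<noteq> 0" using \<open>ev \<xi> q \<noteq> 0\<close> by auto
  ultimately show ?thesis by (intro that)
qed

lemma ratio_add: "ratio \<xi> u c \<Longrightarrow> ratio \<xi> u' c' \<Longrightarrow> ratio \<xi> (u + u') (c + c')"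
proof (elim ratioE)
  fix p q p' q' assume *: "u = Fract p q" "q \<noteq> 0" "ev \<xi> q \<noteq> 0" "c * ev \<xi> q = ev \<xi> p"
    "u' = Fract p' q'" "q' \<noteq> 0" "ev \<xi> q' \<noteq> 0" "c' * ev \<xi> q' = ev \<xi> p'"
  show ?thesis unfolding ratio_def
    by (rule exI[of _ "p * q' + p' * q"], rule exI[of _ "q * q'"])
      (use *(1-3,5-7) in \<open>simp add: *(4,8)[symmetric] algebra_simps\<close>)
qed

lemma ratio_mult: "ratio \<xi> u c \<Longrightarrow> ratio \<xi> u' c' \<Longrightarrow> ratio \<xi> (u * u') (c * c')"
proof (elim ratioE)
  fix p q p' q' assume *: "u = Fract p q" "q \<noteq> 0" "ev \<xi> q \<noteq> 0" "c * ev \<xi> q = ev \<xi> p"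
    "u' = Fract p' q'" "q' \<noteq> 0" "ev \<xi> q' \<noteq> 0" "c' * ev \<xi> q' = ev \<xi> p'"
  show ?thesis unfolding ratio_def
    by (rule exI[of _ "p * p'"], rule exI[of _ "q * q'"])
      (use *(1-3,5-7) in \<open>simp add: *(4,8)[symmetric] algebra_simps\<close>)
qed

lemma ratio_inverse: "ratio \<xi> u c \<Longrightarrow> c \<noteq> 0 \<Longrightarrow> ratio \<xi> (inverse u) (inverse c)"
proof (elim ratioE)
  fix p q assume *: "c \<noteq> 0" "u = Fract p q" "q \<noteq> 0" "ev \<xi> q \<noteq> 0" "c * ev \<xi> q = ev \<xi> p"
  show ?thesis unfolding ratio_def
    by (rule exI[of _ q], rule exI[of _ p]) (use *(1-4) in \<open>simp add: *(5)[symmetric]\<close>)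
qed

lemma ratio_uminus: "ratio \<xi> u c \<Longrightarrow> ratio \<xi> (- u) (- c)"
proof (elim ratioE)
  fix p q assume *: "u = Fract p q" "q \<noteq> 0" "ev \<xi> q \<noteq> 0" "c * ev \<xi> q = ev \<xi> p"
  interpret comm_ring_hom "ev \<xi>" by (rule ev_hom)
  have "ev \<xi> (- p) = - ev \<xi> p" using ev_add[of \<xi> "- p" p] by (simp add: eq_neg_iff_add_eq_0)
  then show ?thesis unfolding ratio_def
    by (intro exI[of _ "- p"] exI[of _ q]) (use *(1-3) in \<open>simp add: *(4)[symmetric]\<close>)
qed

lemma ratio_sum: "(\<And>i. i \<in> S \<Longrightarrow> ratio \<xi> (f i) (g i)) \<Longrightarrow> ratio \<xi> (\<Sum>i\<in>S. f i) (\<Sum>i\<in>S. g i)"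
  by (induction S rule: infinite_finite_induct) (auto intro: ratio_add ratio_0)

lemma ratio_prod: "(\<And>i. i \<in> S \<Longrightarrow> ratio \<xi> (f i) (g i)) \<Longrightarrow> ratio \<xi> (\<Prod>i\<in>S. f i) (\<Prod>i\<in>S. g i)"
  by (induction S rule: infinite_finite_induct) (auto intro: ratio_mult ratio_1)

lemma ratio_power: "ratio \<xi> u c \<Longrightarrow> ratio \<xi> (u ^ e) (c ^ e)"
  by (induction e) (auto intro: ratio_mult ratio_1)

definition fratio :: "(nat \<Rightarrow> complex) \<Rightarrow> cpoly fract fps \<Rightarrow> complex fps \<Rightarrow> bool" where
  "fratio \<xi> F G \<longleftrightarrow> (\<forall>m. ratio \<xi> (fps_nth F m) (fps_nth G m))"

lemma fratio_mult: "fratio \<xi> F G \<Longrightarrow> fratio \<xi> F' G' \<Longrightarrow> fratio \<xi> (F * F') (G * G')"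
  unfolding fratio_def fps_mult_nth by (intro allI ratio_sum ratio_mult) simp_all

lemma fratio_uminus: "fratio \<xi> F G \<Longrightarrow> fratio \<xi> (- F) (- G)"
  by (simp add: fratio_def ratio_uminus)

lemma fratio_0: "fratio \<xi> 0 0" by (simp add: fratio_def ratio_0)

lemma fratio_1: "fratio \<xi> 1 1" by (simp add: fratio_def ratio_0 ratio_1)

lemma fratio_add: "fratio \<xi> F G \<Longrightarrow> fratio \<xi> F' G' \<Longrightarrow> fratio \<xi> (F + F') (G + G')"
  by (simp add: fratio_def ratio_add)

lemma fratio_sum: "(\<And>i. i \<in> S \<Longrightarrow> fratio \<xi> (f i) (g i)) \<Longrightarrow> fratio \<xi> (\<Sum>i\<in>S. f i) (\<Sum>i\<in>S. g i)"
  by (induction S rule: infinite_finite_induct) (auto intro: fratio_add fratio_0)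

lemma fratio_prod: "(\<And>i. i \<in> S \<Longrightarrow> fratio \<xi> (f i) (g i)) \<Longrightarrow> fratio \<xi> (\<Prod>i\<in>S. f i) (\<Prod>i\<in>S. g i)"
  by (induction S rule: infinite_finite_induct) (auto intro: fratio_mult fratio_1)

lemma fratio_sign: "fratio \<xi> ((- 1) ^ e) ((- 1) ^ e)"
  by (induction e) (auto intro: fratio_mult fratio_1 fratio_uminus)

lemma fratio_minor:
  assumes "\<And>a b. a < j \<Longrightarrow> b < j \<Longrightarrow> fratio \<xi> (X (f a) (g b)) (Y (f a) (g b))"
  shows "fratio \<xi> (minor j f g X) (minor j f g Y)"
  unfolding minor_def det_mat_Leibniz
proof (rule fratio_sum)
  fix p assume p: "p \<in> {p. p permutes {0..<j}}"
  have "fratio \<xi> (\<Prod>i = 0..<j. X (f i) (g (p i))) (\<Prod>i = 0..<j. Y (f i) (g (p i)))"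
    using permutes_in_image[of p "{0..<j}"] p by (intro fratio_prod assms) auto
  then show "fratio \<xi> (signof p * (\<Prod>i = 0..<j. X (f i) (g (p i)))) (signof p * (\<Prod>i = 0..<j. Y (f i) (g (p i))))"
    by (cases p rule: sign_cases) (simp_all add: fratio_uminus)
qed

text \<open>The recursion for the coefficients of the inverse divides only by the constant
  coefficient, which does not vanish at \<xi>.\<close>

lemma fratio_inverse:
  assumes F: "fratio \<xi> F G" and G: "fps_nth G 0 \<noteq> 0"
  shows "fratio \<xi> (inverse F) (inverse G)"
  unfolding fratio_def
proof
  fix N
  have c: "ratio \<xi> (fps_nth F m) (fps_nth G m)" for m using F by (simp add: fratio_def)
  have i: "ratio \<xi> (inverse (fps_nth F 0)) (inverse (fps_nth G 0))" by (rule ratio_inverse[OF c G])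
  show "ratio \<xi> (fps_nth (inverse F) N) (fps_nth (inverse G) N)"
  proof (induction N rule: less_induct)
    case (less N)
    show ?case
    proof (cases N)
      case 0
      then show ?thesis using i by simp
    next
      case (Suc m)
      have F': "fps_nth (inverse F) N = - inverse (fps_nth F 0) * (\<Sum>i = 1..N. fps_nth F i * fps_nth (inverse F) (N - i))"
        unfolding Suc by (simp add: fps_inverse_def)
      have G': "fps_nth (inverse G) N = - inverse (fps_nth G 0) * (\<Sum>i = 1..N. fps_nth G i * fps_nth (inverse G) (N - i))"
        unfolding Suc by (simp add: fps_inverse_def)
      show ?thesis unfolding F' G'
        by (intro ratio_mult ratio_uminus i ratio_sum c less.IH) auto
    qed
  qed
qed

lemma fratio_ncoord:
  assumes J: "J \<in> charts k n" and kn: "k < n" and v: "v < k * (n - k)"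
    and XB: "\<And>x y. x < k \<Longrightarrow> y < n \<Longrightarrow> fratio \<xi> (X x y) (B x y)"
    and unit: "fps_nth (minor k id (pick J) B) 0 \<noteq> 0"
  shows "fratio \<xi> (ncoord k n J (fun_mat k n X) v) (ncoord k n J (fun_mat k n B) v)"
proof -
  note e = ncoord_eq[OF J kn v]
  have J': "J \<subseteq> {..<n}" "card J = k" "finite J" using J by (auto simp: charts_def intro: finite_subset)
  have pJ: "pick J b < n" if "b < k" for b using pick_mem[of J b] J' that by auto
  show ?thesis unfolding e(3)
    by (intro fratio_mult fratio_inverse fratio_sum fratio_sign fratio_minor XB unit)
      (use e(1,2) pJ in \<open>auto simp del: pick.simps\<close>)
qed

lemma Fract_hom: "comm_ring_hom (\<lambda>p :: cpoly. Fract p 1)"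
  by unfold_locales (simp_all add: One_fract_def Zero_fract_def)

definition umat :: "nat \<Rightarrow> nat \<Rightarrow> nat set \<Rightarrow> nat \<Rightarrow> nat \<Rightarrow> cpoly fract fps" where
  "umat k n I = cm k n I (\<lambda>v. fmap (\<lambda>p. Fract p 1) (universal_coord k n v))"

lemma transition_hom_eq:
  "transition_hom k n I J = eval_poly (\<lambda>c. Fract (const c) 1)
    (\<lambda>w. fps_nth (ncoord k n J (fun_mat k n (umat k n I)) (w mod (k * (n - k)))) (w div (k * (n - k))))"
proof -
  have "map_mat (\<lambda>g. Abs_fps (\<lambda>m. Fract (fps_nth g m) 1)) (universal_arc k n I) = fun_mat k n (umat k n I)"
    unfolding universal_arc_def chart_mat_cm fun_mat_def umat_def cm_hom[OF fmap_hom[OF Fract_hom], symmetric]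
    by (rule eq_matI) (auto simp: fmap_def)
  then show ?thesis
    unfolding transition_hom_def transition_mat_def ncoord_def Let_def by simp
qed

lemma fmap_ev_universal: "fmap (ev \<xi>) (universal_coord k n v) = arcc k n \<xi> v"
  by (rule fps_ext) (simp add: universal_coord_def arcc_def)

lemma ev_transition_minor:
  assumes "J \<in> charts k n"
  shows "ev \<xi> (transition_minor k n I J) = fps_nth (minor k id (pick J) (cm k n I (arcc k n \<xi>))) 0"
proof -
  have "universal_arc k n I = fun_mat k n (cm k n I (universal_coord k n))"
    by (simp add: universal_arc_def chart_mat_cm fun_mat_def)
  then have "transition_minor k n I J = fps_nth (minor k id (pick J) (cm k n I (universal_coord k n))) 0"
    unfolding transition_minor_def by (simp add: submatrix_fun_mat[OF assms] minor_def)
  then have "ev \<xi> (transition_minor k n I J) = fps_nth (fmap (ev \<xi>) (minor k id (pick J) (cm k n I (universal_coord k n)))) 0"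
    by simp
  then show ?thesis
    unfolding minor_hom[OF fmap_hom[OF ev_hom]] cm_hom[OF fmap_hom[OF ev_hom]] fmap_ev_universal .
qed

text \<open>At a closed point of the overlap the transition map amounts to evaluation at the
  normalized arc.\<close>

lemma ratio_transition:
  assumes I: "I \<in> charts k n" and J: "J \<in> charts k n" and kn: "0 < k" "k < n"
    and unit: "ev \<xi> (transition_minor k n I J) \<noteq> 0"
  shows "ratio \<xi> (transition_hom k n I J g) (ev (npoint k n J (cm k n I (arcc k n \<xi>))) g)"
proof -
  let ?B = "cm k n I (arcc k n \<xi>)" and ?K = "k * (n - k)"
  have XB: "fratio \<xi> (umat k n I x y) (?B x y)" for x y
  proof -
    have "umat k n I x y = fmap (\<lambda>p. Fract p 1) (cm k n I (universal_coord k n) x y)"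
      unfolding umat_def cm_hom[OF fmap_hom[OF Fract_hom]] ..
    moreover have "?B x y = fmap (ev \<xi>) (cm k n I (universal_coord k n) x y)"
      unfolding cm_hom[OF fmap_hom[OF ev_hom]] fmap_ev_universal ..
    ultimately show ?thesis by (simp add: fratio_def ratio_Fract)
  qed
  have "ratio \<xi> (fps_nth (ncoord k n J (fun_mat k n (umat k n I)) (w mod ?K)) (w div ?K)) (npoint k n J ?B w)" for w
  proof -
    have "w mod ?K < ?K" using kn by simp
    from fratio_ncoord[OF J kn(2) this XB unit[unfolded ev_transition_minor[OF J]]]
    show ?thesis by (simp add: fratio_def npoint_def)
  qed
  moreover have "ratio \<xi> (Fract (const c) 1) (id c)" for c using ratio_Fract[of \<xi> "const c"] by simp
  ultimately show ?thesis
    unfolding transition_hom_eq ev_def eval_poly_def by (intro ratio_sum ratio_mult ratio_prod ratio_power)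
qed

abbreviation ucoeff :: "nat \<Rightarrow> nat \<Rightarrow> cpoly \<Rightarrow> nat \<Rightarrow> cpoly" where
  "ucoeff k n f \<equiv> fps_nth (eval_poly (\<lambda>c. fps_const (const c)) (universal_coord k n) f)"

lemma le_arc_ord_iff:
  "t \<le> arc_ord k n Y (I, P) \<longleftrightarrow> (\<forall>f\<in>chart_ideal k n I Y. \<forall>m. enat m < t \<longrightarrow> ucoeff k n f m \<in> P)"
proof -
  have "t \<le> ord_mod P g \<longleftrightarrow> (\<forall>m. enat m < t \<longrightarrow> fps_nth g m \<in> P)" for g
    unfolding ord_mod_def le_Inf_iff by (auto simp: not_le[symmetric])
  then show ?thesis by (simp add: arc_ord_def le_INF_iff)
qed

lemma arc_ord_mono_prime:
  assumes "P \<subseteq> Q"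
  shows "arc_ord k n Y (I, P) \<le> arc_ord k n Y (I, Q)"
  using le_arc_ord_iff[of "arc_ord k n Y (I, P)" k n Y I P] assms by (auto simp: le_arc_ord_iff)

text \<open>Reduction to closed points. A coefficient that violates the bound becomes a fraction p /
  q with p and q outside P. At a closed specialization \<eta> of P where p, q and the transition
  minor are nonzero, the coefficient does not vanish at the normalized arc, although the matrices of
  the two arcs are row equivalent and have equal contact orders.\<close>

lemma arc_ord_glue:
  assumes gl: "((I, P), (J, Q)) \<in> glue k n" and kn: "0 < k" "k < n" and ab: "a \<in> {1..k}" "b \<in> {1..n - k}"
  shows "arc_ord k n (schubert_rect k n a b) (I, P) \<le> arc_ord k n (schubert_rect k n a b) (J, Q)"
    (is "?t \<le> _")
  unfolding le_arc_ord_iff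
proof (intro ballI allI impI, rule ccontr)
  let ?Y = "schubert_rect k n a b" and ?\<delta> = "transition_minor k n I J"
  fix f m assume f: "f \<in> chart_ideal k n J ?Y" and m: "enat m < ?t" and nQ: "ucoeff k n f m \<notin> Q"
  let ?g = "ucoeff k n f m"
  have I: "I \<in> charts k n" and J: "J \<in> charts k n" and P: "P \<in> prime_spec" and \<delta>: "?\<delta> \<notin> P"
    and Q: "Q = transition_hom k n I J -` local_max_ideal P" using gl by (auto simp: glue_def)
  interpret P: cpoly_prime P using P by (simp add: prime_spec_iff)
  \<comment> \<open>This first closed point only shows that the denominator can be taken outside
    P.\<close>
  obtain \<xi> where \<xi>: "\<And>p. p \<in> P \<Longrightarrow> ev \<xi> p = 0" "ev \<xi> ?\<delta> \<noteq> 0" using exists_point[OF P \<delta>] by blast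
  obtain p q where pq: "transition_hom k n I J ?g = Fract p q" "q \<noteq> 0" "ev \<xi> q \<noteq> 0"
    using ratio_transition[OF I J kn \<xi>(2), of ?g] by (elim ratioE)
  have q: "q \<notin> P" using \<xi>(1) pq(3) by blast
  have p: "p \<notin> P" using nQ q pq(1) unfolding Q local_max_ideal_def by auto
  have "p * q * ?\<delta> \<notin> P" using p q \<delta> P.prime by blast
  then obtain \<eta> where \<eta>: "\<And>p. p \<in> P \<Longrightarrow> ev \<eta> p = 0" "ev \<eta> (p * q * ?\<delta>) \<noteq> 0" using exists_point[OF P] by blast
  then have \<eta>': "ev \<eta> p \<noteq> 0" "ev \<eta> q \<noteq> 0" "ev \<eta> ?\<delta> \<noteq> 0" by auto
  let ?B = "cm k n I (arcc k n \<eta>)"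
  let ?\<zeta> = "npoint k n J ?B"
  obtain p' q' where pq': "transition_hom k n I J ?g = Fract p' q'" "q' \<noteq> 0" "ev \<eta> q' \<noteq> 0" "ev ?\<zeta> ?g * ev \<eta> q' = ev \<eta> p'"
    using ratio_transition[OF I J kn \<eta>'(3), of ?g] by (elim ratioE)
  have "p * q' = p' * q" using pq(1) pq'(1) pq(2) pq'(2) by (simp add: eq_fract)
  then have "ev \<eta> p * ev \<eta> q' = ev \<eta> p' * ev \<eta> q" by (metis ev_mult)
  then have nz: "ev ?\<zeta> ?g \<noteq> 0" using \<eta>' pq'(3,4) by auto
  interpret X: closed_arc k n I \<eta> by unfold_locales (use I kn in auto)
  interpret Z: closed_arc k n J ?\<zeta> by unfold_locales (use J kn in auto)
  have "P \<subseteq> ev_ker \<eta>" using \<eta>(1) by (auto simp: ev_ker_def)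
  then have "?t \<le> arc_ord k n ?Y (I, ev_ker \<eta>)" by (rule arc_ord_mono_prime)
  also have "\<dots> = dord k (k - a + b) (k - a + 1) ?B"
    using X.schubert_ord_closed[OF ab] ab by (simp add: schubert_ord_def)
  also have "\<dots> = dord k (k - a + b) (k - a + 1) (cm k n J (arcc k n ?\<zeta>))"
    by (rule dord_npoint[symmetric, OF J kn(2)]) (use \<eta>'(3) ab kn in \<open>auto simp: ev_transition_minor[OF J]\<close>)
  also have "\<dots> = arc_ord k n ?Y (J, ev_ker ?\<zeta>)"
    using Z.schubert_ord_closed[OF ab] ab by (simp add: schubert_ord_def)
  finally have "?g \<in> ev_ker ?\<zeta>" using f m unfolding le_arc_ord_iff by blast
  then show False using nz by (simp add: ev_ker_def)
qed

lemma eval_poly_var_self: "eval_poly const var p = p"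
proof (induction p rule: cpoly_induct)
  case (single m c)
  have "monom_eval var m = Poly_Mapping.single m 1"
  proof -
    have "(\<Prod>v\<in>S. var v ^ Poly_Mapping.lookup m v) = Poly_Mapping.single (\<Sum>v\<in>S. Poly_Mapping.single v (Poly_Mapping.lookup m v)) 1" for S
    proof (induction S rule: infinite_finite_induct)
      case (insert v S)
      have "var v ^ e = Poly_Mapping.single (Poly_Mapping.single v e) 1" for e
        by (induction e) (simp_all add: var_def mult_single single_add[symmetric])
      then show ?case using insert by (simp add: mult_single)
    qed simp_all
    moreover have "(\<Sum>v\<in>Poly_Mapping.keys m. Poly_Mapping.single v (Poly_Mapping.lookup m v)) = m"
      by (rule poly_mapping_eqI)
        (auto simp: lookup_sum lookup_single when_def in_keys_iff sum.delta)
    ultimately show ?thesis by (simp add: monom_eval_def)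
  qed
  then show ?case by (simp add: eval_poly_single const_def mult_single)
next
  case (add p q)
  then show ?case by (simp add: eval_poly_add[OF const_hom])
qed

lemma ncoord_self:
  fixes X :: "nat \<Rightarrow> 'r::{comm_ring_1,inverse}"
  assumes I: "I \<in> charts k n" and kn: "k < n" and v: "v < k * (n - k)" and inv: "inverse 1 = (1 :: 'r)"
  shows "ncoord k n I (fun_mat k n (cm k n I X)) v = X v"
proof -
  interpret closed_arc k n I "\<lambda>_. 0" by unfold_locales (use I kn in auto)
  let ?M = "fun_mat k n (cm k n I X)"
  have M: "?M \<in> carrier_mat k n" by (simp add: fun_mat_def)
  have one: "submatrix ?M UNIV I = 1\<^sub>m k"
    unfolding submatrix_fun_mat[OF I] by (rule eq_matI) (auto simp: cm_pick[OF I])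
  have adj: "adj_mat (1\<^sub>m k :: 'r mat) = 1\<^sub>m k"
  proof -
    have "1\<^sub>m k * adj_mat (1\<^sub>m k :: 'r mat) = 1 \<cdot>\<^sub>m 1\<^sub>m k" using adj_mat(2)[of "1\<^sub>m k :: 'r mat" k] by simp
    also have "\<dots> = 1\<^sub>m k" by (rule eq_matI) auto
    finally show ?thesis using adj_mat(1)[of "1\<^sub>m k :: 'r mat" k] by simp
  qed
  note e = encode[OF v]
  have "ncoord k n I ?M v = ?M $$ (v div (n - k), ccol v)"
    unfolding ncoord_def Let_def one adj det_one inv ccol_def[symmetric] using e M by simp
  also have "\<dots> = X v" using e by (simp add: fun_mat_def cm_def)
  finally show ?thesis .
qed

text \<open>Puts every point into its own class, so that equality of two values of
  \<open>arc_point\<close> gives back \<open>glue\<close> in both directions.\<close>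

lemma glue_refl:
  assumes I: "I \<in> charts k n" and P: "P \<in> prime_spec" and kn: "0 < k" "k < n"
  shows "((I, P), (I, P)) \<in> glue k n"
proof -
  interpret P: cpoly_prime P using P by (simp add: prime_spec_iff)
  let ?K = "k * (n - k)"
  have "fps_nth (ncoord k n I (fun_mat k n (umat k n I)) (w mod ?K)) (w div ?K) = Fract (var w) 1" for w
  proof -
    have "w mod ?K < ?K" using kn by simp
    then show ?thesis unfolding umat_def
      by (subst ncoord_self[OF I kn(2)]) (simp_all add: universal_coord_def div_mult_mod_eq)
  qed
  then have T: "transition_hom k n I I p = Fract p 1" for p
    using hom_eval_poly[OF Fract_hom, of const var p] by (simp add: transition_hom_eq eval_poly_var_self)
  have "transition_hom k n I I -` local_max_ideal P = P"
  proof (intro equalityI subsetI)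
    fix p assume "p \<in> P"
    then show "p \<in> transition_hom k n I I -` local_max_ideal P"
      using P.one by (auto simp: T local_max_ideal_def)
  next
    fix p assume "p \<in> transition_hom k n I I -` local_max_ideal P"
    then obtain r q where rq: "Fract p 1 = Fract r q" "r \<in> P" "q \<notin> P" by (auto simp: T local_max_ideal_def)
    then have "q \<noteq> 0" using P.zero by auto
    then have "p * q = r" using rq(1) by (simp add: eq_fract)
    then show "p \<in> P" using rq P.prime by blast
  qed
  moreover have "transition_minor k n I I \<notin> P"
  proof -
    have "universal_arc k n I = fun_mat k n (cm k n I (universal_coord k n))"
      by (simp add: universal_arc_def chart_mat_cm fun_mat_def)
    then have "submatrix (universal_arc k n I) UNIV I = 1\<^sub>m k"
      by (simp only: submatrix_fun_mat[OF I]) (rule eq_matI, auto simp: cm_pick[OF I])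
    then show ?thesis using P.one by (simp add: transition_minor_def)
  qed
  ultimately show ?thesis using I P by (simp add: glue_def)
qed

section \<open>Deformation and existence of closed points\<close>

lemma fcont_inverse:
  assumes F: "fcont F" and F0: "fps_nth (F 0) 0 \<noteq> 0"
  shows "fcont (\<lambda>s. inverse (F s))"
  unfolding fcont_def
proof
  fix N
  have c: "isCont (\<lambda>s. fps_nth (F s) m) 0" for m using F by (simp add: fcont_def)
  have i: "isCont (\<lambda>s. inverse (fps_nth (F s) 0)) 0" using c F0 by (intro continuous_at_within_inverse)
  show "isCont (\<lambda>s. fps_nth (inverse (F s)) N) 0"
  proof (induction N rule: less_induct)
    case (less N)
    show ?case
    proof (cases N)
      case 0
      then show ?thesis using i by simp
    next
      case (Suc m)
      have "fps_nth (inverse (F s)) N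
        = - inverse (fps_nth (F s) 0) * (\<Sum>i = 1..N. fps_nth (F s) i * fps_nth (inverse (F s)) (N - i))" for s
        unfolding Suc by (simp add: fps_inverse_def)
      moreover have "isCont (\<lambda>s. - inverse (fps_nth (F s) 0) * (\<Sum>i = 1..N. fps_nth (F s) i * fps_nth (inverse (F s)) (N - i))) 0"
      proof (rule isCont_mult[OF isCont_minus[OF i]])
        have "isCont (\<lambda>s. fps_nth (F s) i * fps_nth (inverse (F s)) (N - i)) 0" if "i \<in> {1..N}" for i
          by (intro isCont_mult c less.IH) (use that in auto)
        then show "isCont (\<lambda>s. \<Sum>i = 1..N. fps_nth (F s) i * fps_nth (inverse (F s)) (N - i)) 0"
          by (rule continuous_sum)
      qed
      ultimately show ?thesis by simp
    qed
  qed
qed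

lemma fcont_ncoord:
  assumes J: "J \<in> charts k n" and kn: "k < n" and B: "\<And>x y. fcont (\<lambda>s. B s x y)"
    and unit: "fps_nth (minor k id (pick J) (B 0)) 0 \<noteq> 0" and v: "v < k * (n - k)"
  shows "fcont (\<lambda>s. ncoord k n J (fun_mat k n (B s)) v)"
proof -
  note e = ncoord_eq[OF J kn v]
  have fm: "fcont (\<lambda>s. minor j f g (B s))" for j f g
    unfolding minor_def by (rule fcont_det) (rule B)
  show ?thesis unfolding e(3)
    by (intro fcont_mult fcont_sum fcont_inverse fm B fcont_const unit)
qed

lemma isCont_ev:
  assumes "\<And>w. isCont (\<lambda>s. y s w) 0"
  shows "isCont (\<lambda>s. ev (y s) f) 0"
  unfolding ev_def eval_poly_def by (intro continuous_intros assms)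

context closed_arc begin

lemma npoint_self:
  assumes k: "0 < k" and B: "\<And>x y. x < k \<Longrightarrow> B x y = A x y"
  shows "npoint k n I B = \<xi>"
proof
  fix w
  let ?m = "k * (n - k)"
  define v where "v = w mod ?m"
  have v: "v < ?m" using k kn by (simp add: v_def)
  have one_inv: "inverse (1 :: complex fps) = 1" by (rule fps_inverse_one)
  have "fun_mat k n B = fun_mat k n A" unfolding fun_mat_def by (rule eq_matI) (auto simp: B)
  then have "ncoord k n I (fun_mat k n B) v = arcc k n \<xi> v" using ncoord_self[OF I kn v one_inv] by simp
  then show "npoint k n I B w = \<xi> w" by (simp add: npoint_def arcc_def v_def div_mult_mod_eq)
qed

text \<open>The normalized coordinates depend continuously on s, and at s = 0 they are \<xi> itself;
  so the open conditions persist.\<close>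

lemma near:
  assumes k: "0 < k" and B: "\<And>x y. fcont (\<lambda>s. B s x y)" and B0: "\<And>x y. x < k \<Longrightarrow> B 0 x y = A x y"
    and f: "ev \<xi> f \<noteq> 0"
  shows "eventually (\<lambda>s. ev (npoint k n I (B s)) f \<noteq> 0) (at 0)"
    and "eventually (\<lambda>s. fps_nth (minor k id (pick I) (B s)) 0 \<noteq> 0) (at 0)"
proof -
  have "minor k id (pick I) (B 0) = minor k id (pick I) A"
    by (rule minor_cong) (simp add: B0)
  then have unit: "fps_nth (minor k id (pick I) (B 0)) 0 \<noteq> 0" by (simp add: A_pick_unit)
  have "fcont (\<lambda>s. minor k id (pick I) (B s))" unfolding minor_def by (rule fcont_det) (rule B)
  then show "eventually (\<lambda>s. fps_nth (minor k id (pick I) (B s)) 0 \<noteq> 0) (at 0)"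
    using unit by (rule eventually_nth_ne)
  have "isCont (\<lambda>s. npoint k n I (B s) w) 0" for w
  proof -
    have "w mod (k * (n - k)) < k * (n - k)" using k kn by simp
    from fcont_ncoord[where B = B, OF I kn B unit this] show ?thesis by (simp add: npoint_def fcont_def)
  qed
  then have "isCont (\<lambda>s. ev (npoint k n I (B s)) f) 0" by (rule isCont_ev)
  moreover have "ev (npoint k n I (B 0)) f \<noteq> 0" using f by (simp add: npoint_self[OF k B0])
  ultimately show "eventually (\<lambda>s. ev (npoint k n I (B s)) f \<noteq> 0) (at 0)"
    unfolding isCont_def by (intro tendsto_imp_eventually_ne)
qed

text \<open>A choice of Smith exponents of the first c columns; \<open>dord_inv_fact\<close>
  determines those of index below min k c.\<close>

definition inv_fact :: "nat \<Rightarrow> nat \<Rightarrow> enat" where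
  "inv_fact c = (SOME \<kappa>. \<exists>U U' V V'. smith_form k c A U U' V V' \<kappa>)"

lemma inv_fact: "\<exists>U U' V V'. smith_form k c A U U' V V' (inv_fact c)"
proof -
  have "\<exists>\<kappa> U U' V V'. smith_form k c A U U' V V' \<kappa>" using smith_form_exists by blast
  then show ?thesis unfolding inv_fact_def by (rule someI_ex)
qed

lemma mono_inv_fact: "mono (inv_fact c)"
  using inv_fact[of c] by (auto simp: smith_form_def)

lemma dord_inv_fact: "j \<le> min k c \<Longrightarrow> dord k c j A = (\<Sum>i<j. inv_fact c i)"
  using inv_fact[of c] smith_form.dord_eq by blast

lemma profile_inv_fact:
  "i \<in> {1..k} \<Longrightarrow> j \<in> {1..n - k} \<Longrightarrow> profile k n (I, ev_ker \<xi>) i j = inv_fact (k - i + j) (k - i)"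
  by (rule profile_closed) (auto simp: mono_inv_fact intro!: dord_inv_fact)

text \<open>The first c columns have rank at least k - (n - c) modulo t, so that many of their
  exponents are 0.\<close>

lemma inv_fact_0:
  assumes "i < k" "c \<le> n" "n - k < c - i"
  shows "inv_fact c i = 0"
proof -
  have "dord k (n - (n - c)) (k - (n - c)) A = 0" by (rule dord_deleted) (use assms in auto)
  moreover have "k - (n - c) \<le> min k c" "c = n - (n - c)" using assms kn by auto
  ultimately have "(\<Sum>x<k - (n - c). inv_fact c x) = 0"
    using dord_inv_fact[of "k - (n - c)" c] by metis
  then show ?thesis using assms by simp
qed

end

text \<open>Carries out the deformation near one closed point inside the basic open set of f, so it
  yields points of the larger stratum in every neighbourhood. Positive fall makes the corner entry g
  of \<beta> finite; with the box added, the exponent to be lowered is g + 1.\<close>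

lemma deform:
  assumes k0: "0 < k" and kn: "k < n" and pp: "plane_partition k (n - k) \<beta>"
    and ab: "1 \<le> a" "a \<le> k" "1 \<le> b" "b \<le> n - k"
    and pl: "has_plateau \<beta> a b h" and fall: "0 < plateau_fall \<beta> a b h"
    and I: "I \<in> charts k n"
    and prof: "\<And>i j. i \<in> {1..k} \<Longrightarrow> j \<in> {1..n - k} \<Longrightarrow> profile k n (I, ev_ker \<xi>) i j = add_box \<beta> a b i j"
    and f: "ev \<xi> f \<noteq> 0"
  obtains \<eta> where "ev \<eta> f \<noteq> 0"
    "\<And>i j. i \<in> {1..k} \<Longrightarrow> j \<in> {1..n - k} \<Longrightarrow> profile k n (I, ev_ker \<eta>) i j = \<beta> i j"
proof -
  interpret closed_arc k n I \<xi> by unfold_locales (use I kn in auto)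
  define r where "r = k - a"
  define c where "c = k - a + b"
  obtain g where g: "\<beta> a b = enat g" using fall by (cases "\<beta> a b"; cases h) (auto simp: plateau_fall_def split: if_splits)
  have gh: "enat (Suc g) \<le> h" using fall g by (cases h) (auto simp: plateau_fall_def zero_enat_def)
  have row: "\<beta> i j' \<le> \<beta> i j" if "1 \<le> i" "i \<le> k" "1 \<le> j" "j \<le> j'" "j' \<le> n - k" for i j j'
    using pp that unfolding plane_partition_def by simp
  have clm: "\<beta> i' j \<le> \<beta> i j" if "1 \<le> j" "j \<le> n - k" "1 \<le> i" "i \<le> i'" "i' \<le> k" for i i' j
    using pp that unfolding plane_partition_def by simp
  have small: "\<beta> i j \<le> enat g" if "a \<le> i" "i \<le> k" "b \<le> j" "j \<le> n - k" for i j
  proof -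
    have "\<beta> i j \<le> \<beta> a j" by (rule clm) (use that ab in auto)
    also have "\<dots> \<le> \<beta> a b" by (rule row) (use that ab in auto)
    finally show ?thesis unfolding g .
  qed
  have flat: "\<beta> i j = h" if "1 \<le> i" "i \<le> a" "1 \<le> j" "j \<le> b" "(i, j) \<noteq> (a, b)" for i j
    using pl that unfolding has_plateau_def by simp
  \<comment> \<open>The exponent number i of the first c' columns sits at position (k - i, c' - i);
    in particular \<open>inv_fact c r\<close> is the corner.\<close>
  have K: "inv_fact c' i = add_box \<beta> a b (k - i) (c' - i)" if "i < k" "i < c'" "c' - i \<le> n - k" for c' i
    using profile_inv_fact[of "k - i" "c' - i"] prof[of "k - i" "c' - i"] that by simp
  have K': "inv_fact c' i \<le> enat g" if "i < k" "i < c'" "c' \<le> n" "a \<le> k - i" "b \<le> c' - i" "(k - i, c' - i) \<noteq> (a, b)" for c' i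
  proof (cases "c' - i \<le> n - k")
    case True
    then show ?thesis using K[OF that(1,2) True] that small[of "k - i" "c' - i"] by (auto simp: add_box_def)
  qed (use inv_fact_0[of i c'] that in auto)
  have Kh: "inv_fact c' i = h" if "i < k" "i < c'" "k - i \<le> a" "c' - i \<le> b" "(k - i, c' - i) \<noteq> (a, b)" for c' i
    using K[of i c'] that ab flat[of "k - i" "c' - i"] by (auto simp: add_box_def)
  have r: "r < k" "r < c" "c < n" "k - r = a" "c - r = b" using ab kn by (auto simp: r_def c_def)
  have Kr: "inv_fact c r = enat (Suc g)"
    using K[of r c] r ab g by (simp add: add_box_def one_enat_def)
  obtain U U' V V' where sf: "smith_form k c A U U' V V' (inv_fact c)" using inv_fact by blast
  obtain B where B: "\<And>x y. fcont (\<lambda>s. B s x y)" "\<And>x y. x < k \<Longrightarrow> B 0 x y = A x y"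
    "eventually (\<lambda>s. \<forall>j\<le>min k c. dord k c j (B s) = (\<Sum>i<j. ((inv_fact c)(r := enat (Suc g - 1))) i)) (at 0)"
    "\<And>c' j. c' \<noteq> c \<Longrightarrow> eventually (\<lambda>s. dord k c' j (B s) = dord k c' j A) (at 0)"
  \<comment> \<open>The remaining inequalities concern the four neighbours of the corner: (a, b + 1)
    and (a + 1, b) have entries at most g, and (a - 1, b) and (a, b - 1) lie on the plateau and have
    entry h. A neighbour in column n - k + 1 counts as 0 by \<open>inv_fact_0\<close>.\<close>
  proof (rule wedge_exists[OF sf r(1,2) Kr, of h])
    show "inv_fact c i \<le> enat (Suc g - 1)" if "i < r" for i
      using K'[of i c] that r ab by (auto simp: r_def c_def)
    show "inv_fact c i = h" if "r < i" "i < min k c" for i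
      by (rule Kh) (use that r in auto)
    show "dord k (Suc c) (Suc r) A \<le> dord k (Suc c) r A + enat (Suc g - 1)"
      using K'[of r "Suc c"] r dord_inv_fact[of "Suc r" "Suc c"] dord_inv_fact[of r "Suc c"]
      by (auto simp: add_mono Suc_diff_le)
    show "dord k (Suc c) (Suc r) A + h \<le> dord k (Suc c) (Suc (Suc r)) A" if "Suc r < k"
      using Kh[of "Suc r" "Suc c"] r that dord_inv_fact[of "Suc r" "Suc c"] dord_inv_fact[of "Suc (Suc r)" "Suc c"]
      by (auto simp: add_mono)
    show "dord k (c - 1) r A \<le> dord k (c - 1) (r - 1) A + enat (Suc g - 1)" if r0: "0 < r"
    proof -
      obtain r' where r': "r = Suc r'" using r0 by (cases r) auto
      have b: "c - 1 - r' = b" "k - r' = Suc a" using r r' by auto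
      have "inv_fact (c - 1) r' \<le> enat g" by (rule K') (use r r' ab b in auto)
      then show ?thesis
        using r r' ab dord_inv_fact[of r "c - 1"] dord_inv_fact[of r' "c - 1"] by (auto simp: add_mono)
    qed
    show "dord k (c - 1) r A + h \<le> dord k (c - 1) (Suc r) A" if "Suc r < c"
    proof -
      have "inv_fact (c - 1) r = h" by (rule Kh) (use r that ab in auto)
      then show ?thesis using r that dord_inv_fact[of r "c - 1"] dord_inv_fact[of "Suc r" "c - 1"] by simp
    qed
  qed (simp, rule that, assumption+)
  let ?\<kappa> = "(inv_fact c)(r := enat g)"
  have "eventually (\<lambda>s. \<forall>c'\<in>{..n} - {c}. \<forall>j\<in>{..k}. dord k c' j (B s) = dord k c' j A) (at 0)"
    by (intro eventually_ball_finite ballI B(4)) auto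
  with near[OF k0 B(1,2) f] B(3)
  have "eventually (\<lambda>s. ev (npoint k n I (B s)) f \<noteq> 0 \<and> fps_nth (minor k id (pick I) (B s)) 0 \<noteq> 0 \<and>
    (\<forall>j\<le>min k c. dord k c j (B s) = (\<Sum>i<j. ?\<kappa> i)) \<and>
    (\<forall>c'\<in>{..n} - {c}. \<forall>j\<in>{..k}. dord k c' j (B s) = dord k c' j A)) (at 0)"
    by (simp add: eventually_conj_iff)
  then obtain s where s: "ev (npoint k n I (B s)) f \<noteq> 0" "fps_nth (minor k id (pick I) (B s)) 0 \<noteq> 0"
    "\<forall>j\<le>min k c. dord k c j (B s) = (\<Sum>i<j. ?\<kappa> i)"
    "\<forall>c'\<in>{..n} - {c}. \<forall>j\<in>{..k}. dord k c' j (B s) = dord k c' j A"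
    using eventually_happens' at_neq_bot by blast
  let ?\<eta> = "npoint k n I (B s)"
  interpret Y: closed_arc k n I ?\<eta> by unfold_locales (use I kn in auto)
  have "profile k n (I, ev_ker ?\<eta>) i j = \<beta> i j" if ij: "i \<in> {1..k}" "j \<in> {1..n - k}" for i j
  proof (cases "k - i + j = c")
    case False
    have "profile k n (I, ev_ker ?\<eta>) i j = inv_fact (k - i + j) (k - i)"
    proof (rule Y.profile_closed[OF ij mono_inv_fact])
      fix l assume l: "l \<le> min k (k - i + j)"
      have "dord k (k - i + j) l Y.A = dord k (k - i + j) l (B s)"
        by (rule dord_npoint[OF I kn s(2)]) (use ij in auto)
      also have "\<dots> = dord k (k - i + j) l A" using s(4) False ij l by auto
      also have "\<dots> = (\<Sum>x<l. inv_fact (k - i + j) x)" by (rule dord_inv_fact[OF l])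
      finally show "dord k (k - i + j) l Y.A = (\<Sum>x<l. inv_fact (k - i + j) x)" .
    qed
    then show ?thesis using profile_inv_fact[OF ij] prof[OF ij] False by (auto simp: add_box_def c_def split: if_splits)
  next
    case True
    \<comment> \<open>Lowering the entry at r from g + 1 to g keeps the order because all earlier
      exponents are at most g.\<close>
    have "mono ?\<kappa>"
    proof (rule monoI)
      fix x y :: nat assume "x \<le> y"
      have "inv_fact c x \<le> enat g" if "x < r" using K'[of x c] that r ab by (auto simp: r_def c_def)
      moreover have "enat g \<le> inv_fact c y" if "r \<le> y"
        using monoD[OF mono_inv_fact that, of c] Kr by (metis enat_ord_simps(1) le_SucI order_refl order_trans)
      ultimately show "?\<kappa> x \<le> ?\<kappa> y" using \<open>x \<le> y\<close> monoD[OF mono_inv_fact \<open>x \<le> y\<close>, of c]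
        by (cases "x = r"; cases "y = r") auto
    qed
    then have "profile k n (I, ev_ker ?\<eta>) i j = ?\<kappa> (k - i)"
    proof (rule Y.profile_closed[OF ij])
      fix l assume l: "l \<le> min k (k - i + j)"
      have "dord k (k - i + j) l Y.A = dord k (k - i + j) l (B s)"
        by (rule dord_npoint[OF I kn s(2)]) (use ij in auto)
      also have "\<dots> = (\<Sum>x<l. ?\<kappa> x)" using s(3) l unfolding True by blast
      finally show "dord k (k - i + j) l Y.A = (\<Sum>x<l. ?\<kappa> x)" .
    qed
    also have "\<dots> = \<beta> i j"
    proof (cases "i = a")
      case i: True
      then have "j = b" using True by (simp add: c_def)
      then show ?thesis using i by (simp add: r_def g)
    next
      case False
      then have "k - i \<noteq> r" using ij ab by (auto simp: r_def)
      then show ?thesis using profile_inv_fact[OF ij] prof[OF ij] False True by (auto simp: add_box_def)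
    qed
    finally show ?thesis .
  qed
  with s(1) show ?thesis by (rule that)
qed

text \<open>The Smith exponents of the first \<open>c\<close> columns of a matrix with profile \<open>\<beta>\<close>; columns
  beyond the \<open>n - k\<close> of \<open>\<beta>\<close> contribute zeros, and rows or columns that do not exist infinities.\<close>

definition exponent :: "nat \<Rightarrow> nat \<Rightarrow> (nat \<Rightarrow> nat \<Rightarrow> enat) \<Rightarrow> nat \<Rightarrow> nat \<Rightarrow> enat" where
  "exponent k n \<beta> c i = (if c \<le> i \<or> k \<le> i then \<infinity> else if n - k < c - i then 0 else \<beta> (k - i) (c - i))"

text \<open>Monotonicity along the rows and the columns of \<beta> becomes the two interlacing
  inequalities between the exponents of c and of c + 1 columns; the infinite values outside the
  matrix are compatible with both.\<close>

lemma exponent_interlace: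
  assumes "plane_partition k (n - k) \<beta>"
  shows "mono (exponent k n \<beta> c)"
    and "exponent k n \<beta> (Suc c) i \<le> exponent k n \<beta> c i"
    and "exponent k n \<beta> c i \<le> exponent k n \<beta> (Suc c) (Suc i)"
proof -
  have row: "\<beta> i j' \<le> \<beta> i j" if "1 \<le> i" "i \<le> k" "1 \<le> j" "j \<le> j'" "j' \<le> n - k" for i j j'
    using assms that unfolding plane_partition_def by simp
  have clm: "\<beta> i' j \<le> \<beta> i j" if "1 \<le> j" "j \<le> n - k" "1 \<le> i" "i \<le> i'" "i' \<le> k" for i i' j
    using assms that unfolding plane_partition_def by simp
  show "exponent k n \<beta> (Suc c) i \<le> exponent k n \<beta> c i"
    unfolding exponent_def by (auto intro!: row)
  show 3: "exponent k n \<beta> c i \<le> exponent k n \<beta> (Suc c) (Suc i)" for c i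
    unfolding exponent_def by (auto intro!: clm)
  show "mono (exponent k n \<beta> c)" unfolding mono_iff_le_Suc
  proof
    fix i
    have "exponent k n \<beta> (Suc c) (Suc i) \<le> exponent k n \<beta> c (Suc i)"
      unfolding exponent_def by (auto intro!: row)
    with 3 show "exponent k n \<beta> c i \<le> exponent k n \<beta> c (Suc i)" by (rule order_trans)
  qed
qed

section \<open>Construction of an arc with a given profile\<close>

locale interlacing =
  fixes \<kappa> \<kappa>' :: "nat \<Rightarrow> enat"
  assumes mono: "mono \<kappa>" "mono \<kappa>'" and le: "\<kappa>' i \<le> \<kappa> i" and le_Suc: "\<kappa> i \<le> \<kappa>' (Suc i)"
begin

text \<open>The order of the i-th entry of the new column: chosen so that the minor made of i
  diagonal entries and this entry has the order required of the first i + 1 new exponents.\<close>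

definition "\<nu> i = (\<Sum>l<Suc i. \<kappa>' l) - (\<Sum>l<i. \<kappa> l)"

lemma mono_\<nu>: "mono \<nu>"
  unfolding mono_iff_le_Suc
proof
  fix i
  have *: "p - q \<le> (p + x) - (q + y)" if "y \<le> x" for p q x y :: enat
    using that by (cases p; cases q; cases x; cases y) auto
  show "\<nu> i \<le> \<nu> (Suc i)"
    using *[OF le_Suc[of i], of "\<Sum>l<Suc i. \<kappa>' l" "\<Sum>l<i. \<kappa> l"]
    by (simp only: \<nu>_def sum.lessThan_Suc[of _ "Suc i"] sum.lessThan_Suc[of \<kappa> i])
qed

lemma \<nu>_sum: "\<nu> i + (\<Sum>l<i. \<kappa> l) = (\<Sum>l<Suc i. \<kappa>' l)"
proof -
  have *: "p - q + q = p" if "q \<le> p" for p q :: enat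
    using that by (cases p; cases q) auto
  have "(\<Sum>l<i. \<kappa> l) \<le> (\<Sum>l<i. \<kappa>' (Suc l))" by (intro sum_mono le_Suc)
  also have "\<dots> \<le> (\<Sum>l<Suc i. \<kappa>' l)" unfolding sum.lessThan_Suc_shift by (rule add_increasing) auto
  finally show ?thesis unfolding \<nu>_def by (rule *)
qed

text \<open>Let p be the number of elements of S below q. Those elements are replaced by 0, ..., p -
  1, q by p, and above q the exponents \<kappa> are compared with \<kappa>'. Since p \<le> q and
  \<nu> is monotone, nothing grows, and \<open>\<nu>_sum\<close> absorbs the initial segment into
  \<kappa>'.\<close>

lemma bound:
  assumes S: "finite S" "q \<notin> S" "card S = j - 1" and j: "0 < j"
  shows "(\<Sum>i<j. \<kappa>' i) \<le> \<nu> q + (\<Sum>i\<in>S. \<kappa> i)"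
proof -
  let ?S1 = "S \<inter> {..<q}" and ?S2 = "S \<inter> {q<..}"
  define p where "p = card ?S1"
  have "x < q \<or> q < x" if "x \<in> S" for x using that S(2) by (metis nat_neq_iff)
  then have Su: "S = ?S1 \<union> ?S2" by auto
  have fin: "finite ?S1" "finite ?S2" using S(1) by simp_all
  have "card ?S1 \<le> card {..<q}" by (rule card_mono) simp_all
  then have pq: "p \<le> q" by (simp only: p_def card_lessThan)
  have c2: "p + card ?S2 = j - 1"
  proof -
    have "card S = card (?S1 \<union> ?S2)" by (rule arg_cong[where f = card, OF Su])
    also have "\<dots> = card ?S1 + card ?S2" by (rule card_Un_disjoint) (use fin in auto)
    finally show ?thesis using S(3) by (simp only: p_def)
  qed
  have "(\<Sum>i<j. \<kappa>' i) = (\<Sum>i<card ({..<Suc p} \<union> ?S2). \<kappa>' i)"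
    using c2 j fin pq by (subst card_Un_disjoint) auto
  also have "\<dots> \<le> (\<Sum>i\<in>{..<Suc p} \<union> ?S2. \<kappa>' i)" by (rule sum_ge_initial[OF mono(2)]) (use fin in auto)
  also have "\<dots> = (\<Sum>i<Suc p. \<kappa>' i) + (\<Sum>i\<in>?S2. \<kappa>' i)" using fin pq by (intro sum.union_disjoint) auto
  also have "\<dots> = \<nu> p + (\<Sum>i<p. \<kappa> i) + (\<Sum>i\<in>?S2. \<kappa>' i)" by (simp only: \<nu>_sum)
  also have "\<dots> \<le> \<nu> q + (\<Sum>i\<in>?S1. \<kappa> i) + (\<Sum>i\<in>?S2. \<kappa> i)"
    unfolding p_def by (intro add_mono monoD[OF mono_\<nu>] sum_ge_initial mono fin sum_mono le) (use pq p_def in auto)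
  also have "\<dots> = \<nu> q + (\<Sum>i\<in>S. \<kappa> i)"
  proof -
    have "(\<Sum>i\<in>S. \<kappa> i) = (\<Sum>i\<in>?S1 \<union> ?S2. \<kappa> i)" by (rule arg_cong[where f = "sum \<kappa>", OF Su])
    also have "\<dots> = (\<Sum>i\<in>?S1. \<kappa> i) + (\<Sum>i\<in>?S2. \<kappa> i)" by (rule sum.union_disjoint) (use fin in auto)
    finally show ?thesis by (simp only: add.assoc)
  qed
  finally show ?thesis .
qed

text \<open>\<open>bound\<close> estimates every minor through the new column; the minor of the
  first j - 1 columns and the new one attains the value.\<close>

lemma dord_bordered:
  assumes j: "j \<le> min k (Suc c)"
  shows "dord k (Suc c) j (\<lambda>x y. if y < c then diag \<kappa> x y else tp (\<nu> x)) = (\<Sum>i<j. \<kappa>' i)"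
    (is "dord k (Suc c) j ?T = _")
proof (cases "j = 0")
  case False
  show ?thesis
  proof (rule antisym)
    show "(\<Sum>i<j. \<kappa>' i) \<le> dord k (Suc c) j ?T"
    proof (rule dord_geI)
      fix f g assume fg: "\<forall>a<j. f a < k" "\<forall>b<j. g b < Suc c" "inj_on f {..<j}" "inj_on g {..<j}"
      show "(\<Sum>i<j. \<kappa>' i) \<le> ford (minor j f g ?T)"
      proof (cases "\<exists>l<j. g l = c")
        case True
        then obtain l where l: "l < j" "g l = c" by blast
        have gc: "g a < c" if "a < j" "a \<noteq> l" for a
          using fg(2,4) that l by (metis inj_onD lessThan_iff less_antisym)
        have "minor j f g ?T = minor j g f (\<lambda>x y. ?T y x)" by (rule minor_transpose[symmetric])
        also have "\<dots> = det (mat j j (\<lambda>(a, b). if a = l then tp (\<nu> (f b)) else diag \<kappa> (g a) (f b)))"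
          unfolding minor_def by (intro arg_cong[of _ _ det] eq_matI) (auto simp: l gc diag_def)
        also have "(\<Sum>i<j. \<kappa>' i) \<le> ford \<dots>"
          by (rule det_diag_row_ge[OF fg(4,3) l(1)]) (use False in \<open>auto intro!: bound\<close>)
        finally show ?thesis .
      next
        case none: False
        then have gc: "g b < c" if "b < j" for b using fg(2) that by (metis less_antisym)
        have "(\<Sum>i<j. \<kappa>' i) \<le> (\<Sum>i<j. \<kappa> i)" by (intro sum_mono le)
        also have "\<dots> \<le> ford (minor j f g (diag \<kappa>))" by (rule minor_diag_ge[OF mono(1) fg(3,4)])
        also have "minor j f g (diag \<kappa>) = minor j f g ?T" by (rule minor_cong) (simp add: gc)
        finally show ?thesis .
      qed
    qed
    let ?g = "\<lambda>b. if b = j - 1 then c else b"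
    have "minor j id ?g ?T = minor j ?g id (\<lambda>x y. ?T y x)" by (rule minor_transpose[symmetric])
    also have "\<dots> = det (mat j j (\<lambda>(a, b). if a = j - 1 then tp (\<nu> b) else if a = b then tp (\<kappa> a) else 0))"
      unfolding minor_def by (intro arg_cong[of _ _ det] eq_matI) (use j in \<open>auto simp: diag_def\<close>)
    also have "\<dots> = tp (\<nu> (j - 1)) * (\<Prod>a\<in>{0..<j} - {j - 1}. tp (\<kappa> a))"
      by (rule det_diag_row) (use False in simp)
    also have "{0..<j} - {j - 1} = {..<j - 1}" using False by auto
    finally have e: "minor j id ?g ?T = tp (\<nu> (j - 1)) * (\<Prod>a<j - 1. tp (\<kappa> a))" .
    have "ford (minor j id ?g ?T) = \<nu> (j - 1) + (\<Sum>l<j - 1. \<kappa> l)"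
      unfolding e by (simp add: ford_mult ford_prod)
    also have "\<dots> = (\<Sum>i<j. \<kappa>' i)" unfolding \<nu>_sum using False by simp
    finally show "dord k (Suc c) j ?T \<le> (\<Sum>i<j. \<kappa>' i)"
      using dord_le[of j id k ?g "Suc c" ?T] j by auto
  qed
qed simp

end

text \<open>Subtraction of partial sums fails only when they are infinite, and then both monotone
  sequences are infinite from there on.\<close>

lemma sums_eq_imp_eq:
  fixes \<kappa> \<kappa>' :: "nat \<Rightarrow> enat"
  assumes mono: "mono \<kappa>" "mono \<kappa>'" and eq: "\<And>j. j \<le> m \<Longrightarrow> (\<Sum>i<j. \<kappa> i) = (\<Sum>i<j. \<kappa>' i)" and i: "i < m"
  shows "\<kappa> i = \<kappa>' i"
proof -
  have inf: "\<kappa> i = \<infinity>" if mo: "mono \<kappa>" and su: "(\<Sum>l<i. \<kappa> l) = \<infinity>" for \<kappa> :: "nat \<Rightarrow> enat"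
  proof -
    obtain l where "l < i" "\<kappa> l = \<infinity>" using sum_enat_infinity[OF _ su] by auto
    then show ?thesis using monoD[OF mo, of l i] by simp
  qed
  have s: "(\<Sum>l<i. \<kappa> l) = (\<Sum>l<i. \<kappa>' l)" "(\<Sum>l<i. \<kappa> l) + \<kappa> i = (\<Sum>l<i. \<kappa>' l) + \<kappa>' i"
    using eq[of i] eq[of "Suc i"] i by simp_all
  show ?thesis
  proof (cases "(\<Sum>l<i. \<kappa> l) = \<infinity>")
    case True
    then show ?thesis using inf[OF mono(1)] inf[OF mono(2)] s by simp
  next
    case False
    then show ?thesis using s by (auto simp: enat_add_left_cancel)
  qed
qed

text \<open>One column at a time: in Smith coordinates of the columns built so far, the new column
  has entries t^\<nu> with \<nu> from the interlacing exponents. Earlier blocks of columns are not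
  touched.\<close>

lemma matrix_exists:
  assumes pp: "plane_partition k (n - k) \<beta>"
  shows "\<exists>X. \<forall>c'\<le>c. \<forall>j\<le>min k c'. dord k c' j X = (\<Sum>i<j. exponent k n \<beta> c' i)"
proof (induction c)
  case 0
  show ?case by simp
next
  case (Suc c)
  then obtain X where X: "\<And>c' j. c' \<le> c \<Longrightarrow> j \<le> min k c' \<Longrightarrow> dord k c' j X = (\<Sum>i<j. exponent k n \<beta> c' i)" by blast
  let ?\<kappa> = "exponent k n \<beta> c" and ?\<kappa>' = "exponent k n \<beta> (Suc c)"
  interpret I: interlacing ?\<kappa> ?\<kappa>' by unfold_locales (rule exponent_interlace[OF pp])+
  obtain U U' V V' \<kappa> where "smith_form k c X U U' V V' \<kappa>" using smith_form_exists by blast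
  then interpret S: smith_form k c X U U' V V' \<kappa> .
  have \<kappa>: "\<kappa> i = ?\<kappa> i" if "i < min k c" for i
    by (rule sums_eq_imp_eq[OF S.mono I.mono(1) _ that]) (use X S.dord_eq in simp)
  define Y where "Y x y = (if y < c then X x y else \<Sum>i<k. U x i * tp (I.\<nu> i))" for x y
  \<comment> \<open>The exponents supplied by the Smith form equal the prescribed ones only below
    min k c; since no others occur in the product, the form can be restated with the prescribed
    sequence.\<close>
  have "smith_form k c Y U U' V V' ?\<kappa>"
  proof
    show "Y x y = (\<Sum>i<min k c. U x i * tp (?\<kappa> i) * V i y)" if "x < k" "y < c" for x y
      using S.X_eq[OF that] that by (simp add: Y_def \<kappa>)
  qed (simp_all add: I.mono S.UU' S.U'U S.VV' S.V'V)
  then interpret S': smith_form k c Y U U' V V' ?\<kappa> .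
  have wt: "tp (I.\<nu> i) = (\<Sum>x<k. U' i x * Y x c)" if "i < k" for i
  proof -
    have "(\<Sum>x<k. U' i x * Y x c) = (\<Sum>x<k. \<Sum>l<k. U' i x * U x l * tp (I.\<nu> l))"
      by (simp add: Y_def sum_distrib_left mult.assoc)
    also have "\<dots> = (\<Sum>l<k. (\<Sum>x<k. U' i x * U x l) * tp (I.\<nu> l))"
      unfolding sum_distrib_right by (rule sum.swap)
    also have "\<dots> = (\<Sum>l<k. if l = i then tp (I.\<nu> l) else 0)"
      using that by (intro sum.cong refl) (auto simp: S.U'U)
    finally show ?thesis using that by simp
  qed
  have new: "dord k (Suc c) j Y = (\<Sum>i<j. ?\<kappa>' i)" if "j \<le> min k (Suc c)" for j
    using S'.dord_border_col[of "\<lambda>i. tp (I.\<nu> i)" j] wt I.dord_bordered[OF that] by simp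
  have old: "dord k c' j Y = (\<Sum>i<j. exponent k n \<beta> c' i)" if "c' \<le> c" "j \<le> min k c'" for c' j
  proof -
    have "dord k c' j Y = dord k c' j X" by (rule dord_cong) (use that in \<open>simp add: Y_def\<close>)
    then show ?thesis using X[OF that] by simp
  qed
  show ?case
  proof (intro exI[of _ Y] allI impI)
    fix c' j assume c: "c' \<le> Suc c" "j \<le> min k c'"
    show "dord k c' j Y = (\<Sum>i<j. exponent k n \<beta> c' i)"
    proof (cases "c' = Suc c")
      case True
      then show ?thesis using new c by simp
    qed (use old c in simp)
  qed
qed

text \<open>The minor with arbitrary index functions factors as det F * det Y * det G, where F and G
  only select rows and columns and Y has the columns in increasing order; a unit product has unit
  factors.\<close>

lemma unit_minor_columns:
  fixes X :: "nat \<Rightarrow> nat \<Rightarrow> complex fps"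
  assumes unit: "fps_nth (minor k f g X) 0 \<noteq> 0" and f: "\<And>i. i < k \<Longrightarrow> f i < k" and g: "\<And>i. i < k \<Longrightarrow> g i < n"
  shows "g ` {..<k} \<in> charts k n \<and> fps_nth (minor k id (pick (g ` {..<k})) X) 0 \<noteq> 0"
proof
  let ?J = "g ` {..<k}"
  have "inj_on g {..<k}"
  proof (rule ccontr)
    assume "\<not> inj_on g {..<k}"
    then have "minor k f g X = 0" by (rule minor_noninj_col)
    then show False using unit by simp
  qed
  then have cJ: "card ?J = k" by (simp add: card_image)
  then show "?J \<in> charts k n" using g by (auto simp: charts_def)
  define F where "F = mat k k (\<lambda>(a, l). if l = f a then 1 else 0 :: complex fps)"
  define Y where "Y = mat k k (\<lambda>(a, b). X a (pick ?J b))"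
  define G where "G = mat k k (\<lambda>(l, b). if l = card (?J \<inter> {..<g b}) then 1 else 0 :: complex fps)"
  have carr: "F \<in> carrier_mat k k" "Y \<in> carrier_mat k k" "G \<in> carrier_mat k k"
    by (simp_all add: F_def Y_def G_def)
  have lt: "card (?J \<inter> {..<g b}) < k" if "b < k" for b
  proof -
    have "?J \<inter> {..<g b} \<subset> ?J" using that by auto
    then show ?thesis using psubset_card_mono[of ?J "?J \<inter> {..<g b}"] cJ by simp
  qed
  have FY: "(F * Y) $$ (a, b) = X (f a) (pick ?J b)" if "a < k" "b < k" for a b
  proof -
    have "(F * Y) $$ (a, b) = (\<Sum>l<k. if l = f a then X l (pick ?J b) else 0)"
      unfolding index_mult_sum[OF carr(1,2) that] using that by (intro sum.cong refl) (simp add: F_def Y_def)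
    then show ?thesis using f[OF that(1)] by simp
  qed
  have "F * Y * G = mat k k (\<lambda>(a, b). X (f a) (g b))"
  proof (rule eq_matI)
    fix a b assume "a < dim_row (mat k k (\<lambda>(a, b). X (f a) (g b)))" "b < dim_col (mat k k (\<lambda>(a, b). X (f a) (g b)))"
    then have ab: "a < k" "b < k" by simp_all
    let ?l = "card (?J \<inter> {..<g b})"
    have "(F * Y * G) $$ (a, b) = (\<Sum>l<k. if l = ?l then X (f a) (pick ?J l) else 0)"
      unfolding index_mult_sum[OF mult_carrier_mat[OF carr(1,2)] carr(3) ab] using ab
      by (intro sum.cong refl) (simp add: FY G_def)
    also have "\<dots> = X (f a) (pick ?J ?l)" using lt[OF ab(2)] by simp
    also have "pick ?J ?l = g b" by (rule pick_card_below) (use ab in auto)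
    finally show "(F * Y * G) $$ (a, b) = mat k k (\<lambda>(a, b). X (f a) (g b)) $$ (a, b)" using ab by simp
  qed (use carr in auto)
  then have "minor k f g X = det (F * Y * G)" by (simp add: minor_def)
  also have "\<dots> = det F * det Y * det G" using carr by (simp add: det_mult)
  finally have "fps_nth (det Y) 0 \<noteq> 0" using unit by auto
  then show "fps_nth (minor k id (pick ?J) X) 0 \<noteq> 0" by (simp add: minor_def Y_def)
qed

text \<open>Shows that a stratum is not empty, as strictness requires. For c = n all exponents are
  0, so the matrix has a unit k-minor and spans an arc in the Grassmannian.\<close>

lemma closed_point_exists:
  assumes k0: "0 < k" and kn: "k < n" and pp: "plane_partition k (n - k) \<beta>"
  obtains I \<xi> where "I \<in> charts k n"
    "\<And>i j. i \<in> {1..k} \<Longrightarrow> j \<in> {1..n - k} \<Longrightarrow> profile k n (I, ev_ker \<xi>) i j = \<beta> i j"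
proof -
  obtain X where X: "\<And>c j. c \<le> n \<Longrightarrow> j \<le> min k c \<Longrightarrow> dord k c j X = (\<Sum>i<j. exponent k n \<beta> c i)"
    using matrix_exists[OF pp, of n] by blast
  have "exponent k n \<beta> n i = 0" if "i < k" for i
    using that kn by (auto simp: exponent_def)
  then have "dord k n k X = 0" using X[of n k] kn by simp
  then obtain f g where fg: "\<And>i. i < k \<Longrightarrow> f i < k" "\<And>i. i < k \<Longrightarrow> g i < n" "ford (minor k f g X) = 0"
    using dord_attained[of k n k X] by auto
  define I where "I = g ` {..<k}"
  have I: "I \<in> charts k n" and unit: "fps_nth (minor k id (pick I) X) 0 \<noteq> 0"
    using unit_minor_columns[of k f g X n] fg by (simp_all add: I_def ford_eq_0_iff)
  interpret closed_arc k n I "npoint k n I X" by unfold_locales (use I kn in auto)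
  have "profile k n (I, ev_ker (npoint k n I X)) i j = \<beta> i j" if ij: "i \<in> {1..k}" "j \<in> {1..n - k}" for i j
  proof -
    have "profile k n (I, ev_ker (npoint k n I X)) i j = exponent k n \<beta> (k - i + j) (k - i)"
    proof (rule profile_closed[OF ij exponent_interlace(1)[OF pp]])
      fix l assume l: "l \<le> min k (k - i + j)"
      have c: "k - i + j \<le> n" using ij by auto
      show "dord k (k - i + j) l A = (\<Sum>x<l. exponent k n \<beta> (k - i + j) x)"
        unfolding dord_npoint[OF I kn unit c] by (rule X[OF c l])
    qed
    moreover have "exponent k n \<beta> (k - i + j) (k - i) = \<beta> i j" using ij by (auto simp: exponent_def)
    ultimately show ?thesis by simp
  qed
  with I show ?thesis by (rule that)
qed

section \<open>Closures of contact strata\<close>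

lemma topspace_zariski: "topspace zariski = prime_spec"
proof -
  have "1 \<notin> P" if "P \<in> prime_spec" for P using that by (simp add: prime_spec_iff cpoly_prime.one)
  then show ?thesis unfolding zariski_def topology_generated_by_topspace by auto
qed

lemma openin_zariski_basic: "openin zariski {P \<in> prime_spec. f \<notin> P}"
  unfolding zariski_def by (rule topology_generated_by_Basis) simp

text \<open>The generating sets form a basis: by primality the sets of f and of g meet in the set of
  f * g.\<close>

lemma openin_zariskiD:
  assumes "openin zariski U" "P \<in> U"
  shows "\<exists>f. f \<notin> P \<and> {Q \<in> prime_spec. f \<notin> Q} \<subseteq> U"
proof -
  have "generate_topology_on (range (\<lambda>f. {P \<in> prime_spec. f \<notin> P})) U"
    using assms(1) by (simp add: zariski_def openin_topology_generated_by_iff)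
  then show ?thesis using assms(2)
  proof (induction arbitrary: P rule: generate_topology_on.induct)
    case (Int U V)
    obtain f g where f: "f \<notin> P" "{Q \<in> prime_spec. f \<notin> Q} \<subseteq> U" and g: "g \<notin> P" "{Q \<in> prime_spec. g \<notin> Q} \<subseteq> V"
      using Int by blast
    have "P \<in> prime_spec"
    proof -
      have "U \<subseteq> prime_spec" using openin_subset[of zariski U] Int.hyps(1) topspace_zariski
        by (simp add: zariski_def openin_topology_generated_by_iff)
      then show ?thesis using Int.prems by blast
    qed
    then have "f * g \<notin> P" using f(1) g(1) cpoly_prime.prime by (auto simp: prime_spec_iff)
    moreover have "f * g \<in> Q" if "Q \<in> prime_spec" "f \<in> Q \<or> g \<in> Q" for Q
    proof -
      interpret cpoly_prime Q using that by (simp add: prime_spec_iff)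
      show ?thesis using that(2) absorb absorb_right by blast
    qed
    then have "{Q \<in> prime_spec. f * g \<notin> Q} \<subseteq> U \<inter> V" using f(2) g(2) by blast
    ultimately show ?case by blast
  next
    case (UN K)
    then obtain V where V: "V \<in> K" "P \<in> V" by blast
    obtain f where "f \<notin> P" "{Q \<in> prime_spec. f \<notin> Q} \<subseteq> V" using UN.IH[OF V] by blast
    then show ?case using V(1) by blast
  qed auto
qed

lemma topspace_chart_points: "topspace (chart_points k n) = charts k n \<times> prime_spec"
  by (auto simp: chart_points_def topspace_zariski)

lemma schubert_rect_Suc: "schubert_rect k n (Suc i) (Suc j) \<subseteq> schubert_rect k n i j"
  by (auto simp: schubert_rect_def)

lemma chart_ideal_antimono: "Y \<subseteq> Y' \<Longrightarrow> chart_ideal k n I Y' \<subseteq> chart_ideal k n I Y"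
  by (auto simp: chart_ideal_def)

text \<open>The variety of the larger rectangle is smaller, so its ideal is larger and the infimum
  of orders can only drop.\<close>

lemma schubert_ord_Suc_le: "schubert_ord k n z (Suc i) (Suc j) \<le> schubert_ord k n z i j"
  if "1 \<le> i" "1 \<le> j"
proof (cases "Suc i \<le> k \<and> Suc j \<le> n - k")
  case True
  obtain I P where z: "z = (I, P)" by fastforce
  have "arc_ord k n (schubert_rect k n (Suc i) (Suc j)) z \<le> arc_ord k n (schubert_rect k n i j) z"
    unfolding arc_ord_def z split_conv
    by (rule INF_superset_mono[OF chart_ideal_antimono[OF schubert_rect_Suc] order_refl])
  then show ?thesis using True that by (simp add: schubert_ord_def)
qed (auto simp: schubert_ord_def)

lemma schubert_ord_profile:
  assumes "1 \<le> i" "1 \<le> j"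
  shows "schubert_ord k n z i j = profile k n z i j + schubert_ord k n z (Suc i) (Suc j)"
proof -
  have *: "p = p - q + q" if "q \<le> p" for p q :: enat
    using that by (cases p; cases q) auto
  show ?thesis using *[OF schubert_ord_Suc_le[OF assms]] by (simp add: profile_def)
qed

text \<open>By \<open>schubert_ord_profile\<close> the order at (i, j) is the sum of the profile
  entries down the diagonal from (i, j).\<close>

lemma schubert_ord_cong:
  assumes "1 \<le> i" "1 \<le> j"
    and "\<And>l. i + l \<le> k \<Longrightarrow> j + l \<le> n - k \<Longrightarrow> profile k n z (i + l) (j + l) = profile k n z' (i + l) (j + l)"
  shows "schubert_ord k n z i j = schubert_ord k n z' i j"
  using assms
proof (induction "Suc k - i" arbitrary: i j)
  case 0
  then show ?case by (simp add: schubert_ord_def)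
next
  case (Suc d)
  show ?case
  proof (cases "i \<le> k \<and> j \<le> n - k")
    case True
    have "schubert_ord k n z (Suc i) (Suc j) = schubert_ord k n z' (Suc i) (Suc j)"
    proof (rule Suc.hyps(1))
      fix l assume "Suc i + l \<le> k" "Suc j + l \<le> n - k"
      then show "profile k n z (Suc i + l) (Suc j + l) = profile k n z' (Suc i + l) (Suc j + l)"
        using Suc.prems(3)[of "Suc l"] by simp
    qed (use Suc.hyps(2) in auto)
    then show ?thesis using Suc.prems(3)[of 0] True 
      by (simp add: schubert_ord_profile[OF Suc.prems(1,2), of k n z] schubert_ord_profile[OF Suc.prems(1,2), of k n z'])
  qed (auto simp: schubert_ord_def)
qed

lemma schubert_ord_finite:
  assumes "1 \<le> i" "1 \<le> j"
    and "\<And>l. i + l \<le> k \<Longrightarrow> j + l \<le> n - k \<Longrightarrow> profile k n z (i + l) (j + l) \<noteq> \<infinity>"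
  shows "schubert_ord k n z i j \<noteq> \<infinity>"
  using assms
proof (induction "Suc k - i" arbitrary: i j)
  case 0
  then show ?case by (simp add: schubert_ord_def)
next
  case (Suc d)
  show ?case
  proof (cases "i \<le> k \<and> j \<le> n - k")
    case True
    have "schubert_ord k n z (Suc i) (Suc j) \<noteq> \<infinity>"
    proof (rule Suc.hyps(1))
      fix l assume "Suc i + l \<le> k" "Suc j + l \<le> n - k"
      then show "profile k n z (Suc i + l) (Suc j + l) \<noteq> \<infinity>" using Suc.prems(3)[of "Suc l"] by simp
    qed (use Suc.hyps(2) in auto)
    then show ?thesis using Suc.prems(3)[of 0] True
      by (simp add: schubert_ord_profile[OF Suc.prems(1,2), of k n z] plus_eq_infty_iff_enat)
  qed (auto simp: schubert_ord_def zero_enat_def)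
qed

text \<open>A finite order is witnessed by one coefficient outside P. A closed specialization of P
  at which f and all these witnesses are nonzero has no larger order, and no smaller one because
  orders cannot drop under specialization.\<close>

lemma closed_point_same_orders:
  assumes P: "P \<in> prime_spec" and f: "f \<notin> P" and fin: "finite \<Y>"
  shows "\<exists>\<xi>. ev \<xi> f \<noteq> 0 \<and> (\<forall>Y\<in>\<Y>. arc_ord k n Y (I, ev_ker \<xi>) = arc_ord k n Y (I, P))"
proof -
  interpret P: cpoly_prime P using P by (simp add: prime_spec_iff)
  have "\<exists>w. w \<notin> P \<and> (\<forall>\<xi>. ev \<xi> w \<noteq> 0 \<longrightarrow> arc_ord k n Y (I, ev_ker \<xi>) \<le> arc_ord k n Y (I, P))" for Y
  proof (cases "arc_ord k n Y (I, P)")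
    case (enat m)
    then have "\<not> enat (Suc m) \<le> arc_ord k n Y (I, P)" by simp
    then obtain g m' where g: "g \<in> chart_ideal k n I Y" "enat m' < enat (Suc m)" "ucoeff k n g m' \<notin> P"
      unfolding le_arc_ord_iff by blast
    have "arc_ord k n Y (I, ev_ker \<xi>) \<le> enat m" if "ev \<xi> (ucoeff k n g m') \<noteq> 0" for \<xi>
    proof (rule ccontr)
      assume "\<not> ?thesis"
      then have "enat (Suc m) \<le> arc_ord k n Y (I, ev_ker \<xi>)" by (simp add: Suc_ile_eq)
      then have "ucoeff k n g m' \<in> ev_ker \<xi>" using g(1,2) unfolding le_arc_ord_iff by blast
      then show False using that by (simp add: ev_ker_def)
    qed
    then show ?thesis using g(3) enat by (intro exI[of _ "ucoeff k n g m'"]) simp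
  next
    case infinity
    then show ?thesis using P.one by (intro exI[of _ 1]) simp
  qed
  then obtain w where w: "\<And>Y. w Y \<notin> P" "\<And>Y \<xi>. ev \<xi> (w Y) \<noteq> 0 \<Longrightarrow> arc_ord k n Y (I, ev_ker \<xi>) \<le> arc_ord k n Y (I, P)"
    by metis
  have "(\<Prod>Y\<in>\<Y>. w Y) \<notin> P" using P.prod[OF fin, of w] w(1) by blast
  then have "f * (\<Prod>Y\<in>\<Y>. w Y) \<notin> P" using f P.prime by blast
  then obtain \<xi> where \<xi>: "\<And>p. p \<in> P \<Longrightarrow> ev \<xi> p = 0" "ev \<xi> (f * (\<Prod>Y\<in>\<Y>. w Y)) \<noteq> 0"
    using exists_point[OF P] by blast
  interpret comm_ring_hom "ev \<xi>" by (rule ev_hom)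
  have "ev \<xi> (w Y) \<noteq> 0" if "Y \<in> \<Y>" for Y using \<xi>(2) that fin by (simp add: hom_prod)
  moreover have "P \<subseteq> ev_ker \<xi>" using \<xi>(1) by (auto simp: ev_ker_def)
  ultimately have "arc_ord k n Y (I, ev_ker \<xi>) = arc_ord k n Y (I, P)" if "Y \<in> \<Y>" for Y
    using w(2)[of \<xi> Y] arc_ord_mono_prime[of P "ev_ker \<xi>" k n Y I] that by (intro antisym) auto
  moreover have "ev \<xi> f \<noteq> 0" using \<xi>(2) by auto
  ultimately show ?thesis by blast
qed

lemma closed_point_same_profile:
  assumes P: "P \<in> prime_spec" and f: "f \<notin> P"
  obtains \<xi> where "ev \<xi> f \<noteq> 0" "\<And>i j. profile k n (I, ev_ker \<xi>) i j = profile k n (I, P) i j"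
proof -
  let ?Y = "(\<lambda>(i, j). schubert_rect k n i j) ` ({1..k} \<times> {1..n - k})"
  obtain \<xi> where \<xi>: "ev \<xi> f \<noteq> 0" "\<forall>Y\<in>?Y. arc_ord k n Y (I, ev_ker \<xi>) = arc_ord k n Y (I, P)"
    using closed_point_same_orders[OF P f, of ?Y k n I] by auto
  have "schubert_ord k n (I, ev_ker \<xi>) i j = schubert_ord k n (I, P) i j" for i j
    using \<xi>(2) unfolding schubert_ord_def by auto
  then show ?thesis by (intro that[OF \<xi>(1)]) (simp add: profile_def)
qed

lemma schubert_ord_arc_point:
  assumes z: "z \<in> topspace (chart_points k n)" and z': "z' \<in> topspace (chart_points k n)" and kn: "0 < k" "k < n"
    and eq: "arc_point k n z = arc_point k n z'"
  shows "schubert_ord k n z i j = schubert_ord k n z' i j"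
proof (cases "i \<in> {1..k} \<and> j \<in> {1..n - k}")
  case True
  obtain I P J Q where e: "z = (I, P)" "z' = (J, Q)" by (cases z; cases z')
  have "(z, z) \<in> glue k n" "(z', z') \<in> glue k n"
    using z z' glue_refl[OF _ _ kn] unfolding e topspace_chart_points by auto
  then have "(z, z') \<in> glue k n" "(z', z) \<in> glue k n" using eq by (auto simp: arc_point_def)
  then have "arc_ord k n (schubert_rect k n i j) z = arc_ord k n (schubert_rect k n i j) z'"
    unfolding e using True kn by (intro antisym arc_ord_glue) auto
  then show ?thesis using True by (simp add: schubert_ord_def)
next
  case False
  then show ?thesis by (simp only: schubert_ord_def if_False)
qed

text \<open>Upper semicontinuity on the quotient: D is a union of classes by
  \<open>schubert_ord_arc_point\<close>, and in each chart it is a union of basic open sets, one for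
  each coefficient that may be nonzero below order t.\<close>

lemma openin_arc_space_low_order:
  fixes t :: enat
  assumes kn: "0 < k" "k < n" and ab: "a \<in> {1..k}" "b \<in> {1..n - k}"
  defines "D \<equiv> {z \<in> topspace (chart_points k n). \<not> t \<le> schubert_ord k n z a b}"
  shows "openin (arc_space k n) (arc_point k n ` D)"
proof -
  have "{z \<in> topspace (chart_points k n). arc_point k n z \<in> arc_point k n ` D} = D"
  proof (intro equalityI subsetI)
    fix x assume "x \<in> {z \<in> topspace (chart_points k n). arc_point k n z \<in> arc_point k n ` D}"
    then obtain z where x: "x \<in> topspace (chart_points k n)" and z: "z \<in> D" "arc_point k n x = arc_point k n z" by blast
    have "schubert_ord k n x a b = schubert_ord k n z a b"
      by (rule schubert_ord_arc_point[OF x _ kn z(2)]) (use z(1) in \<open>simp add: D_def\<close>)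
    then show "x \<in> D" using x z(1) by (simp add: D_def)
  next
    fix x assume x: "x \<in> D"
    then have "x \<in> topspace (chart_points k n)" by (simp add: D_def)
    with x show "x \<in> {z \<in> topspace (chart_points k n). arc_point k n z \<in> arc_point k n ` D}" by blast
  qed
  moreover have "openin (chart_points k n) D"
    unfolding chart_points_def openin_sum_topology
  proof (intro conjI ballI)
    show "D \<subseteq> Sigma (charts k n) (topspace \<circ> (\<lambda>_. zariski))"
      by (auto simp: D_def topspace_chart_points topspace_zariski)
    fix I assume I: "I \<in> charts k n"
    have "{P. (I, P) \<in> D} = (\<Union>f\<in>chart_ideal k n I (schubert_rect k n a b). \<Union>m\<in>{m. enat m < t}. {P \<in> prime_spec. ucoeff k n f m \<notin> P})"
      using ab I by (auto simp: D_def topspace_chart_points schubert_ord_def le_arc_ord_iff)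
    then show "openin zariski {P. (I, P) \<in> D}"
      by (simp only:) (intro openin_Union ballI; auto intro!: openin_Union openin_zariski_basic)
  qed
  ultimately show ?thesis
    unfolding arc_space_def openin_quotient_topology by (auto simp: D_def)
qed

theorem theorem8p7:
  fixes k n a b :: nat and \<beta> :: "nat \<Rightarrow> nat \<Rightarrow> enat" and h :: enat
  assumes "0 < k" and "k < n"
    and "plane_partition k (n - k) \<beta>"
    and "1 \<le> a" and "a \<le> k" and "1 \<le> b" and "b \<le> n - k"
    and "has_plateau \<beta> a b h"
    and "0 < plateau_fall \<beta> a b h"
  shows "arc_space k n closure_of contact_stratum k n (add_box \<beta> a b)
           \<subset> arc_space k n closure_of contact_stratum k n \<beta>"
proof -
  let ?\<beta>' = "add_box \<beta> a b" and ?X = "arc_space k n" and ?T = "topspace (chart_points k n)"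
  have topX: "topspace ?X = arc_point k n ` ?T" by (simp add: arc_space_def topspace_quotient_topology)
  have "contact_stratum k n ?\<beta>' \<subseteq> ?X closure_of contact_stratum k n \<beta>"
  proof
    fix p assume "p \<in> contact_stratum k n ?\<beta>'"
    then obtain I P where p: "p = arc_point k n (I, P)" and IP: "(I, P) \<in> ?T"
      and prof: "\<And>i j. i \<in> {1..k} \<Longrightarrow> j \<in> {1..n - k} \<Longrightarrow> profile k n (I, P) i j = ?\<beta>' i j"
      by (auto simp: contact_stratum_def)
    have I: "I \<in> charts k n" and P: "P \<in> prime_spec" using IP by (auto simp: topspace_chart_points)
    show "p \<in> ?X closure_of contact_stratum k n \<beta>"
      unfolding in_closure_of
    proof (intro conjI allI impI)
      show "p \<in> topspace ?X" unfolding topX p using IP by (rule imageI)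
      fix U assume U: "p \<in> U \<and> openin ?X U"
      define W where "W = {z \<in> ?T. arc_point k n z \<in> U}"
      have "openin (chart_points k n) W"
        using U unfolding arc_space_def openin_quotient_topology W_def by blast
      then have "openin zariski {Q. (I, Q) \<in> W}"
        using I unfolding chart_points_def openin_sum_topology by blast
      moreover have "P \<in> {Q. (I, Q) \<in> W}" using IP U p by (simp add: W_def)
      \<comment> \<open>The neighbourhood is shrunk to a basic open set of the chart that contains
        the given point; both the closed point and its deformation stay in this chart.\<close>
      ultimately obtain f where f: "f \<notin> P" "{Q \<in> prime_spec. f \<notin> Q} \<subseteq> {Q. (I, Q) \<in> W}"
        using openin_zariskiD by blast
      obtain \<xi> where \<xi>: "ev \<xi> f \<noteq> 0" "\<And>i j. profile k n (I, ev_ker \<xi>) i j = profile k n (I, P) i j"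
        using closed_point_same_profile[OF P f(1)] by blast
      have \<xi>': "profile k n (I, ev_ker \<xi>) i j = ?\<beta>' i j" if "i \<in> {1..k}" "j \<in> {1..n - k}" for i j
        using \<xi>(2) prof[OF that] by simp
      obtain \<eta> where \<eta>: "ev \<eta> f \<noteq> 0"
        "\<And>i j. i \<in> {1..k} \<Longrightarrow> j \<in> {1..n - k} \<Longrightarrow> profile k n (I, ev_ker \<eta>) i j = \<beta> i j"
        using deform[OF assms I \<xi>' \<xi>(1)] by blast
      have "ev_ker \<eta> \<in> prime_spec" by (simp add: prime_spec_iff cpoly_prime_ev_ker)
      moreover have "f \<notin> ev_ker \<eta>" using \<eta>(1) by (simp add: ev_ker_def)
      ultimately have "(I, ev_ker \<eta>) \<in> W" using f(2) by blast
      then have "arc_point k n (I, ev_ker \<eta>) \<in> U" "arc_point k n (I, ev_ker \<eta>) \<in> contact_stratum k n \<beta>"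
        using \<eta>(2) by (auto simp: W_def contact_stratum_def)
      then show "\<exists>q. q \<in> contact_stratum k n \<beta> \<and> q \<in> U" by blast
    qed
  qed
  then have sub: "?X closure_of contact_stratum k n ?\<beta>' \<subseteq> ?X closure_of contact_stratum k n \<beta>"
    by (rule closure_of_minimal) (rule closedin_closure_of)
  obtain I \<xi> where I: "I \<in> charts k n"
    and prof: "\<And>i j. i \<in> {1..k} \<Longrightarrow> j \<in> {1..n - k} \<Longrightarrow> profile k n (I, ev_ker \<xi>) i j = \<beta> i j"
    using closed_point_exists[OF assms(1-3)] by blast
  define z where "z = (I, ev_ker \<xi>)"
  have z: "z \<in> ?T" using I by (simp add: z_def topspace_chart_points prime_spec_iff cpoly_prime_ev_ker)
  have "arc_point k n z \<in> contact_stratum k n \<beta>" using z prof by (auto simp: contact_stratum_def z_def)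
  moreover have "contact_stratum k n \<beta> \<subseteq> topspace ?X" unfolding topX contact_stratum_def by blast
  ultimately have in_cl: "arc_point k n z \<in> ?X closure_of contact_stratum k n \<beta>"
    using closure_of_subset by blast
  have ab: "a \<in> {1..k}" "b \<in> {1..n - k}" using assms by auto
  have fin: "\<beta> a b \<noteq> \<infinity>" using assms(9) by (cases "\<beta> a b"; cases h) (auto simp: plateau_fall_def split: if_splits)
  have le: "\<beta> (a + l) (b + l) \<le> \<beta> a b" if "a + l \<le> k" "b + l \<le> n - k" for l
  proof -
    have "\<beta> (a + l) (b + l) \<le> \<beta> a (b + l)" using assms(3-7) that unfolding plane_partition_def by simp
    also have "\<dots> \<le> \<beta> a b" using assms(3-7) that unfolding plane_partition_def by simp
    finally show ?thesis .
  qed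
  \<comment> \<open>The order at (a, b) is the sum of \<beta> down the diagonal from the corner,
    whose entries are at most the corner entry, and that entry is finite because the fall is
    positive.\<close>
  have z_fin: "schubert_ord k n z a b \<noteq> \<infinity>"
  proof (rule schubert_ord_finite)
    fix l assume "a + l \<le> k" "b + l \<le> n - k"
    then show "profile k n z (a + l) (b + l) \<noteq> \<infinity>"
      using prof[of "a + l" "b + l"] le[of l] fin ab unfolding z_def by (cases "\<beta> (a + l) (b + l)") auto
  qed (use ab in auto)
  \<comment> \<open>Arcs with order at (a, b) at most that of z. This neighbourhood of z misses the
    smaller stratum, on which the order is larger by one; finiteness of the order puts z itself into
    D.\<close>
  define D where "D = {x \<in> ?T. \<not> eSuc (schubert_ord k n z a b) \<le> schubert_ord k n x a b}"
  have "openin ?X (arc_point k n ` D)"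
    unfolding D_def by (rule openin_arc_space_low_order[OF assms(1,2) ab])
  moreover have "z \<in> D" using z z_fin by (cases "schubert_ord k n z a b") (simp_all add: D_def eSuc_enat)
  moreover have "contact_stratum k n ?\<beta>' \<inter> arc_point k n ` D = {}"
  proof (rule ccontr)
    assume "\<not> ?thesis"
    then obtain p where p: "p \<in> contact_stratum k n ?\<beta>'" "p \<in> arc_point k n ` D" by blast
    obtain x where xT: "x \<in> ?T" and xp: "\<forall>i\<in>{1..k}. \<forall>j\<in>{1..n - k}. profile k n x i j = ?\<beta>' i j" and px: "p = arc_point k n x"
      using p(1) unfolding contact_stratum_def by blast
    obtain y where y: "y \<in> D" "arc_point k n x = arc_point k n y" using p(2) px by blast
    have x: "profile k n x i j = ?\<beta>' i j" if "i \<in> {1..k}" "j \<in> {1..n - k}" for i j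
      using xp that by blast
    \<comment> \<open>The added box changes only the entry at (a, b), so the diagonals agree from (a
      + 1, b + 1) on.\<close>
    have "schubert_ord k n x (Suc a) (Suc b) = schubert_ord k n z (Suc a) (Suc b)"
    proof (rule schubert_ord_cong)
      fix l assume "Suc a + l \<le> k" "Suc b + l \<le> n - k"
      then show "profile k n x (Suc a + l) (Suc b + l) = profile k n z (Suc a + l) (Suc b + l)"
        using x[of "Suc a + l" "Suc b + l"] prof[of "Suc a + l" "Suc b + l"] by (simp add: z_def add_box_def)
    qed simp_all
    then have "schubert_ord k n x a b = \<beta> a b + 1 + schubert_ord k n z (Suc a) (Suc b)"
      using schubert_ord_profile[of a b k n x] x[OF ab] ab by (simp add: add_box_def)
    also have "\<dots> = eSuc (schubert_ord k n z a b)"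
      using schubert_ord_profile[of a b k n z] prof[OF ab] ab by (simp add: z_def eSuc_plus_1 add_ac)
    finally have "eSuc (schubert_ord k n z a b) \<le> schubert_ord k n y a b"
      using schubert_ord_arc_point[OF xT _ assms(1,2) y(2), of a b] y(1) by (simp add: D_def)
    then show False using y(1) by (simp add: D_def)
  qed
  ultimately have "arc_point k n z \<notin> ?X closure_of contact_stratum k n ?\<beta>'"
    unfolding in_closure_of by blast
  with sub in_cl show ?thesis by blast
qed

end
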